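(* Let $\rho\in\mathcal P([0,\infty))$ be absolutely continuous with respect to Lebesgue measure, let $s_1<s_2$ be such that $\rho([0,s_1))=\rho([s_1,s_2))=\rho([s_2,\infty))=\tfrac13$, and let $T$ be the DDI map of $\rho$. Assume that \[ r_2(r_3-r_1)^3 - r_1(r_3+r_2)^3 - r_3(r_1+r_2)^3 \ \ge\ 0 \] for $(\rho\otimes\rho\otimes\rho)$-a.e. $(r_1,r_2,r_3)\in[0,s_1]\times[s_1,s_2]\times[s_2,\infty)$. Then $\gamma=(\mathrm{Id},T,T^2)_\sharp\rho$ is an optimal solution of the radial problem, i.e. $\gamma\in\Pi_3(\rho)$ and \[\int c\,d\gamma=\min_{\gamma'\in\Pi_3(\rho)}\int_{[0,\infty)^3} c\,d\gamma'.\]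
   Context: For $r_1,r_2,r_3\ge 0$ and $(\alpha,\beta)\in\mathbb T^2=(\mathbb R/2\pi\mathbb Z)^2$ let \[C(r_1,r_2,r_3,\alpha,\beta)=\frac{1}{\sqrt{r_1^2+r_2^2-2r_1r_2\cos\alpha}}+\frac{1}{\sqrt{r_1^2+r_3^2-2r_1r_3\cos\beta}}+\frac{1}{\sqrt{r_2^2+r_3^2-2r_2r_3\cos(\alpha-\beta)}}\] (value $+\infty$ if a denominator vanishes); this is the Coulomb cost $\sum_{i<j}|v_i-v_j|^{-1}$ of $v_1=(r_1,0)$, $v_2=r_2(\cos\alpha,\sin\alpha)$, $v_3=r_3(\cos\beta,\sin\beta)$ in $\mathbb R^2$. The radial cost is $c(r_1,r_2,r_3)=\min_{(\alpha,\beta)\in\mathbb T^2}C(r_1,r_2,r_3,\alpha,\beta)$. For $\rho\in\mathcal P([0,\infty))$, $\Pi_3(\rho)$ is the set of Borel probability measures on $[0,\infty)^3$ all three of whose marginals equal $\rho$; the radial problem is minimizing $\int c\,d\gamma$ over $\gamma\in\Pi_3(\rho)$. With $F(r)=\rho([0,r))$ and $F^{-1}$ its generalized inverse, the DDI map is the map $T:[0,\infty)\to[0,\infty)$ with $T(x)=F^{-1}(\tfrac23-F(x))$ for $x\in[0,s_1)$, $T(x)=F^{-1}(\tfrac43-F(x))$ for $x\in[s_1,s_2)$, and $T(x)=F^{-1}(F(x)-\tfrac23)$ for $x\in[s_2,\infty)$; it maps $[0,s_1)$ onto $[s_1,s_2)$ decreasingly, $[s_1,s_2)$ onto $[s_2,\infty)$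 decreasingly and $[s_2,\infty)$ onto $[0,s_1)$ increasingly, preserves $\rho$, and $T^3=\mathrm{Id}$ $\rho$-a.e. *)

theory Defs
  imports "HOL-Probability.Probability"
begin

definition recip_dist :: "real \<Rightarrow> ennreal" where
  "recip_dist d = (if d = 0 then \<infinity> else ennreal (1 / d))"

(* Coulomb cost C(r1,r2,r3,alpha,beta); angles range over R (2pi-periodic, same as the torus) *)
definition coulomb_C :: "real \<Rightarrow> real \<Rightarrow> real \<Rightarrow> real \<Rightarrow> real \<Rightarrow> ennreal" where
  "coulomb_C r1 r2 r3 \<alpha> \<beta> =
     recip_dist (sqrt (r1\<^sup>2 + r2\<^sup>2 - 2 * r1 * r2 * cos \<alpha>))
   + recip_dist (sqrt (r1\<^sup>2 + r3\<^sup>2 - 2 * r1 * r3 * cos \<beta>))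
   + recip_dist (sqrt (r2\<^sup>2 + r3\<^sup>2 - 2 * r2 * r3 * cos (\<alpha> - \<beta>)))"

definition radial_cost :: "real \<times> real \<times> real \<Rightarrow> ennreal" where
  "radial_cost r = (case r of (r1, r2, r3) \<Rightarrow>
      (INF ab \<in> UNIV. coulomb_C r1 r2 r3 (fst ab) (snd ab)))"

definition Pi3 :: "real measure \<Rightarrow> (real \<times> real \<times> real) measure set" where
  "Pi3 \<rho> = {\<gamma>. sets \<gamma> = sets borel \<and> prob_space \<gamma> \<and>
              distr \<gamma> borel (\<lambda>x. fst x) = \<rho> \<and>
              distr \<gamma> borel (\<lambda>x. fst (snd x)) = \<rho> \<and>
              distr \<gamma> borel (\<lambda>x. snd (snd x)) = \<rho>}"

definition cdfF :: "real measure \<Rightarrow> real \<Rightarrow> real" where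
  "cdfF \<rho> r = measure \<rho> {0..<r}"

definition cdfFinv :: "real measure \<Rightarrow> real \<Rightarrow> real" where
  "cdfFinv \<rho> t = Inf {x. 0 \<le> x \<and> t \<le> cdfF \<rho> x}"

definition DDI :: "real measure \<Rightarrow> real \<Rightarrow> real \<Rightarrow> real \<Rightarrow> real" where
  "DDI \<rho> s1 s2 x =
     (if x < s1 then cdfFinv \<rho> (2/3 - cdfF \<rho> x)
      else if x < s2 then cdfFinv \<rho> (4/3 - cdfF \<rho> x)
      else cdfFinv \<rho> (cdfF \<rho> x - 2/3))"

end

theory Submission
  imports Defs
begin

text \<open>
  The cubic condition factors as \<open>y + z\<close> times
  \<open>y z (z - y) - x (y\<^sup>2 + 5 y z + z\<^sup>2) - x\<^sup>3\<close>, and it is the second order condition for the collinear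
  configuration \<open>- y < x < z\<close> to minimise the Coulomb cost over the angles. Bounding \<open>1 / d\<close> from
  below by its tangent as a function of \<open>d\<^sup>2\<close> reduces global minimality to the Cauchy-Schwarz
  inequality in the half angles. So on triples with one point in each third of the mass the radial
  cost is the cost of three points on a line, for which the monotone (DDI) coupling is optimal, with
  explicit potentials obtained by integrating the force along the coupling.

  A triple may however have several points in the same third. With \<open>A\<close>, \<open>B\<close>, \<open>C\<close> the three thirds, the
  potentials on \<open>A\<close>, \<open>B\<close>, \<open>C\<close> are only determined up to constants of sum \<open>0\<close>; they are chosen so that
  the constraints on the triples of type \<open>AAC\<close> and \<open>ACC\<close> become tight. All other constraints then
  follow from seven exchange inequalities such as \<open>AAC + BBC \<ge> 2 ABC\<close>. Integrating the resulting
  potential against an arbitrary plan gives the lower bound that the DDI plan attains.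
\<close>

section \<open>Exchange inequalities\<close>

text \<open>The hypothesis only concerns triples with one point in each third, while a competing
  plan may charge any triple. What helps is that alignment holds for all choices from the three
  thirds at once: every inner radius is at most a twelfth of every outer one and lies below every
  middle one. Two inner points are expensive together, and this surplus pays for the exchanges that
  break up an inner pair. The bound \<open>anti_cost\<close> is too weak for some types. In the
  exchange of \<open>ACC\<close> with \<open>ABB\<close> the loss is of first order in the inner
  radius while the gain may be of second order; the term \<open>2 * curv x z\<close> of
  \<open>bent_cost\<close> removes the first order. For \<open>AAA\<close> and \<open>BBB\<close>,
  three directions cannot be pairwise opposite, which is worth \<open>3/2\<close> times a common
  lower bound of the three coefficients. Constants of sum zero have two degrees of freedom, hence
  two families of constraints can be made tight. Every other constraint then involves an integer
  combination of the two extremal slacks, and this combination dictates which triples its exchange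
  inequality must contain.\<close>

text \<open>
  Convexity of \<open>d\<^sup>2 \<mapsto> 1 / d\<close> gives \<open>1 / d \<ge> 1 / (r + s) + curv r s (1 + cos \<theta>)\<close> for two points with radii
  \<open>r\<close>, \<open>s\<close> at angle \<open>\<theta>\<close>. Minimising the sum of the three bounds over the angles, after lowering the
  coefficient of the pair \<open>(x, y)\<close> to that of \<open>(x, z)\<close>, leads to \<open>bent_cost\<close>.
\<close>

definition anti_cost :: "real \<Rightarrow> real \<Rightarrow> real \<Rightarrow> real" where
  "anti_cost x y z = 1 / (x + y) + 1 / (x + z) + 1 / (y + z)"

definition line_cost :: "real \<Rightarrow> real \<Rightarrow> real \<Rightarrow> real" where
  "line_cost x y z = 1 / (x + y) + 1 / (z - x) + 1 / (y + z)"

definition curv :: "real \<Rightarrow> real \<Rightarrow> real" where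
  "curv r s = r * s / (r + s) ^ 3"

definition bent_cost :: "real \<Rightarrow> real \<Rightarrow> real \<Rightarrow> real" where
  "bent_cost x y z = anti_cost x y z + 2 * curv x z - (curv x z)\<^sup>2 / (2 * curv y z)"

definition aligned :: "real \<Rightarrow> real \<Rightarrow> real \<Rightarrow> bool" where
  "aligned x y z \<longleftrightarrow> x * (y\<^sup>2 + 5 * y * z + z\<^sup>2) + x ^ 3 \<le> y * z * (z - y)"

lemma recip_diff: "0 < a \<Longrightarrow> 0 < b \<Longrightarrow> 1 / a - 1 / b = (b - a) / (a * b)" for a b :: real
  by (simp add: field_simps)

lemma condition_factor:
  "r2 * (r3 - r1)^3 - r1 * (r3 + r2)^3 - r3 * (r1 + r2)^3
    = (r2 + r3) * (r2 * r3 * (r3 - r2) - (r1 * (r2\<^sup>2 + 5 * r2 * r3 + r3\<^sup>2) + r1 ^ 3))" for r1 r2 r3 :: real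
  by (simp add: algebra_simps power2_eq_square power3_eq_cube)

section \<open>Consequences of alignment when the outer radius is scaled to 1\<close>

context
  fixes x y :: real
  assumes x: "0 < x" and y: "0 < y" and Q: "aligned x y 1"
begin

lemma aligned_linear: "x * (1 + 5 * y + y\<^sup>2) \<le> y * (1 - y)"
proof -
  have "x * (y\<^sup>2 + 5 * y + 1) + x ^ 3 \<le> y * (1 - y)" using Q by (simp add: aligned_def)
  moreover have "0 < x ^ 3" by (rule zero_less_power[OF x])
  moreover have "x * (y\<^sup>2 + 5 * y + 1) = x * (1 + 5 * y + y\<^sup>2)" by (simp add: algebra_simps)
  ultimately show ?thesis by linarith
qed

lemma aligned_lt_one: "y < 1"
proof -
  have "0 < x * (1 + 5 * y + y\<^sup>2)" using x y by (simp add: add_pos_pos)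
  with aligned_linear have "0 < y * (1 - y)" by linarith
  thus ?thesis using y by (simp add: zero_less_mult_iff)
qed

lemma aligned_gap: "y\<^sup>2 + 5 * x * y \<le> y - x"
proof -
  have "0 \<le> x * y\<^sup>2" using x by simp
  with aligned_linear show ?thesis by (simp add: algebra_simps power2_eq_square)
qed

lemma aligned_less: "x < y"
proof -
  have "0 < y\<^sup>2 + 5 * x * y" using x y by (simp add: add_pos_pos)
  with aligned_gap show ?thesis by linarith
qed

text \<open>The bound \<open>y * (1 - y) / (1 + 5 * y + y^2)\<close> for \<open>x\<close> stays
  below \<open>1/12\<close> because \<open>13 * y^2 - 7 * y + 1\<close> has negative
  discriminant.\<close>

lemma aligned_le_twelfth: "12 * x \<le> 1"
proof (rule ccontr)
  assume "\<not> ?thesis"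
  hence "12 * x * (1 + 5 * y + y\<^sup>2) > 1 * (1 + 5 * y + y\<^sup>2)"
    by (intro mult_strict_right_mono) (use y in \<open>auto simp: add_pos_nonneg\<close>)
  hence "1 + 5 * y + y\<^sup>2 < 12 * (y * (1 - y))" using aligned_linear by (simp add: algebra_simps)
  moreover have "0 \<le> (13 * y - 7/2)\<^sup>2" by simp
  ultimately show False by (simp add: algebra_simps power2_eq_square)
qed

text \<open>\<open>1 + y^2 >= 2 * y\<close> replaces the factor of \<open>x\<close> in
  \<open>aligned_linear\<close> by \<open>7 * y\<close>. Unlike \<open>1/12\<close>, this bound
  vanishes as \<open>y\<close> tends to \<open>1\<close>, which is needed when the middle and the
  outer radius come close.\<close>

lemma aligned_le_seventh: "7 * x \<le> 1 - y"
proof -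
  have "0 \<le> x * (1 - y)\<^sup>2" using x by simp
  hence "7 * x * y \<le> y * (1 - y)" using aligned_linear by (simp add: algebra_simps power2_eq_square)
  hence "(7 * x) * y \<le> (1 - y) * y" by (simp add: mult.commute mult.left_commute)
  thus ?thesis using y by simp
qed

text \<open>The right side is the second difference of the reciprocal at \<open>2 * x\<close>,
  \<open>x + y\<close>, \<open>2 * y\<close>. Squaring \<open>aligned_gap\<close> bounds its
  numerator, and with the constant \<open>8\<close> the remainder is a perfect square.\<close>

lemma aligned_convexity_gap: "8 * y \<le> 1 / (2 * x) + 1 / (2 * y) - 2 / (x + y)"
proof -
  have e: "1 / (2 * x) + 1 / (2 * y) - 2 / (x + y) = (y - x)\<^sup>2 / (2 * x * y * (x + y))"
    using x y by (simp add: field_simps power2_eq_square)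
  have "(y\<^sup>2 + 5 * x * y)\<^sup>2 \<le> (y - x)\<^sup>2"
    using aligned_gap x y by (intro power_mono) auto
  moreover have "(y\<^sup>2 + 5 * x * y)\<^sup>2 - 8 * y * (2 * x * y * (x + y)) = y\<^sup>2 * (y - 3 * x)\<^sup>2"
    by (simp add: algebra_simps power2_eq_square)
  moreover have "0 \<le> y\<^sup>2 * (y - 3 * x)\<^sup>2" by simp
  ultimately have "8 * y * (2 * x * y * (x + y)) \<le> (y - x)\<^sup>2" by linarith
  thus ?thesis unfolding e using x y by (subst pos_le_divide_eq) auto
qed

text \<open>Once \<open>y - x\<close> is replaced by its lower bound \<open>y^2 + 5 * x * y\<close>,
  the quotient increases with \<open>y / x\<close>; \<open>3/2\<close> is its value at
  \<open>y = x\<close>.\<close>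

lemma aligned_recip_gap: "3 / 2 \<le> 1 / (2 * x) - 1 / (x + y)"
proof -
  have e: "1 / (2 * x) - 1 / (x + y) = (y - x) / (2 * x * (x + y))"
    using x y by (simp add: field_simps)
  have "0 \<le> (y - x) * (y + 3 * x)" using aligned_less x y by simp
  hence "3 / 2 * (2 * x * (x + y)) \<le> y\<^sup>2 + 5 * x * y"
    by (simp add: algebra_simps power2_eq_square)
  hence "3 / 2 * (2 * x * (x + y)) \<le> y - x" using aligned_gap by linarith
  thus ?thesis unfolding e using x y by (subst pos_le_divide_eq) auto
qed

end

text \<open>The difference equals \<open>(q - p) / ((p + s) * (q + s))\<close>, which decreases in
  \<open>s\<close>. This is the device that moves each partner of an exchanged point to its worst
  position.\<close>

lemma recip_diff_mono:
  fixes x p q s :: real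
  assumes "0 < p" "p \<le> q" "0 \<le> x" "x \<le> s"
  shows "1 / (p + s) - 1 / (q + s) \<le> 1 / (p + x) - 1 / (q + x)"
proof -
  have "(q - p) / ((p + s) * (q + s)) \<le> (q - p) / ((p + x) * (q + x))"
    using assms by (intro divide_left_mono mult_mono mult_pos_pos) auto
  thus ?thesis using assms by (simp add: recip_diff)
qed

text \<open>This is the price of putting two points on the same side instead of opposite sides. It
  is about \<open>2 * x\<close>; the excess of \<open>61/30\<close> over \<open>2\<close> absorbs
  the factor \<open>1 / (1 - x^2)\<close>.\<close>

lemma sym_recip_bound:
  fixes x z :: real
  assumes "0 < x" "12 * x \<le> 1" "1 \<le> z"
  shows "1 / (z - x) - 1 / (z + x) \<le> 61 / 30 * x"
proof -
  have "1 / (z - x) - 1 / (z + x) = 2 * x / ((z - x) * (z + x))"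
    using assms by (simp add: recip_diff)
  also have "\<dots> \<le> 2 * x / ((1 - x) * (1 + x))"
    using assms by (intro divide_left_mono mult_mono mult_pos_pos) auto
  also have "\<dots> \<le> 61 / 30 * x"
  proof -
    have "x * x \<le> 1 / 12 * (1 / 12)" using assms by (intro mult_mono) auto
    hence "60 * x \<le> 61 * x * ((1 - x) * (1 + x))"
      using assms by (simp add: algebra_simps)
    thus ?thesis using assms by (subst pos_divide_le_eq) (auto simp: algebra_simps)
  qed
  finally show ?thesis .
qed

text \<open>The pairs \<open>x, X\<close> and \<open>y, Y\<close> become the mixed pairs
  \<open>x, Y\<close> and \<open>X, y\<close>. Two uses of \<open>recip_diff_mono\<close> reduce
  these four terms to the second difference at \<open>2 * X\<close>, \<open>X + y\<close>,
  \<open>2 * y\<close>, worth at least \<open>8 * y\<close>; the losses at \<open>z\<close> and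
  \<open>Z\<close> are below \<open>5 * y\<close>.\<close>

lemma exchange_AAC_BBC_unit:
  fixes x X y Y z Z :: real
  assumes x: "0 < x" "x \<le> X" and y: "0 < y" "y \<le> Y" and Q: "aligned X y 1" and z: "1 \<le> z" "1 \<le> Z"
  shows "line_cost x Y Z + line_cost X y z \<le> anti_cost x X z + anti_cost y Y Z"
proof -
  have X: "0 < X" using x by simp
  note q = aligned_less[OF X y(1) Q] aligned_le_twelfth[OF X y(1) Q] aligned_lt_one[OF X y(1) Q]
  have s1: "1 / (2 * X) - 1 / (X + Y) \<le> 1 / (x + X) - 1 / (x + Y)"
    using recip_diff_mono[of X Y x X] x X q y by (simp add: add.commute)
  have s2: "1 / (X + Y) - 1 / (y + Y) \<le> 1 / (X + y) - 1 / (2 * y)"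
    using recip_diff_mono[of X y y Y] x X q y by (simp add: add.commute)
  have s3: "8 * y \<le> 1 / (2 * X) + 1 / (2 * y) - 2 / (X + y)" by (rule aligned_convexity_gap[OF X y(1) Q])
  have s4: "1 / (z - X) - 1 / (z + X) \<le> 61 / 30 * X" by (rule sym_recip_bound) (use X q z in auto)
  have s5: "1 / (y + z) \<le> 1 / (x + z)" using x y q z by (intro divide_left_mono mult_pos_pos) auto
  have s6: "1 / (Z - x) - 1 / (y + Z) \<le> 12 / 11 * (2 * y)"
  proof -
    have "1 / (Z - x) - 1 / (y + Z) = (x + y) / ((Z - x) * (y + Z))"
      using x y q z by (simp add: recip_diff)
    also have "\<dots> \<le> (2 * y) / ((11 / 12) * 1)"
      using x y q z by (intro frac_le mult_mono) auto
    finally show ?thesis by simp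
  qed
  have e: "anti_cost x X z + anti_cost y Y Z - (line_cost x Y Z + line_cost X y z) =
     (1 / (x + X) - 1 / (x + Y)) - (1 / (X + y) - 1 / (y + Y))
     + (1 / (x + z) - 1 / (y + z)) - (1 / (z - X) - 1 / (z + X)) - (1 / (Z - x) - 1 / (y + Z))"
    by (simp add: anti_cost_def line_cost_def add.commute)
  have "2 / (X + y) = 2 * (1 / (X + y))" by simp
  thus ?thesis using s1 s2 s3 s4 s5 s6 e q X y by linarith
qed


section \<open>Size of the bent correction, and exchanges with few close pairs\<close>

lemma curv_pos: "0 < r \<Longrightarrow> 0 < s \<Longrightarrow> 0 < curv r s"
  by (simp add: curv_def)

lemma curv_le_sq:
  assumes "0 < x" "0 < z" shows "curv x z \<le> x / z\<^sup>2"
proof -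
  have "curv x z = x * z / (x + z) ^ 3" by (simp add: curv_def)
  also have "\<dots> \<le> x * z / z ^ 3"
    using assms by (intro divide_left_mono power_mono mult_pos_pos) auto
  also have "\<dots> = x / z\<^sup>2" using assms by (simp add: power2_eq_square power3_eq_cube)
  finally show ?thesis .
qed

lemma curv_ge_sq:
  assumes "0 < y" "y \<le> z" shows "y / (8 * z\<^sup>2) \<le> curv y z"
proof -
  have "y / (8 * z\<^sup>2) = y * z / (2 * z) ^ 3" using assms by (simp add: power2_eq_square power3_eq_cube)
  also have "\<dots> \<le> y * z / (y + z) ^ 3"
    using assms by (intro divide_left_mono power_mono mult_pos_pos) auto
  also have "\<dots> = curv y z" by (simp add: curv_def)
  finally show ?thesis .
qed

text \<open>With \<open>m = curv x z\<close> and \<open>k = curv y z\<close> the correction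
  \<open>2 * m - m^2 / (2 * k)\<close> is nonnegative as soon as \<open>m <= 4 * k\<close>; the
  factor \<open>2\<close> between \<open>x\<close> and \<open>y\<close> guarantees this.\<close>

lemma bent_cost_ge_anti_cost:
  assumes "0 < x" "2 * x \<le> y" "y \<le> z"
  shows "anti_cost x y z \<le> bent_cost x y z"
proof -
  have p: "0 < curv x z" "0 < curv y z" using assms by (auto intro: curv_pos)
  have "curv x z \<le> x / z\<^sup>2" using assms by (intro curv_le_sq) auto
  also have "\<dots> \<le> 4 * (y / (8 * z\<^sup>2))" using assms by (simp add: divide_right_mono field_simps)
  also have "\<dots> \<le> 4 * curv y z" using assms curv_ge_sq[of y z] by simp
  finally have "curv x z \<le> 4 * curv y z" .
  hence "(curv x z)\<^sup>2 \<le> 4 * curv y z * curv x z" using p by (simp add: power2_eq_square)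
  hence "(curv x z)\<^sup>2 / (2 * curv y z) \<le> 2 * curv x z" using p by (subst pos_divide_le_eq) (auto simp: ac_simps)
  thus ?thesis by (simp add: bent_cost_def)
qed

lemma bent_cost_le:
  assumes "0 < x" "0 < y" "1 \<le> z"
  shows "bent_cost x y z \<le> anti_cost x y z + 2 * x"
proof -
  have "0 < curv y z" using assms by (intro curv_pos) auto
  hence "0 \<le> (curv x z)\<^sup>2 / (2 * curv y z)" by simp
  moreover have "curv x z \<le> x / z\<^sup>2" using assms by (intro curv_le_sq) auto
  moreover have "x / z\<^sup>2 \<le> x / 1" using assms by (intro divide_left_mono) (auto simp: one_le_power)
  ultimately show ?thesis by (simp add: bent_cost_def)
qed

text \<open>The points \<open>1\<close> and \<open>y\<close> trade places. The gain counts two pairs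
  of \<open>y\<close> with inner points, the loss only one, so everything reduces to
  \<open>key\<close>, where the first two inner points sit at \<open>a\<close> and the reciprocals
  of the third are taken at radius \<open>0\<close>.\<close>

lemma exchange_ACC_AAB_unit:
  fixes x0 x1 x2 a y Z :: real
  assumes x: "0 < x0" "x0 \<le> a" "0 < x1" "x1 \<le> a" "0 < x2" "x2 \<le> a"
    and y: "0 < y" and Q: "aligned a y 1" and z: "1 \<le> Z"
  shows "anti_cost x1 x2 1 + line_cost x0 y Z \<le> anti_cost x0 1 Z + anti_cost x1 x2 y"
proof -
  have a: "0 < a" using x by simp
  note q = aligned_less[OF a y Q] aligned_le_twelfth[OF a y Q] aligned_lt_one[OF a y Q]
  have s0: "1 / y - 1 \<ge> 1 / (y + x0) - 1 / (1 + x0)"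
    using recip_diff_mono[of y 1 0 x0] x y q by simp
  have s1: "1 / (y + a) - 1 / (1 + a) \<le> 1 / (y + x1) - 1 / (1 + x1)"
    using recip_diff_mono[of y 1 x1 a] x y q by simp
  have s2: "1 / (y + a) - 1 / (1 + a) \<le> 1 / (y + x2) - 1 / (1 + x2)"
    using recip_diff_mono[of y 1 x2 a] x y q by simp
  have s3: "1 / (Z - x0) - 1 / (Z + x0) \<le> 61 / 30 * x0" by (rule sym_recip_bound) (use x q z in auto)
  have s4: "1 / (y + Z) - 1 / (1 + Z) \<le> 1 / (y + 1) - 1 / 2"
    using recip_diff_mono[of y 1 1 Z] x y q z by simp
  have key: "1 / y - 1 + (1 / (y + 1) - 1 / 2) + 61 / 30 * a \<le> 2 * (1 / (y + a) - 1 / (1 + a))"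
  proof -
    define D where "D = (y + a) * (1 + a)"
    have D: "0 < D" using y a by (simp add: D_def)
    have "a * a \<le> a * y" using a q by (intro mult_left_mono) auto
    hence D1: "D \<le> y + a * (1 + 2 * y)" by (simp add: D_def algebra_simps)
    have gap: "a * (1 + 5 * y) \<le> y * (1 - y)" using aligned_gap[OF a y Q] by (simp add: algebra_simps power2_eq_square)
    have "a * ((1 + 2 * y) * (5 + 4 * y)) * (1 + 5 * y) \<le> y * (5 - 4 * y) * (1 + 5 * y)"
    proof -
      have "a * ((1 + 2 * y) * (5 + 4 * y)) * (1 + 5 * y) = a * (1 + 5 * y) * ((1 + 2 * y) * (5 + 4 * y))"
        by (simp only: mult_ac)
      also have "\<dots> \<le> y * (1 - y) * ((1 + 2 * y) * (5 + 4 * y))"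
        using gap y by (intro mult_right_mono) auto
      also have "\<dots> \<le> y * (5 - 4 * y) * (1 + 5 * y)"
      proof -
        have "0 \<le> (y - 1)\<^sup>2" by simp
        hence "0 \<le> 12 - 14 * y + 8 * y\<^sup>2" using y by (simp add: algebra_simps power2_eq_square)
        hence "0 \<le> y * y * (12 - 14 * y + 8 * y\<^sup>2)" using y by simp
        thus ?thesis by (simp add: algebra_simps power2_eq_square)
      qed
      finally show ?thesis .
    qed
    hence "a * ((1 + 2 * y) * (5 + 4 * y)) \<le> y * (5 - 4 * y)" using y by (simp add: mult_le_cancel_right)
    moreover have "D * (5 + 4 * y) \<le> (y + a * (1 + 2 * y)) * (5 + 4 * y)"
      using D1 y by (intro mult_right_mono) auto
    ultimately have D2: "D * (5 + 4 * y) \<le> 10 * y" by (simp add: algebra_simps)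
    \<comment> \<open>All terms of \<open>key\<close> contain the factor \<open>1 - y\<close> or are
      bounded by it. After dividing it out, \<open>4/5\<close> must dominate \<open>1/2\<close> from
      the pair \<open>y, 1\<close> and \<open>61/210\<close> from the same-side price, bounded
      through \<open>aligned_le_seventh\<close>.\<close>
    have "1 / y + 4/5 = (5 + 4 * y) / (5 * y)" using y by (simp add: field_simps)
    also have "\<dots> \<le> 2 / D" using D y D2 by (simp add: divide_le_eq le_divide_eq mult_ac)
    finally have k: "1 / y + 4/5 \<le> 2 / D" .
    have "1 / (2 * (y + 1)) \<le> 1 / 2" using y by (simp add: field_simps)
    hence "1 / y + 1 / (2 * (y + 1)) + 61 / 210 \<le> 2 / D" using k by linarith
    hence m: "(1 - y) * (1 / y + 1 / (2 * (y + 1)) + 61 / 210) \<le> (1 - y) * (2 / D)"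
      using q by (intro mult_left_mono) auto
    have e1: "(1 - y) * (2 / D) = 2 * (1 / (y + a) - 1 / (1 + a))"
      using y a by (simp add: D_def field_simps)
    have e2: "(1 - y) * (1 / y + 1 / (2 * (y + 1)) + 61 / 210) = 1 / y - 1 + (1 / (y + 1) - 1 / 2) + 61 / 210 * (1 - y)"
      using y by (simp add: field_simps)
    have "61 / 30 * a \<le> 61 / 210 * (1 - y)" using aligned_le_seventh[OF a y Q] by (simp add: field_simps)
    with m[unfolded e1 e2] show ?thesis by linarith
  qed
  have e: "anti_cost x0 1 Z + anti_cost x1 x2 y - (anti_cost x1 x2 1 + line_cost x0 y Z) =
     (1 / (y + x1) - 1 / (1 + x1)) + (1 / (y + x2) - 1 / (1 + x2)) - (1 / (y + x0) - 1 / (1 + x0))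
      - (1 / (Z - x0) - 1 / (Z + x0)) - (1 / (y + Z) - 1 / (1 + Z))"
    by (simp add: anti_cost_def line_cost_def add.commute)
  define u where "u = 1 / (y + a)"
  define v where "v = 1 / (1 + a)"
  have "61 / 30 * x0 \<le> 61 / 30 * a" "2 * (u - v) = 2 * u - 2 * v" using x by simp_all
  thus ?thesis using s0 s1 s2 s3 s4 key e unfolding u_def[symmetric] v_def[symmetric] by linarith
qed

text \<open>For \<open>x1 = x2 = x3\<close> and \<open>x0\<close> near \<open>0\<close> the terms of
  order \<open>1 / x3\<close> cancel in the antipodal costs and the rest is negative. The
  \<open>min\<close> term restores \<open>3/16 * (1 / x3)\<close>, which suffices because
  \<open>1 / x3 >= 12\<close>.\<close>

lemma exchange_ACC_AAA_unit:
  fixes x0 x1 x2 x3 Z :: real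
  assumes x: "0 < x0" "0 < x1" "x1 \<le> x2" "x2 \<le> x3" "12 * x3 \<le> 1" "12 * x0 \<le> 1" and Z: "1 \<le> Z"
  shows "anti_cost x1 x2 1 + anti_cost x3 x0 Z \<le> anti_cost x0 1 Z + anti_cost x1 x2 x3 + 3/2 * min (curv x1 x3) (1 / (8 * x3))"
proof -
  have p: "0 < x2" "0 < x3" using x by auto
  have s1: "1 / (2 * x3) \<le> 1 / (x2 + x3)" using x p by (intro divide_left_mono mult_pos_pos) auto
  have s2: "1 / (2 * x3) \<le> 1 / (x1 + x3)" using x p by (intro divide_left_mono mult_pos_pos) auto
  have lead: "3 / 16 * (1 / x3) \<le> 1 / (x1 + x3) - 1 / (2 * x3) + 3/2 * min (curv x1 x3) (1 / (8 * x3))"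
  proof (cases "curv x1 x3 \<le> 1 / (8 * x3)")
    case True
    define W where "W = (x1 + x3) ^ 3"
    have W: "0 < W" using x p by (simp add: W_def)
    \<comment> \<open>The factor \<open>x3 - x1\<close> shows that \<open>lead\<close> is an
      equality at \<open>x1 = x3\<close>, where \<open>curv x1 x3 = 1 / (8 * x3)\<close>.\<close>
    have "0 \<le> (x3 - x1) * (5 * x3\<^sup>2 + 28 * x1 * x3 + 11 * x1\<^sup>2)" using x p by simp
    also have "\<dots> = 16 * x3 * (x1 + x3)\<^sup>2 - 11 * W + 24 * (x3 * (x1 * x3))"
      by (simp add: W_def algebra_simps power2_eq_square power3_eq_cube)
    finally have "0 \<le> (16 * x3 * (x1 + x3)\<^sup>2 - 11 * W + 24 * (x3 * (x1 * x3))) / (16 * x3 * W)"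
      using W p by simp
    also have "\<dots> = (x1 + x3)\<^sup>2 / W - 11 / 16 * (1 / x3) + 3/2 * (x1 * x3 / W)"
      using W p by (simp add: field_simps)
    also have "(x1 + x3)\<^sup>2 / W = 1 / (x1 + x3)"
      using x p by (simp add: W_def power2_eq_square power3_eq_cube)
    finally have "0 \<le> 1 / (x1 + x3) - 11 / 16 * (1 / x3) + 3/2 * curv x1 x3"
      by (simp add: curv_def W_def)
    moreover have "1 / (2 * x3) = 8 / 16 * (1 / x3)" by simp
    ultimately have "0 \<le> 1 / (x1 + x3) - 1 / (2 * x3) + 3/2 * curv x1 x3 - 3 / 16 * (1 / x3)"
      by linarith
    thus ?thesis using True by (simp add: min_def)
  next
    case False
    thus ?thesis using s2 p by (simp add: min_def)
  qed
  have s3: "12 \<le> 1 / x3" using x p by (simp add: field_simps)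
  have s4: "1 / (x3 + x0) \<le> 1 / x3" using x p by (intro divide_left_mono mult_pos_pos) auto
  have s5: "1 / (x1 + 1) \<le> 1" "1 / (x2 + 1) \<le> 1" using x p by (auto simp: field_simps)
  have s6: "12 / 13 \<le> 1 / (x0 + 1)" using x by (simp add: field_simps)
  have s7: "1 / (x3 + Z) - 1 / (1 + Z) \<le> 1 / 2"
  proof -
    have "1 / (x3 + Z) - 1 / (1 + Z) = (1 - x3) / ((x3 + Z) * (1 + Z))" using x p Z by (simp add: recip_diff)
    also have "\<dots> \<le> 1 / (1 * 2)" using x p Z by (intro frac_le mult_mono) auto
    finally show ?thesis by simp
  qed
  have e: "anti_cost x0 1 Z + anti_cost x1 x2 x3 - (anti_cost x1 x2 1 + anti_cost x3 x0 Z) =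
     1 / (x1 + x3) + 1 / (x2 + x3) - 1 / (x3 + x0) - 1 / (x1 + 1) - 1 / (x2 + 1) + 1 / (x0 + 1)
      - (1 / (x3 + Z) - 1 / (1 + Z))"
    by (simp add: anti_cost_def add.commute)
  have "1 / (2 * x3) = 1 / 2 * (1 / x3)" by simp
  thus ?thesis using s1 lead s3 s4 s5 s6 s7 e by linarith
qed

text \<open>Breaking the pair \<open>x, X\<close> gains \<open>3/2\<close> by
  \<open>aligned_recip_gap\<close>. It pays two losses of at most \<open>1/2\<close> at
  \<open>z\<close> and \<open>Z\<close>, and the small terms \<open>2 * x\<close> and
  \<open>61/30 * X\<close>.\<close>

lemma exchange_BCC_AAC_unit:
  fixes x X a y z Z z' :: real
  assumes x: "0 < x" "x \<le> a" "0 < X" "X \<le> a" and y: "0 < y" and Q: "aligned a y 1"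
    and z: "1 \<le> z" "1 \<le> Z" "1 \<le> z'"
  shows "bent_cost x z Z + line_cost X y z' \<le> anti_cost y z Z + anti_cost x X z'"
proof -
  have a: "0 < a" using x by simp
  note q = aligned_less[OF a y Q] aligned_le_twelfth[OF a y Q] aligned_lt_one[OF a y Q]
  have f: "bent_cost x z Z \<le> anti_cost x z Z + 2 * x" using x z by (intro bent_cost_le) auto
  have s1: "1 / (x + a) - 1 / (y + a) \<le> 1 / (x + X) - 1 / (y + X)"
    using recip_diff_mono[of x y X a] x q by simp
  have s2: "1 / (2 * a) \<le> 1 / (x + a)" using x a by (intro divide_left_mono mult_pos_pos) auto
  have s3: "3 / 2 \<le> 1 / (2 * a) - 1 / (a + y)" by (rule aligned_recip_gap[OF a y Q])
  have s4: "1 / (x + w) - 1 / (y + w) \<le> 1 / 2" if "1 \<le> w" for w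
  proof -
    have "1 / (x + w) - 1 / (y + w) = (y - x) / ((x + w) * (y + w))" using x y that by (simp add: recip_diff)
    also have "\<dots> \<le> y / (1 * (y + 1))" using x y q that by (intro frac_le mult_mono) auto
    also have "\<dots> \<le> 1 / 2" using y q by (simp add: field_simps)
    finally show ?thesis .
  qed
  have s5: "1 / (y + z') \<le> 1 / (x + z')" using x y q z by (intro divide_left_mono mult_pos_pos) auto
  have s6: "1 / (z' - X) - 1 / (z' + X) \<le> 61 / 30 * X" by (rule sym_recip_bound) (use x q z in auto)
  have e: "anti_cost y z Z + anti_cost x X z' - (anti_cost x z Z + line_cost X y z') =
     (1 / (x + X) - 1 / (y + X)) - (1 / (x + z) - 1 / (y + z)) - (1 / (x + Z) - 1 / (y + Z))
     + (1 / (x + z') - 1 / (y + z')) - (1 / (z' - X) - 1 / (z' + X))"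
    by (simp add: anti_cost_def line_cost_def add.commute)
  have "1 / (a + y) = 1 / (y + a)" by (simp add: add.commute)
  thus ?thesis using f s1 s2 s3 s4[of z] s4[of Z] s5 s6 e x q z by linarith
qed

text \<open>A pair of inner points alone costs at least \<open>6\<close>, more than two bent costs
  of at most \<open>8/3\<close> each. No cost of a \<open>CCC\<close> triple appears: this slack
  allows it to be bounded below by \<open>0\<close>.\<close>

lemma exchange_AAC_CCC_unit:
  fixes x X z z1 z2 z3 z4 :: real
  assumes x: "0 < x" "12 * x \<le> 1" "0 < X" "12 * X \<le> 1"
    and z: "1 \<le> z" "1 \<le> z1" "1 \<le> z2" "1 \<le> z3" "1 \<le> z4"
  shows "bent_cost x z1 z2 + bent_cost X z3 z4 \<le> anti_cost x X z"
proof -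
  have b: "bent_cost r p q \<le> 8 / 3" if "0 < r" "12 * r \<le> 1" "1 \<le> p" "1 \<le> q" for r p q
  proof -
    have "1 / (r + p) \<le> 1 / 1" "1 / (r + q) \<le> 1 / 1" "1 / (p + q) \<le> 1 / 2"
      using that by (auto intro!: divide_left_mono)
    moreover have "bent_cost r p q \<le> anti_cost r p q + 2 * r" using that by (intro bent_cost_le) auto
    ultimately show ?thesis using that unfolding anti_cost_def by linarith
  qed
  have "6 \<le> 1 / (x + X)" using x by (simp add: field_simps)
  moreover have "0 \<le> 1 / (x + z)" "0 \<le> 1 / (X + z)" using x z by auto
  moreover have "bent_cost x z1 z2 \<le> 8 / 3" "bent_cost X z3 z4 \<le> 8 / 3" using b x z by auto
  ultimately show ?thesis unfolding anti_cost_def by linarith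
qed


text \<open>The same-side price cancels against \<open>2 * curv x Z\<close> to first order in
  \<open>x\<close>. The remainders are at most \<open>6 * x^2\<close> and \<open>4 * x^2\<close>,
  and alignment makes the gain at least \<open>10 * x^2\<close>, even when \<open>Y\<close> is close
  to \<open>1\<close>.\<close>

lemma exchange_ACC_ABB_C_part:
  fixes x Y Z :: real
  assumes x: "0 < x" and Y: "0 < Y" and Q: "aligned x Y 1" and Z: "1 \<le> Z"
  shows "0 \<le> (1 / (x + 1) - 1 + 1 / Y - 1 / (x + Y)) - (1 / (Z - x) - 1 / (x + Z)) + 2 * curv x Z
            - (curv x Z)\<^sup>2 / (2 * curv 1 Z)"
proof -
  note q = aligned_less[OF x Y Q] aligned_le_twelfth[OF x Y Q] aligned_lt_one[OF x Y Q] aligned_le_seventh[OF x Y Q]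
  have a: "1 / (Z - x) - 1 / (x + Z) - 2 * curv x Z \<le> 6 * x\<^sup>2"
  proof -
    define W where "W = (Z - x) * (x + Z) ^ 3"
    have W: "0 < W" using x q Z by (simp add: W_def)
    have e1: "1 / (Z - x) = (x + Z) ^ 3 / W" using x q Z by (simp add: W_def)
    have e2: "1 / (x + Z) = (Z - x) * (x + Z)\<^sup>2 / W"
      using x q Z by (simp add: W_def power2_eq_square power3_eq_cube)
    have e3: "curv x Z = x * Z * (Z - x) / W" using x q Z by (simp add: W_def curv_def)
    have "1 / (Z - x) - 1 / (x + Z) - 2 * curv x Z
        = ((x + Z) ^ 3 - (Z - x) * (x + Z)\<^sup>2 - 2 * (x * Z * (Z - x))) / W"
      unfolding e1 e2 e3 by (simp add: diff_divide_distrib)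
    also have "(x + Z) ^ 3 - (Z - x) * (x + Z)\<^sup>2 - 2 * (x * Z * (Z - x)) = 2 * x\<^sup>2 * (3 * Z + x)"
      by (simp add: algebra_simps power2_eq_square power3_eq_cube)
    also have "2 * x\<^sup>2 * (3 * Z + x) / W \<le> 6 * x\<^sup>2"
    proof -
      have "1 \<le> (1 - x) * (1 + x)\<^sup>2"
      proof -
        have "0 \<le> x * (1 - x - x * x)" using x q mult_mono[of x "1/12" x "1/12"] by (intro mult_nonneg_nonneg) auto
        thus ?thesis by (simp add: algebra_simps power2_eq_square)
      qed
      also have "\<dots> \<le> (Z - x) * (x + Z)\<^sup>2" using x q Z by (intro mult_mono power_mono) auto
      finally have "1 * (3 * (x + Z)) \<le> (Z - x) * (x + Z)\<^sup>2 * (3 * (x + Z))"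
        using x Z by (intro mult_right_mono) auto
      hence "3 * Z + x \<le> 3 * W" using x by (simp add: W_def power2_eq_square power3_eq_cube mult_ac)
      hence "2 * x\<^sup>2 * (3 * Z + x) \<le> 2 * x\<^sup>2 * (3 * W)" by (intro mult_left_mono) auto
      thus ?thesis using W by (subst pos_divide_le_eq) (auto simp: mult_ac)
    qed
    finally show ?thesis .
  qed
  have b: "(curv x Z)\<^sup>2 / (2 * curv 1 Z) \<le> 4 * x\<^sup>2"
  proof -
    have "curv x Z \<le> x / Z\<^sup>2" using x Z by (intro curv_le_sq) auto
    hence 1: "(curv x Z)\<^sup>2 \<le> (x / Z\<^sup>2)\<^sup>2" using curv_pos[of x Z] x Z by (intro power_mono) auto
    have 2: "1 / (8 * Z\<^sup>2) \<le> curv 1 Z" using Z by (intro curv_ge_sq) auto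
    have "(curv x Z)\<^sup>2 / (2 * curv 1 Z) \<le> (x / Z\<^sup>2)\<^sup>2 / (2 * (1 / (8 * Z\<^sup>2)))"
      using 1 2 Z by (intro frac_le) auto
    also have "\<dots> = 4 * (x\<^sup>2 / Z\<^sup>2)" using Z by (simp add: power2_eq_square)
    also have "\<dots> \<le> 4 * (x\<^sup>2 / 1)" using Z by (intro mult_left_mono divide_left_mono) (auto simp: one_le_power)
    finally show ?thesis by simp
  qed
  have c: "10 * x\<^sup>2 \<le> 1 / (x + 1) - 1 + 1 / Y - 1 / (x + Y)"
  proof -
    have e: "1 / (x + 1) - 1 + 1 / Y - 1 / (x + Y) = x * (1 - Y) * (1 + Y + x) / (Y * (x + Y) * (1 + x))"
    proof -
      have 1: "1 - 1 / (x + 1) = x / (1 + x)" using x by (simp add: field_simps)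
      have 2: "1 / Y - 1 / (x + Y) = x / (Y * (x + Y))" using x Y by (simp add: recip_diff)
      have 3: "x / (Y * (x + Y)) - x / (1 + x) = (x * (1 + x) - x * (Y * (x + Y))) / (Y * (x + Y) * (1 + x))"
        using x Y by (subst diff_frac_eq) auto
      have 4: "x * (1 + x) - x * (Y * (x + Y)) = x * (1 - Y) * (1 + Y + x)" by (simp add: algebra_simps)
      show ?thesis using 1 2 3 unfolding 4 by linarith
    qed
    have "x + Y \<le> 1" using x q by linarith
    hence "10 * Y * (x + Y) * (1 + x) \<le> 10 * Y * 1 * (1 + x)"
      using x Y by (intro mult_right_mono mult_left_mono) auto
    also have "\<dots> \<le> 7 * (1 + Y + x)"
    proof -
      have "x * Y \<le> x * 1" using x q by (intro mult_left_mono) auto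
      thus ?thesis using q by (simp add: algebra_simps)
    qed
    finally have "10 * x * (Y * (x + Y) * (1 + x)) \<le> x * (7 * (1 + Y + x))"
      using x by (simp add: mult_ac)
    hence "x * (10 * x * (Y * (x + Y) * (1 + x))) \<le> x * (x * (7 * (1 + Y + x)))"
      using x by (intro mult_left_mono) auto
    also have "\<dots> = x * ((7 * x) * (1 + Y + x))" by simp
    also have "\<dots> \<le> x * ((1 - Y) * (1 + Y + x))" using x Y q by (intro mult_left_mono mult_right_mono) auto
    finally show ?thesis unfolding e using x Y
      by (subst pos_le_divide_eq) (auto simp: power2_eq_square mult_ac)
  qed
  show ?thesis using a b c by linarith
qed

text \<open>Equivalent to \<open>curv x Y <= 6/5 * curv y Y\<close>, this is the source of
  \<open>7/5 = 2 - 3/5\<close> below. In the gaps \<open>p\<close> and \<open>q\<close> the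
  difference is a sum of visibly nonnegative terms.\<close>

lemma curv_ratio_bound:
  fixes x y Y :: real
  assumes "0 < x" "x \<le> y" "y \<le> Y"
  shows "5 * (x * (y + Y) ^ 3) \<le> 6 * (y * (x + Y) ^ 3)"
proof -
  define q where "q = Y - y"
  define p where "p = y - x"
  have n: "0 \<le> p" "0 \<le> q" "y = x + p" "Y = x + p + q" using assms by (auto simp: p_def q_def)
  have "6 * (y * (x + Y) ^ 3) - 5 * (x * (y + Y) ^ 3) =
     2 * x^4 + 6 * (p\<^sup>2 - x\<^sup>2)\<^sup>2 + 12 * x^3 * q + 24 * x\<^sup>2 * p * q + 6 * x\<^sup>2 * q\<^sup>2 + 2 * x * p^3 + 30 * x * p\<^sup>2 * q
     + 24 * x * p * q\<^sup>2 + x * q^3 + 18 * p^3 * q + 18 * p\<^sup>2 * q\<^sup>2 + 6 * p * q^3"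
    unfolding n by (simp add: algebra_simps power2_eq_square power3_eq_cube power4_eq_xxxx)
  also have "\<dots> \<ge> 0" using n assms by simp
  finally show ?thesis by simp
qed

text \<open>With \<open>w = 1 / (1 + r)\<close>, the tangent of \<open>w^3\<close> at
  \<open>w = 1\<close> leaves \<open>16/5 * w - 14/5\<close>, and \<open>w >= 1 - r\<close>.\<close>

lemma recip_cube_tangent:
  fixes r :: real
  assumes "0 \<le> r"
  shows "2/5 - 16/5 * r \<le> 7/5 * (1 / (1 + r)) ^ 3 - 1 / (1 + r)"
proof -
  define w where "w = 1 / (1 + r)"
  have w: "0 < w" using assms by (simp add: w_def)
  have "1 - r \<le> w" using assms unfolding w_def by (subst pos_le_divide_eq) (auto simp: algebra_simps)
  moreover have "0 \<le> (w - 1)\<^sup>2 * (w + 2)" using w by simp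
  moreover have "(w - 1)\<^sup>2 * (w + 2) = w ^ 3 - 3 * w + 2" by (simp add: algebra_simps power2_eq_square power3_eq_cube)
  ultimately have "2/5 - 16/5 * r \<le> 7/5 * w ^ 3 - w" by linarith
  thus ?thesis by (simp add: w_def)
qed

text \<open>With \<open>r = x / Y\<close>, the following is the second half of the exchange inequality multiplied by
  \<open>Y\<^sup>2 / x\<close>; \<open>g\<close> stands for the gain from the pair terms.\<close>

lemma exchange_psi_far:
  fixes r Y g x :: real
  assumes r: "0 < r" "r \<le> 1" and Y: "0 < Y" "Y \<le> 13/20" and rN: "r * (1 + 5 * Y + Y\<^sup>2) \<le> 1 - Y"
    and x: "0 < x" "12 * x \<le> 1" and g: "(1 + 5 * Y + Y\<^sup>2) * (1 - Y) / (2 * (1 + Y)) \<le> g"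
  shows "0 \<le> - (1 / (1 + r)) + 7/5 * (1 / (1 + r)) ^ 3 - Y\<^sup>2 / (1 - x) + g"
proof -
  define w where "w = 1 / (1 + r)"
  have w: "0 < w" "w \<le> 1" using r by (auto simp: w_def field_simps)
  have x1: "Y\<^sup>2 / (1 - x) \<le> 12/11 * Y\<^sup>2"
  proof -
    have "Y\<^sup>2 / (1 - x) \<le> Y\<^sup>2 / (11/12)" using x by (intro divide_left_mono) auto
    thus ?thesis by simp
  qed
  have "- (1 / (1 + r)) + 7/5 * (1 / (1 + r)) ^ 3 = 7/5 * w ^ 3 - w" by (simp add: w_def)
  moreover have "0 \<le> 7/5 * w ^ 3 - w - 12/11 * Y\<^sup>2 + g"
  \<comment> \<open>For small \<open>Y\<close> the tangent of \<open>w^3\<close> is taken at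
    \<open>1/2\<close>, close to the minimiser of \<open>7/5 * w^3 - w\<close>. For larger
    \<open>Y\<close> alignment forces \<open>r <= 2/15\<close>, so \<open>w\<close> is near
    \<open>1\<close> and the tangent at \<open>1\<close> is better.\<close>
  proof (cases "Y \<le> 1/2")
    case True
    have "0 \<le> (w - 1/2)\<^sup>2 * (w + 1)" using w by simp
    moreover have "(w - 1/2)\<^sup>2 * (w + 1) = w ^ 3 - 3/4 * w + 1/4"
      by (simp add: field_simps power2_eq_square power3_eq_cube)
    ultimately have q: "- 7/20 \<le> 7/5 * w ^ 3 - w" using w by linarith
    have "(7/20 + 12/11 * Y\<^sup>2) * (2 * (1 + Y)) \<le> (1 + 5 * Y + Y\<^sup>2) * (1 - Y)"
    proof -
      have 1: "Y\<^sup>2 \<le> Y * (1/2)" "Y ^ 3 \<le> Y * (1/4)"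
        using True Y mult_mono[of Y "1/2" Y "1/2"] by (auto simp: power2_eq_square power3_eq_cube)
      have "(1 + 5 * Y + Y\<^sup>2) * (1 - Y) - (7/20 + 12/11 * Y\<^sup>2) * (2 * (1 + Y)) = 
         3/10 + 33/10 * Y - 68/11 * Y\<^sup>2 - 35/11 * Y ^ 3"
        by (simp add: field_simps power2_eq_square power3_eq_cube)
      with 1 True Y show ?thesis by linarith
    qed
    hence "7/20 + 12/11 * Y\<^sup>2 \<le> (1 + 5 * Y + Y\<^sup>2) * (1 - Y) / (2 * (1 + Y))"
      using Y by (subst pos_le_divide_eq) auto
    thus ?thesis using q g by linarith
  next
    case False
    have "r * (15/4) \<le> r * (1 + 5 * Y + Y\<^sup>2)"
      using r False mult_mono[of "1/2" Y "1/2" Y] by (intro mult_left_mono) (auto simp: power2_eq_square)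
    hence r2: "r \<le> 2/15" using rN False by linarith
    have q: "- 2/75 \<le> 7/5 * w ^ 3 - w" using recip_cube_tangent[of r] r r2 by (simp add: w_def)
    have "(2/75 + 12/11 * Y\<^sup>2) * (2 * (1 + Y)) \<le> (1 + 5 * Y + Y\<^sup>2) * (1 - Y)"
    proof -
      have 1: "Y\<^sup>2 \<le> Y * (13/20)" "Y ^ 3 \<le> Y * (169/400)"
        using Y mult_mono[of Y "13/20" Y "13/20"] by (auto simp: power2_eq_square power3_eq_cube)
      have "(1 + 5 * Y + Y\<^sup>2) * (1 - Y) - (2/75 + 12/11 * Y\<^sup>2) * (2 * (1 + Y)) = 
         71/75 + 296/75 * Y - 68/11 * Y\<^sup>2 - 35/11 * Y ^ 3"
        by (simp add: field_simps power2_eq_square power3_eq_cube)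
      with 1 Y show ?thesis by linarith
    qed
    hence "2/75 + 12/11 * Y\<^sup>2 \<le> (1 + 5 * Y + Y\<^sup>2) * (1 - Y) / (2 * (1 + Y))"
      using Y by (subst pos_le_divide_eq) auto
    thus ?thesis using q g by linarith
  qed
  ultimately show ?thesis using x1 by linarith
qed

text \<open>At \<open>Y = 1\<close>, \<open>r = 0\<close>, \<open>x = 0\<close> the terms other than
  \<open>g\<close> sum to \<open>-1 + 7/5 - 1 = -3/5\<close>, and the bound on \<open>g\<close>
  reads \<open>7 * (100/289 - 1/4)\<close>, which exceeds \<open>3/5\<close>. The proof expands
  around this point in \<open>d = 1 - Y\<close>. The factor \<open>17/10\<close> comes from assuming
  \<open>y <= 7/10 * Y\<close>.\<close>

lemma exchange_psi_mid:
  fixes r Y g x :: real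
  assumes r: "0 < r" and Y: "13/20 \<le> Y" "Y < 1" and rN: "r * (1 + 5 * Y + Y\<^sup>2) \<le> 1 - Y"
    and x: "0 < x" "7 * x \<le> 1 - Y" "12 * x \<le> 1"
    and g: "(1 + 5 * Y + Y\<^sup>2) * (1 / (17/10 * (1 + 7/10 * Y)) - Y / (2 * (1 + Y))) \<le> g"
  shows "0 \<le> - (1 / (1 + r)) + 7/5 * (1 / (1 + r)) ^ 3 - Y\<^sup>2 / (1 - x) + g"
proof -
  define d where "d = 1 - Y"
  have d: "0 < d" "d \<le> 7/20" "Y = 1 - d" using Y by (auto simp: d_def)
  have N: "1 + 5 * Y + Y\<^sup>2 = 7 - 7 * d + d\<^sup>2" unfolding d by (simp add: algebra_simps power2_eq_square)
  have "r * (9/2) \<le> r * (1 + 5 * Y + Y\<^sup>2)"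
    using r Y mult_mono[of "13/20" Y "13/20" Y] by (intro mult_left_mono) (auto simp: power2_eq_square)
  hence r2: "r \<le> 2/9 * d" using rN d by linarith
  have q: "2/5 - 16/5 * r \<le> - (1 / (1 + r)) + 7/5 * (1 / (1 + r)) ^ 3"
    using recip_cube_tangent[of r] r by simp
  have x1: "Y\<^sup>2 / (1 - x) \<le> Y\<^sup>2 + 12/77 * d"
  proof -
    have "1 / (1 - x) \<le> 1 + 12/11 * x"
    proof -
      have "x * x \<le> x * (1/12)" using x by (intro mult_left_mono) auto
      hence "1 \<le> (1 + 12/11 * x) * (1 - x)" by (simp add: algebra_simps)
      thus ?thesis using x by (subst pos_divide_le_eq) auto
    qed
    hence "Y\<^sup>2 * (1 / (1 - x)) \<le> Y\<^sup>2 * (1 + 12/11 * x)" by (intro mult_left_mono) auto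
    moreover have "Y\<^sup>2 * (12/11 * x) \<le> 1 * (12/11 * x)" using Y x by (intro mult_right_mono) (auto simp: power_le_one)
    moreover have "12/11 * x \<le> 12/77 * d" using x d by simp
    ultimately show ?thesis by (simp add: algebra_simps)
  qed
  have b1: "100/289 * (1 + 7/17 * d) \<le> 1 / (17/10 * (1 + 7/10 * Y))"
  proof -
    have "100/289 * (1 + 7/17 * d) * (17/10 * (1 + 7/10 * Y)) = 1 - (7/17 * d)\<^sup>2"
      unfolding d by (simp add: field_simps power2_eq_square)
    hence "100/289 * (1 + 7/17 * d) * (17/10 * (1 + 7/10 * Y)) \<le> 1" by simp
    thus ?thesis using Y by (subst pos_le_divide_eq) auto
  qed
  have b2: "Y / (2 * (1 + Y)) \<le> 1/4 - d / 8"
  proof -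
    have "(1/4 - d / 8) * (2 * (1 + Y)) - Y = d\<^sup>2 / 4" unfolding d by (simp add: field_simps power2_eq_square)
    hence "Y \<le> (1/4 - d / 8) * (2 * (1 + Y))" using zero_le_power2[of d] by linarith
    thus ?thesis using Y by (subst pos_divide_le_eq) auto
  qed
  have b: "19/200 + 13/50 * d \<le> 1 / (17/10 * (1 + 7/10 * Y)) - Y / (2 * (1 + Y))"
  proof -
    have "100/289 * (1 + 7/17 * d) = 100/289 + 700/4913 * d" by (simp add: field_simps)
    thus ?thesis using b1 b2 d by linarith
  qed
  have "(7 - 7 * d) * (19/200 + 13/50 * d) \<le> (1 + 5 * Y + Y\<^sup>2) * (1 / (17/10 * (1 + 7/10 * Y)) - Y / (2 * (1 + Y)))"
    by (rule mult_mono) (use b d N zero_le_power2[of d] in linarith)+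
  moreover have "(7 - 7 * d) * (19/200 + 13/50 * d) = 133/200 + 231/200 * d - 91/50 * d\<^sup>2"
    by (simp add: field_simps power2_eq_square)
  moreover have "Y\<^sup>2 = 1 - 2 * d + d\<^sup>2" unfolding d by (simp add: algebra_simps power2_eq_square)
  moreover have "d\<^sup>2 \<le> d * (7/20)" using d by (simp add: power2_eq_square)
  ultimately show ?thesis using q x1 g r2 d by linarith
qed

text \<open>Here the guaranteed gain vanishes as \<open>Y\<close> tends to \<open>1\<close>, so the
  coefficient \<open>7/5\<close> would not do. With \<open>\<rho> <= 4 * r\<close> the coefficient
  tends to \<open>2\<close>, the limit is \<open>-1 + 2 - 1 = 0\<close>, and first order terms in
  \<open>1 - Y\<close> decide.\<close>

lemma exchange_psi_near:
  fixes r Y g x \<rho> :: real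
  assumes r: "0 < r" and Y: "13/20 \<le> Y" "Y < 1" and rN: "r * (1 + 5 * Y + Y\<^sup>2) \<le> 1 - Y"
    and x: "0 < x" "x \<le> r" "12 * x \<le> 1" and \<rho>: "\<rho> \<le> 4 * r"
    and g: "(1 + 5 * Y + Y\<^sup>2) * (1 - Y) / (2 * (1 + Y)) \<le> g"
  shows "0 \<le> - (1 / (1 + r)) + (2 - \<rho>) * (1 / (1 + r)) ^ 3 - Y\<^sup>2 / (1 - x) + g"
proof -
  have N: "9/2 \<le> 1 + 5 * Y + Y\<^sup>2"
    using Y mult_mono[of "13/20" Y "13/20" Y] by (auto simp: power2_eq_square)
  have "r * (9/2) \<le> r * (1 + 5 * Y + Y\<^sup>2)" using r N by (intro mult_left_mono) auto
  hence r2: "9 * r \<le> 2 - 2 * Y" using rN by linarith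
  have r3: "r \<le> 1/10" using r2 Y by linarith
  define w where "w = 1 / (1 + r)"
  have w: "0 < w" "w \<le> 1" using r by (auto simp: w_def field_simps)
  have w1: "w \<le> 1 - r + r\<^sup>2"
  proof -
    have "1 \<le> (1 - r + r\<^sup>2) * (1 + r)" using r by (simp add: algebra_simps power2_eq_square)
    thus ?thesis unfolding w_def using r by (subst pos_divide_le_eq) auto
  qed
  have "1 - r \<le> w" using r unfolding w_def by (subst pos_le_divide_eq) (auto simp: algebra_simps)
  hence "(1 - r) ^ 3 \<le> w ^ 3" using r3 by (intro power_mono) auto
  moreover have "(1 - r) ^ 3 = 1 - 3 * r + r\<^sup>2 * (3 - r)" by (simp add: algebra_simps power2_eq_square power3_eq_cube)
  moreover have "0 \<le> r\<^sup>2 * (3 - r)" using r3 by simp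
  ultimately have w3: "1 - 3 * r \<le> w ^ 3" by linarith
  have "(2 - 4 * r) * (1 - 3 * r) \<le> (2 - \<rho>) * w ^ 3" using w3 \<rho> r r3 by (intro mult_mono) auto
  moreover have "(2 - 4 * r) * (1 - 3 * r) = 2 - 10 * r + 12 * r\<^sup>2" by (simp add: algebra_simps power2_eq_square)
  ultimately have q: "1 - 9 * r \<le> (2 - \<rho>) * w ^ 3 - w" using w1 zero_le_power2[of r] by linarith
  have x1: "Y\<^sup>2 / (1 - x) \<le> Y\<^sup>2 + 12/11 * r"
  proof -
    have "1 / (1 - x) \<le> 1 + 12/11 * x"
    proof -
      have "x * x \<le> x * (1/12)" using x by (intro mult_left_mono) auto
      hence "1 \<le> (1 + 12/11 * x) * (1 - x)" by (simp add: algebra_simps)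
      thus ?thesis using x by (subst pos_divide_le_eq) auto
    qed
    hence "Y\<^sup>2 * (1 / (1 - x)) \<le> Y\<^sup>2 * (1 + 12/11 * x)" by (intro mult_left_mono) auto
    moreover have "Y\<^sup>2 * (12/11 * x) \<le> 1 * (12/11 * x)" using Y x by (intro mult_right_mono) (auto simp: power_le_one)
    moreover have "12/11 * x \<le> 12/11 * r" using x by simp
    ultimately show ?thesis by (simp add: algebra_simps)
  qed
  have "(1 - Y) * (9/8) \<le> g"
  proof -
    have "(9/2) * (1 - Y) / (2 * 2) \<le> (1 + 5 * Y + Y\<^sup>2) * (1 - Y) / (2 * (1 + Y))"
      using N Y by (intro frac_le mult_right_mono) auto
    moreover have "(9/2) * (1 - Y) / (2 * 2) = (1 - Y) * (9/8)" by simp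
    ultimately show ?thesis using g by linarith
  qed
  moreover have "(1 - Y) * (33/20) \<le> 1 - Y\<^sup>2"
  proof -
    have "(1 - Y) * (33/20) \<le> (1 - Y) * (1 + Y)" using Y by (intro mult_left_mono) auto
    thus ?thesis by (simp add: algebra_simps power2_eq_square)
  qed
  moreover have "(1 - Y) * (33/20) = 33/20 - 33/20 * Y" "(1 - Y) * (9/8) = 9/8 - 9/8 * Y" by simp_all
  ultimately show ?thesis using q x1 r2 Y unfolding w_def by linarith
qed

text \<open>Every term carries the factor \<open>x / Y^2\<close>. Removing it leaves
  \<open>main\<close>, in which \<open>g\<close> is the rescaled gain \<open>G\<close> and
  \<open>\<rho>\<close> measures the quadratic part of the bent correction.\<close>

lemma exchange_ACC_ABB_B_part:
  fixes x y Y :: real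
  assumes x: "0 < x" "x \<le> y" and y: "y \<le> Y" and Q: "aligned x Y 1"
  shows "0 \<le> 1 / (x + Y) - 1 / Y + 2 * curv x Y - (curv x Y)\<^sup>2 / (2 * curv y Y) - (1 / (1 - x) - 1)
     + (1 / 2 + 1 / (y + Y) - 1 / (Y + 1) - 1 / (y + 1))"
proof -
  have Y: "0 < Y" "0 < y" using x y by auto
  note q = aligned_less[OF x(1) Y(1) Q] aligned_le_twelfth[OF x(1) Y(1) Q] aligned_lt_one[OF x(1) Y(1) Q] aligned_le_seventh[OF x(1) Y(1) Q] aligned_linear[OF x(1) Y(1) Q]
  define r where "r = x / Y"
  define w where "w = 1 / (1 + r)"
  define \<rho> where "\<rho> = curv x Y / (2 * curv y Y)"
  define G where "G = 1 / 2 + 1 / (y + Y) - 1 / (Y + 1) - 1 / (y + 1)"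
  define g where "g = G * Y / r"
  define N where "N = 1 + 5 * Y + Y\<^sup>2"
  have r: "0 < r" "r \<le> 1" "x = r * Y" using x Y q by (auto simp: r_def field_simps)
  have xr: "x \<le> r" using r q Y by (simp add: mult_le_cancel_left1)
  have N: "0 < N" using Y by (simp add: N_def add_pos_nonneg)
  have "Y * (r * N) \<le> Y * (1 - Y)" using q by (simp add: r N_def mult_ac)
  hence rN: "r * N \<le> 1 - Y" using Y by simp
  have Nr: "N \<le> (1 - Y) / r" using rN r by (simp add: pos_le_divide_eq mult.commute)
  have p: "0 < curv x Y" "0 < curv y Y" using x Y by (auto intro: curv_pos)
  have w: "w = Y / (x + Y)" unfolding w_def r_def using x Y by (simp add: field_simps)
  have e1: "1 / (x + Y) - 1 / Y = - (x / Y\<^sup>2 * w)"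
  proof -
    have "1 / (x + Y) - 1 / Y = - (x / ((x + Y) * Y))" using x Y by (simp add: recip_diff)
    thus ?thesis using Y unfolding w by (simp add: power2_eq_square)
  qed
  have e2: "curv x Y = x / Y\<^sup>2 * w ^ 3"
    using x Y unfolding w curv_def by (simp add: power2_eq_square power3_eq_cube)
  have e3: "(curv x Y)\<^sup>2 / (2 * curv y Y) = \<rho> * curv x Y" by (simp add: \<rho>_def power2_eq_square)
  have e4: "1 / (1 - x) - 1 = x / Y\<^sup>2 * (Y\<^sup>2 / (1 - x))" using q Y by (simp add: field_simps)
  have e5: "G = x / Y\<^sup>2 * g" using r Y by (simp add: g_def power2_eq_square)
  have \<rho>: "\<rho> = x * (y + Y) ^ 3 / (2 * (y * (x + Y) ^ 3))" using x Y by (simp add: \<rho>_def curv_def)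
  have \<rho>1: "\<rho> \<le> 3/5"
    unfolding \<rho> using curv_ratio_bound[OF x y] x Y by (subst pos_divide_le_eq) auto
  have G: "G = (1 - Y) * (1 / ((y + Y) * (y + 1)) - 1 / (2 * (1 + Y)))"
  proof -
    have "1 / (y + Y) - 1 / (y + 1) = (1 - Y) / ((y + Y) * (y + 1))" using Y by (simp add: recip_diff)
    moreover have "1 / 2 - 1 / (Y + 1) = - ((1 - Y) / (2 * (1 + Y)))" using Y by (simp add: field_simps)
    ultimately show ?thesis unfolding G_def by (simp add: right_diff_distrib)
  qed
  \<comment> \<open>Both \<open>G\<close> and the bound for \<open>r\<close> contain the factor
    \<open>1 - Y\<close>. In the quotient defining \<open>g\<close> it is traded for
    \<open>N\<close>, so the gain need not degenerate as \<open>Y\<close> tends to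
    \<open>1\<close>.\<close>
  have gl: "N * b \<le> g" if "0 \<le> b" "b / Y \<le> 1 / ((y + Y) * (y + 1)) - 1 / (2 * (1 + Y))" for b
  proof -
    have "N * b \<le> (1 - Y) / r * b" using Nr that by (intro mult_right_mono) auto
    also have "\<dots> = (1 - Y) * (b / Y) * Y / r" using Y by simp
    also have "\<dots> \<le> g" unfolding g_def G using that q r Y
      by (intro divide_right_mono mult_right_mono mult_left_mono) auto
    finally show ?thesis .
  qed
  have g1: "N * (1 - Y) / (2 * (1 + Y)) \<le> g"
  proof -
    have "(y + Y) * (y + 1) \<le> (2 * Y) * (1 + Y)" using y Y by (intro mult_mono) auto
    hence i: "1 / ((2 * Y) * (1 + Y)) \<le> 1 / ((y + Y) * (y + 1))" using Y x by (intro divide_left_mono mult_pos_pos) auto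
    have gen: "(1 - Y) / (2 * c) / Y = 1 / ((2 * Y) * c) - 1 / (2 * c)" if "0 < c" for c
      using Y that by (simp add: field_simps)
    have e: "(1 - Y) / (2 * (1 + Y)) / Y = 1 / ((2 * Y) * (1 + Y)) - 1 / (2 * (1 + Y))"
      using gen[of "1 + Y"] Y by simp
    have "(1 - Y) / (2 * (1 + Y)) / Y \<le> 1 / ((y + Y) * (y + 1)) - 1 / (2 * (1 + Y))"
      unfolding e using i by linarith
    hence "N * ((1 - Y) / (2 * (1 + Y))) \<le> g" using q Y by (intro gl) auto
    thus ?thesis by simp
  qed
  have main: "0 \<le> - w + (2 - \<rho>) * w ^ 3 - Y\<^sup>2 / (1 - x) + g"
  proof -
    have w0: "0 \<le> w ^ 3" using r by (simp add: w_def)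
    have mono: "7/5 * w ^ 3 \<le> (2 - \<rho>) * w ^ 3" using \<rho>1 w0 by (intro mult_right_mono) auto
    \<comment> \<open>Up to \<open>13/20\<close> the gain is large for every \<open>y\<close>.
      Beyond, either \<open>y\<close> is far enough below \<open>Y\<close> to keep the gain, or
      \<open>y\<close> is so close to \<open>Y\<close> that \<open>(y + Y)^3 <= 8 * y * Y^2\<close>,
      which makes \<open>\<rho>\<close> at most \<open>4 * r\<close>.\<close>
    consider "Y \<le> 13/20" | "13/20 \<le> Y" "y \<le> 7/10 * Y" | "13/20 \<le> Y" "7/10 * Y \<le> y" by linarith
    thus ?thesis
    proof cases
      case 1
      have "0 \<le> - w + 7/5 * w ^ 3 - Y\<^sup>2 / (1 - x) + g"
        unfolding w_def by (rule exchange_psi_far) (use r Y 1 rN g1 x q in \<open>auto simp: N_def\<close>)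
      thus ?thesis using mono by linarith
    next
      case 2
      define b where "b = 1 / (17/10 * (1 + 7/10 * Y)) - Y / (2 * (1 + Y))"
      have "0 \<le> b"
      proof -
        have "Y / (2 * (1 + Y)) \<le> 1 / 4" using Y q by (simp add: field_simps)
        moreover have "1 / 4 \<le> 1 / (17/10 * (1 + 7/10 * Y))" using Y q by (simp add: field_simps)
        ultimately show ?thesis unfolding b_def by linarith
      qed
      moreover have "b / Y \<le> 1 / ((y + Y) * (y + 1)) - 1 / (2 * (1 + Y))"
      proof -
        have "(y + Y) * (y + 1) \<le> (17/10 * Y) * (1 + 7/10 * Y)" using 2 Y by (intro mult_mono) auto
        hence "1 / ((17/10 * Y) * (1 + 7/10 * Y)) \<le> 1 / ((y + Y) * (y + 1))"
          using Y x by (intro divide_left_mono mult_pos_pos) auto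
        moreover have "b / Y = 1 / ((17/10 * Y) * (1 + 7/10 * Y)) - 1 / (2 * (1 + Y))"
          using Y by (simp add: b_def diff_divide_distrib mult_ac)
        ultimately show ?thesis by linarith
      qed
      ultimately have "N * b \<le> g" by (rule gl)
      hence "0 \<le> - w + 7/5 * w ^ 3 - Y\<^sup>2 / (1 - x) + g"
        unfolding w_def by (intro exchange_psi_mid) (use r Y 2 rN x q in \<open>auto simp: N_def b_def\<close>)
      thus ?thesis using mono by linarith
    next
      case 3
      have "\<rho> \<le> 4 * r"
      proof -
        define c where "c = Y - y"
        have c: "0 \<le> c" "y = Y - c" "10 * c \<le> 3 * Y" using y 3 by (auto simp: c_def)
        have "8 * (y * Y\<^sup>2) - (y + Y) ^ 3 = c * (4 * Y\<^sup>2 - 6 * (Y * c) + c\<^sup>2)"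
          unfolding c by (simp add: algebra_simps power2_eq_square power3_eq_cube)
        moreover have "0 \<le> c * (4 * Y\<^sup>2 - 6 * (Y * c) + c\<^sup>2)"
        proof -
          have "Y * (10 * c) \<le> Y * (3 * Y)" using c Y by (intro mult_left_mono) auto
          moreover have "Y * (10 * c) = 10 * (Y * c)" "Y * (3 * Y) = 3 * Y\<^sup>2" by (simp_all add: power2_eq_square)
          ultimately have "0 \<le> 4 * Y\<^sup>2 - 6 * (Y * c) + c\<^sup>2"
            using zero_le_power2[of c] zero_le_power2[of Y] by linarith
          thus ?thesis using c by simp
        qed
        ultimately have "(y + Y) ^ 3 \<le> 8 * (y * Y\<^sup>2)" by linarith
        hence "\<rho> \<le> x * (8 * (y * Y\<^sup>2)) / (2 * (y * Y ^ 3))"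
          unfolding \<rho> using x Y by (intro frac_le mult_left_mono power_mono) auto
        also have "\<dots> = 4 * r" using Y by (simp add: r_def power2_eq_square power3_eq_cube)
        finally show ?thesis .
      qed
      thus ?thesis unfolding w_def
        by (intro exchange_psi_near) (use r xr Y 3 rN x q g1 in \<open>auto simp: N_def\<close>)
    qed
  qed
  have "0 \<le> x / Y\<^sup>2 * (- w + (2 - \<rho>) * w ^ 3 - Y\<^sup>2 / (1 - x) + g)"
    using main x by (intro mult_nonneg_nonneg) auto
  also have "\<dots> = - (x / Y\<^sup>2 * w) + 2 * (x / Y\<^sup>2 * w ^ 3) - \<rho> * (x / Y\<^sup>2 * w ^ 3) - x / Y\<^sup>2 * (Y\<^sup>2 / (1 - x)) + x / Y\<^sup>2 * g"
    by (simp add: algebra_simps)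
  finally show ?thesis
    unfolding e2[symmetric] e5[symmetric] e4[symmetric] e3[symmetric] e1[symmetric] G_def by linarith
qed

text \<open>Moving the partner \<open>Z\<close> of \<open>Y\<close> to \<open>1\<close> decouples
  the difference into a part in \<open>x, Y, Z\<close> and a part in \<open>X, y, Y\<close>.\<close>

lemma exchange_ACC_ABB_unit:
  fixes x X y Y Z :: real
  assumes x: "0 < x" "aligned x Y 1" and X: "0 < X" "X \<le> y" "aligned X Y 1" and y: "y \<le> Y" and Z: "1 \<le> Z"
  shows "line_cost x Y Z + line_cost X y 1 \<le> bent_cost x 1 Z + bent_cost X y Y"
proof -
  have Y: "0 < Y" using X y by auto
  note q = aligned_lt_one[OF x(1) Y x(2)]
  have 1: "1 / (Y + Z) - 1 / (1 + Z) \<le> 1 / (Y + 1) - 1 / 2"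
    using recip_diff_mono[of Y 1 1 Z] Y q Z by simp
  have e: "bent_cost x 1 Z + bent_cost X y Y - (line_cost x Y Z + line_cost X y 1) =
     ((1 / (x + 1) - 1 + 1 / Y - 1 / (x + Y)) - (1 / (Z - x) - 1 / (x + Z)) + 2 * curv x Z
            - (curv x Z)\<^sup>2 / (2 * curv 1 Z)) +
     (1 / (X + Y) - 1 / Y + 2 * curv X Y - (curv X Y)\<^sup>2 / (2 * curv y Y) - (1 / (1 - X) - 1)
     + (1 / 2 + 1 / (y + Y) - 1 / (Y + 1) - 1 / (y + 1)))
     + ((1 / (Y + 1) - 1 / 2) - (1 / (Y + Z) - 1 / (1 + Z)))"
    by (simp add: bent_cost_def anti_cost_def line_cost_def)
  show ?thesis using 1 e exchange_ACC_ABB_C_part[OF x(1) Y x(2) Z] exchange_ACC_ABB_B_part[OF X(1,2) y X(3)] by linarith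
qed


text \<open>The term \<open>9/5 * u\<close> is what remains of the second difference
  \<open>8 * u\<close> after paying \<open>31/5 * u\<close>. For fixed \<open>t\<close> the
  inequality is studied in \<open>k = u / t\<close>: by interpolation between the nodes
  \<open>1\<close>, \<open>1/2\<close>, \<open>1/4\<close>, and by a series below
  \<open>1/4\<close>.\<close>

lemma exchange_BBB_close:
  fixes u v t M :: real
  assumes u: "0 < u" "u \<le> v" "v \<le> t" "t \<le> 1" "v \<le> 2 * u"
    and M: "M = min (curv u t) (1 / (8 * t))"
  shows "0 \<le> 9/5 * u + 1 / (u + t) + 1 / (v + t) - 1 / t + 1/2 - 1 / (1 + u) - 1 / (1 + t) + 3/2 * M"
proof -
  have t: "0 < t" using u by simp
  define k where "k = u / t"
  have k: "0 < k" "k \<le> 1" "u = k * t" using u t by (auto simp: k_def)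
  define T where "T = 1 / t"
  define R where "R = 1 / (1 + t)"
  have T: "t * T = 1" "0 < T" using t by (auto simp: T_def)
  have ut: "1 / (u + t) = T * (1 / (1 + k))" unfolding k T_def using t k by (simp add: field_simps)
  have curv: "curv u t = T * (k / (1 + k) ^ 3)"
  proof -
    have "u + t = t * (1 + k)" using k by (simp add: algebra_simps)
    thus ?thesis unfolding curv_def using k t by (simp add: T_def power_mult_distrib power3_eq_cube)
  qed
  have u1: "1 / (1 + u) \<le> 1 - u + u\<^sup>2"
  proof -
    have "1 \<le> (1 - u + u\<^sup>2) * (1 + u)" using u by (simp add: algebra_simps power2_eq_square)
    thus ?thesis using u by (subst pos_divide_le_eq) auto
  qed
  have R: "R \<le> 1" "(1 + t) * R = 1" using t by (auto simp: R_def)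
  have p1: "0 \<le> e" if "0 \<le> t * (1 + t) * e" for e
  proof -
    have "0 < t * (1 + t)" using t by simp
    with that show ?thesis by (metis mult_pos_neg not_le)
  qed
  \<comment> \<open>\<open>q1\<close>, \<open>q2\<close>, \<open>q3\<close> are sufficient forms of
    the inequality at \<open>k = 1\<close>, \<open>1/2\<close>, \<open>1/4\<close>. The squares in
    their proofs are centred near the minimum in \<open>t\<close> of the cleared polynomial.\<close>
  have q1: "0 \<le> 3/16 * T + 14/5 * t - t\<^sup>2 - 1/2 - R"
  proof (rule p1)
    have "t ^ 4 \<le> t ^ 3" using t u by (intro power_decreasing) auto
    moreover have "0 \<le> t ^ 3" using t by simp
    moreover have "0 \<le> (t - 2853/10000)\<^sup>2" by simp
    moreover have "(t - 2853/10000)\<^sup>2 = t\<^sup>2 - 2853/5000 * t + 8139609/100000000"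
      by (simp add: field_simps power2_eq_square)
    ultimately have "0 \<le> 3/16 - 21/16 * t + 23/10 * t\<^sup>2 + 9/5 * t ^ 3 - t ^ 4" using t u by linarith
    also have "\<dots> = 3/16 * (1 + t) * (t * T) + (14/5 * t - t\<^sup>2 - 1/2) * t * (1 + t) - t * ((1 + t) * R)"
      unfolding T R by (simp add: field_simps power2_eq_square power3_eq_cube power4_eq_xxxx)
    also have "\<dots> = t * (1 + t) * (3/16 * T + 14/5 * t - t\<^sup>2 - 1/2 - R)" by (simp add: algebra_simps)
    finally show "0 \<le> t * (1 + t) * (3/16 * T + 14/5 * t - t\<^sup>2 - 1/2 - R)" .
  qed
  have q2: "0 \<le> 5/16 * T + 7/5 * t - t\<^sup>2 / 4 - 1/2 - R"
  proof (rule p1)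
    have "t ^ 4 \<le> t ^ 3" using t u by (intro power_decreasing) auto
    moreover have "0 \<le> (t - 9/20)\<^sup>2 * (t + 9/10)" using t by simp
    moreover have "(t - 9/20)\<^sup>2 * (t + 9/10) = t ^ 3 - 243/400 * t + 729/4000"
      by (simp add: field_simps power2_eq_square power3_eq_cube)
    moreover have "0 \<le> (t - 9/25)\<^sup>2" by simp
    moreover have "(t - 9/25)\<^sup>2 = t\<^sup>2 - 18/25 * t + 81/625" by (simp add: field_simps power2_eq_square)
    ultimately have "0 \<le> 5/16 - 19/16 * t + 9/10 * t\<^sup>2 + 23/20 * t ^ 3 - 1/4 * t ^ 4" using t by linarith
    also have "\<dots> = 5/16 * (1 + t) * (t * T) + (7/5 * t - t\<^sup>2 / 4 - 1/2) * t * (1 + t) - t * ((1 + t) * R)"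
      unfolding T R by (simp add: field_simps power2_eq_square power3_eq_cube power4_eq_xxxx)
    also have "\<dots> = t * (1 + t) * (5/16 * T + 7/5 * t - t\<^sup>2 / 4 - 1/2 - R)" by (simp add: algebra_simps)
    finally show "0 \<le> t * (1 + t) * (5/16 * T + 7/5 * t - t\<^sup>2 / 4 - 1/2 - R)" .
  qed
  have q3: "0 \<le> 1/2 * T + 7/10 * t - t\<^sup>2 / 16 - 1/2 - R"
  proof (rule p1)
    have "t ^ 4 \<le> t ^ 3" using t u by (intro power_decreasing) auto
    moreover have "0 \<le> (t - 13/20)\<^sup>2 * (t + 13/10)" using t by simp
    moreover have "(t - 13/20)\<^sup>2 * (t + 13/10) = t ^ 3 - 507/400 * t + 2197/4000"
      by (simp add: field_simps power2_eq_square power3_eq_cube)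
    moreover have "0 \<le> (t - 13/20)\<^sup>2" by simp
    moreover have "(t - 13/20)\<^sup>2 = t\<^sup>2 - 13/10 * t + 169/400" by (simp add: field_simps power2_eq_square)
    ultimately have "0 \<le> 1/2 - t + 1/5 * t\<^sup>2 + 51/80 * t ^ 3 - 1/16 * t ^ 4" using t u by linarith
    also have "\<dots> = 1/2 * (1 + t) * (t * T) + (7/10 * t - t\<^sup>2 / 16 - 1/2) * t * (1 + t) - t * ((1 + t) * R)"
      unfolding T R by (simp add: field_simps power2_eq_square power3_eq_cube power4_eq_xxxx)
    also have "\<dots> = t * (1 + t) * (1/2 * T + 7/10 * t - t\<^sup>2 / 16 - 1/2 - R)" by (simp add: algebra_simps)
    finally show "0 \<le> t * (1 + t) * (1/2 * T + 7/10 * t - t\<^sup>2 / 16 - 1/2 - R)" .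
  qed
  \<comment> \<open>The equation \<open>(1 + k)^3 = 8 * k\<close> has the positive roots
    \<open>1\<close> and \<open>sqrt 5 - 2\<close>, the latter just below \<open>1/4\<close>;
    between them the constant term of the \<open>min\<close> is the smaller one.\<close>
  have M1: "M = T / 8" if "1/4 \<le> k"
  proof -
    have "0 \<le> (1 - k) * (k\<^sup>2 + 4 * k - 1)" using k that zero_le_power2[of k] by (intro mult_nonneg_nonneg) linarith+
    hence "(1 + k) ^ 3 \<le> 8 * k" by (simp add: algebra_simps power2_eq_square power3_eq_cube)
    hence "1/8 \<le> k / (1 + k) ^ 3" using k by (subst pos_le_divide_eq) auto
    hence "T * (1/8) \<le> curv u t" unfolding curv using T by (intro mult_left_mono) auto
    thus ?thesis unfolding M by (simp add: T_def)
  qed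
  consider "1/2 \<le> k" | "1/4 \<le> k" "k \<le> 1/2" | "k \<le> 1/4" by linarith
  then have "0 \<le> 14/5 * u - u\<^sup>2 + 1 / (u + t) + 1 / (v + t) - T - 1/2 - R + 3/2 * M"
  proof cases
    case 1
    have v: "T / 2 \<le> 1 / (v + t)"
    proof -
      have "1 / (t + t) \<le> 1 / (v + t)" using u by (intro divide_left_mono mult_pos_pos) auto
      thus ?thesis by (simp add: T_def)
    qed
    have "3/4 - k / 4 \<le> 1 / (1 + k)"
    proof -
      have "1 - (3/4 - k / 4) * (1 + k) = (1 - k)\<^sup>2 / 4" by (simp add: field_simps power2_eq_square)
      hence "(3/4 - k / 4) * (1 + k) \<le> 1" using zero_le_power2[of "1 - k"] by linarith
      thus ?thesis using k by (subst pos_le_divide_eq) auto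
    qed
    hence c: "T * (3/4 - k / 4) \<le> 1 / (u + t)" unfolding ut using T by (intro mult_left_mono) auto
    \<comment> \<open>Linear interpolation between the nodes \<open>1\<close> and
      \<open>1/2\<close>. The reciprocals have been replaced by linear bounds, and the last summand
      is the exact distance of the concave \<open>- u^2\<close> from its chord.\<close>
    have "0 \<le> (2 * k - 1) * (3/16 * T + 14/5 * t - t\<^sup>2 - 1/2 - R) + (2 - 2 * k) * (5/16 * T + 7/5 * t - t\<^sup>2 / 4 - 1/2 - R)
         + t\<^sup>2 * ((k - 1/2) * (1 - k))"
      using q1 q2 1 k by (intro add_nonneg_nonneg mult_nonneg_nonneg) auto
    also have "\<dots> = 14/5 * u - u\<^sup>2 + T * (3/4 - k / 4) + T / 2 - T - 1/2 - R + 3/2 * (T / 8)"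
      unfolding k by (simp add: field_simps power2_eq_square)
    finally show ?thesis using v c M1 1 by simp
  next
    case 2
    have v: "T * (3/4 - k / 2) \<le> 1 / (v + t)"
    proof -
      have "1 - (3/4 - k / 2) * (1 + 2 * k) = (k - 1/2)\<^sup>2" by (simp add: field_simps power2_eq_square)
      hence "(3/4 - k / 2) * (1 + 2 * k) \<le> 1" using zero_le_power2[of "k - 1/2"] by linarith
      hence "3/4 - k / 2 \<le> 1 / (1 + 2 * k)" using k by (subst pos_le_divide_eq) auto
      hence "T * (3/4 - k / 2) \<le> T * (1 / (1 + 2 * k))" using T by (intro mult_left_mono) auto
      also have "\<dots> = 1 / (2 * u + t)" unfolding k T_def using t k by (simp add: field_simps)
      also have "\<dots> \<le> 1 / (v + t)" using u by (intro divide_left_mono mult_pos_pos) auto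
      finally show ?thesis .
    qed
    have "8/9 - 4/9 * k \<le> 1 / (1 + k)"
    proof -
      have "1 - (8/9 - 4/9 * k) * (1 + k) = (2 * k - 1)\<^sup>2 / 9" by (simp add: field_simps power2_eq_square)
      hence "(8/9 - 4/9 * k) * (1 + k) \<le> 1" using zero_le_power2[of "2 * k - 1"] by linarith
      thus ?thesis using k by (subst pos_le_divide_eq) auto
    qed
    hence c: "T * (8/9 - 4/9 * k) \<le> 1 / (u + t)" unfolding ut using T by (intro mult_left_mono) auto
    \<comment> \<open>The same interpolation between \<open>1/2\<close> and \<open>1/4\<close>;
      \<open>1/24\<close> and \<open>13/144\<close> are the surpluses of the coefficient of
      \<open>T\<close> at these nodes over those in \<open>q2\<close> and \<open>q3\<close>.\<close>
    have "0 \<le> (4 * k - 1) * (5/16 * T + 7/5 * t - t\<^sup>2 / 4 - 1/2 - R) + (2 - 4 * k) * (1/2 * T + 7/10 * t - t\<^sup>2 / 16 - 1/2 - R)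
         + t\<^sup>2 * ((k - 1/4) * (1/2 - k)) + T * ((4 * k - 1) * (1/24) + (2 - 4 * k) * (13/144))"
      using q2 q3 2 k T by (intro add_nonneg_nonneg mult_nonneg_nonneg) auto
    also have "\<dots> = 14/5 * u - u\<^sup>2 + T * (8/9 - 4/9 * k) + T * (3/4 - k / 2) - T - 1/2 - R + 3/2 * (T / 8)"
      unfolding k by (simp add: field_simps power2_eq_square)
    finally show ?thesis using v c M1 2 by simp
  next
    case 3
    have M3: "T * (k / 2) \<le> M"
    proof -
      have "(1 + k) ^ 3 \<le> (5/4) ^ 3" using k 3 by (intro power_mono) auto
      hence "(1 + k) ^ 3 \<le> 2" by (simp add: power3_eq_cube)
      hence "k / 2 \<le> k / (1 + k) ^ 3" using k by (intro divide_left_mono mult_pos_pos) auto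
      hence "T * (k / 2) \<le> curv u t" unfolding curv using T by (intro mult_left_mono) auto
      moreover have "T * (k / 2) \<le> T * (1/8)" using T 3 by (intro mult_left_mono) auto
      ultimately show ?thesis unfolding M by (simp add: T_def)
    qed
    have k3: "k ^ 3 \<le> k\<^sup>2 / 4" using 3 mult_left_mono[of k "1/4" "k\<^sup>2"] by (simp add: power2_eq_square power3_eq_cube)
    \<comment> \<open>Truncated alternating geometric series; afterwards \<open>k^3\<close> is
      traded for \<open>k^2 / 4\<close>.\<close>
    have c1: "1 - 2 * k + 4 * k\<^sup>2 - 8 * k ^ 3 \<le> 1 / (1 + 2 * k)"
    proof -
      have "(1 - 2 * k + 4 * k\<^sup>2 - 8 * k ^ 3) * (1 + 2 * k) = 1 - 16 * k ^ 4"
        by (simp add: algebra_simps power2_eq_square power3_eq_cube power4_eq_xxxx)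
      thus ?thesis using k by (subst pos_le_divide_eq) auto
    qed
    have c2: "1 - k + k\<^sup>2 - k ^ 3 \<le> 1 / (1 + k)"
    proof -
      have "(1 - k + k\<^sup>2 - k ^ 3) * (1 + k) = 1 - k ^ 4"
        by (simp add: algebra_simps power2_eq_square power3_eq_cube power4_eq_xxxx)
      thus ?thesis using k by (subst pos_le_divide_eq) auto
    qed
    have v: "T * (1 / (1 + 2 * k)) \<le> 1 / (v + t)"
    proof -
      have "T * (1 / (1 + 2 * k)) = 1 / (2 * u + t)" unfolding k T_def using t k by (simp add: field_simps)
      also have "\<dots> \<le> 1 / (v + t)" using u by (intro divide_left_mono mult_pos_pos) auto
      finally show ?thesis .
    qed
    have "1 - 9/4 * k + 11/4 * k\<^sup>2 \<le> 1 / (1 + 2 * k) + 1 / (1 + k) - 1 + 3/4 * k"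
      using c1 c2 k3 by linarith
    hence "T * (1 - 9/4 * k + 11/4 * k\<^sup>2) \<le> T * (1 / (1 + 2 * k) + 1 / (1 + k) - 1 + 3/4 * k)"
      using T by (intro mult_left_mono) auto
    also have "\<dots> = T * (1 / (1 + 2 * k)) + 1 / (u + t) - T + 3/2 * (T * (k / 2))"
      unfolding ut by (simp add: algebra_simps)
    finally have s: "T * (1 - 9/4 * k + 11/4 * k\<^sup>2) \<le> 1 / (v + t) + 1 / (u + t) - T + 3/2 * M"
      using v M3 by linarith
    have "0 \<le> T * (1 - 9/4 * k + 11/4 * k\<^sup>2) + 14/5 * u - u\<^sup>2 - 1/2 - R"
    proof (rule p1)
      have tR: "t * R \<le> 1/4 + t / 4"
      proof -
        have "(1/4 + t / 4) * (1 + t) - t = (1 - t)\<^sup>2 / 4" by (simp add: field_simps power2_eq_square)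
        hence "t \<le> (1/4 + t / 4) * (1 + t)" using zero_le_power2[of "1 - t"] by linarith
        hence "t / (1 + t) \<le> 1/4 + t / 4" using t by (subst pos_divide_le_eq) auto
        thus ?thesis by (simp add: R_def)
      qed
      have a1: "k * (6/5 * t - 9/25) \<le> k * t\<^sup>2"
      proof -
        have "0 \<le> (t - 3/5)\<^sup>2" by simp
        moreover have "(t - 3/5)\<^sup>2 = t\<^sup>2 - (6/5 * t - 9/25)" by (simp add: field_simps power2_eq_square)
        ultimately show ?thesis using k by (intro mult_left_mono) auto
      qed
      have a2: "k\<^sup>2 * t ^ 3 \<le> k\<^sup>2 * 1" using t u by (intro mult_left_mono) (auto simp: power_le_one)
      have "0 \<le> (k - 1/4)\<^sup>2" by simp
      moreover have "(k - 1/4)\<^sup>2 = k\<^sup>2 - k / 2 + 1/16" by (simp add: field_simps power2_eq_square)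
      ultimately have "0 \<le> 3/4 - 1629/500 * k + 7/4 * k\<^sup>2" using 3 by linarith
      hence "0 \<le> (1 - t) * (3/4 - 1629/500 * k + 7/4 * k\<^sup>2)" using u by (intro mult_nonneg_nonneg) auto
      moreover have "0 \<le> t * (51/500 * k + 7/4 * k\<^sup>2)" using t k by simp
      ultimately have "0 \<le> (1 - t) * (3/4 - 1629/500 * k + 7/4 * k\<^sup>2) + t * (51/500 * k + 7/4 * k\<^sup>2)" by simp
      also have "\<dots> = 3/4 - 3/4 * t - 9/4 * k + 7/4 * k\<^sup>2 + 14/5 * (k * (6/5 * t - 9/25))"
        by (simp add: field_simps power2_eq_square)
      finally have "0 \<le> 1 - 9/4 * k + 11/4 * k\<^sup>2 + 14/5 * (k * t\<^sup>2) - k\<^sup>2 * t ^ 3 - 1/2 * t - t * R"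
        using a1 a2 tR by linarith
      also have "\<dots> = (t * T) * (1 - 9/4 * k + 11/4 * k\<^sup>2) + t * (14/5 * u - u\<^sup>2 - 1/2 - R)"
        unfolding T k by (simp add: field_simps power2_eq_square power3_eq_cube)
      also have "\<dots> = t * (T * (1 - 9/4 * k + 11/4 * k\<^sup>2) + 14/5 * u - u\<^sup>2 - 1/2 - R)" by (simp add: algebra_simps)
      finally show "0 \<le> t * (1 + t) * (T * (1 - 9/4 * k + 11/4 * k\<^sup>2) + 14/5 * u - u\<^sup>2 - 1/2 - R)"
        using t by (simp add: zero_le_mult_iff)
    qed
    thus ?thesis using s by linarith
  qed
  thus ?thesis using u1 unfolding T_def R_def by linarith
qed

text \<open>Used when \<open>v > 2 * u\<close>, where the second difference is replaced by the
  constant \<open>5/6 = (1 - 4/9) * (3/2)\<close>. The bound \<open>7 * a <= 1 - t\<close>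
  eliminates \<open>a\<close>, and a quadratic in \<open>t\<close> remains.\<close>

lemma exchange_BBB_spread:
  fixes u v t a M :: real
  assumes u: "0 < u" "2 * u \<le> t" "v \<le> t" "0 < v" "t \<le> 1" and a: "7 * a \<le> 1 - t"
    and M: "M = min (curv u t) (1 / (8 * t))"
  shows "0 \<le> 5/6 - 31/5 * a + 1 / (u + t) + 1 / (v + t) - 1 / t + 1/2 - 1 / (1 + u) - 1 / (1 + t) + 3/2 * M"
proof -
  have t: "0 < t" using u by simp
  define k where "k = u / t"
  have k: "0 < k" "k \<le> 1/2" "u = k * t" using u t by (auto simp: k_def field_simps)
  define T where "T = 1 / t"
  have T: "t * T = 1" "0 < T" using t by (auto simp: T_def)
  have ut: "1 / (u + t) = T * (1 / (1 + k))" unfolding k T_def using t k by (simp add: field_simps)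
  have curv: "curv u t = T * (k / (1 + k) ^ 3)"
  proof -
    have "u + t = t * (1 + k)" using k by (simp add: algebra_simps)
    thus ?thesis unfolding curv_def using k t by (simp add: T_def power_mult_distrib power3_eq_cube)
  qed
  have p1: "0 \<le> e" if "0 \<le> t * e" for e using that t by (simp add: zero_le_mult_iff)
  have R: "1 / (1 + t) \<le> 1 - t / 2"
  proof -
    have "0 \<le> t * (1 - t)" using t u by simp
    moreover have "(1 - t / 2) * (1 + t) = 1 + t * (1 - t) / 2" by (simp add: field_simps)
    ultimately have "1 \<le> (1 - t / 2) * (1 + t)" by linarith
    thus ?thesis using t by (subst pos_divide_le_eq) auto
  qed
  have v: "T / 2 \<le> 1 / (v + t)"
  proof -
    have "1 / (t + t) \<le> 1 / (v + t)" using u by (intro divide_left_mono mult_pos_pos) auto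
    thus ?thesis by (simp add: T_def)
  qed
  show ?thesis
  proof (cases "1/4 \<le> k")
    case True
    have M1: "M = T / 8"
    proof -
      have "0 \<le> (1 - k) * (k\<^sup>2 + 4 * k - 1)" using k True zero_le_power2[of k] by (intro mult_nonneg_nonneg) linarith+
      hence "(1 + k) ^ 3 \<le> 8 * k" by (simp add: algebra_simps power2_eq_square power3_eq_cube)
      hence "1/8 \<le> k / (1 + k) ^ 3" using k by (subst pos_le_divide_eq) auto
      hence "T * (1/8) \<le> curv u t" unfolding curv using T by (intro mult_left_mono) auto
      thus ?thesis unfolding M by (simp add: T_def)
    qed
    have 1: "1 / (t + t / 2) - 1 / (1 + t / 2) \<le> 1 / (t + u) - 1 / (1 + u)"
      using recip_diff_mono[of t 1 u "t / 2"] t u by simp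
    have 2: "1 / (t + t / 2) = 2/3 * T" using t by (simp add: T_def field_simps)
    have 3: "1 / (1 + t / 2) \<le> 1 - t / 3"
    proof -
      have "0 \<le> t * (1 - t)" using t u by simp
      moreover have "(1 - t / 3) * (1 + t / 2) = 1 + t * (1 - t) / 6" by (simp add: field_simps)
      ultimately have "1 \<le> (1 - t / 3) * (1 + t / 2)" by linarith
      thus ?thesis using t by (subst pos_divide_le_eq) auto
    qed
    have "0 \<le> 17/48 * T - 163/105 + 361/210 * t"
    proof (rule p1)
      have "0 \<le> 361/210 * (t - 4516/10000)\<^sup>2" by simp
      moreover have "361/210 * (t - 4516/10000)\<^sup>2 = 361/210 * t\<^sup>2 - 407569/262500 * t + 361/210 * (1274641/6250000)"
        by (simp add: field_simps power2_eq_square)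
      ultimately have "0 \<le> 17/48 - 163/105 * t + 361/210 * t\<^sup>2" using t by linarith
      also have "\<dots> = 17/48 * (t * T) - 163/105 * t + 361/210 * t\<^sup>2" unfolding T by simp
      finally show "0 \<le> t * (17/48 * T - 163/105 + 361/210 * t)" by (simp add: algebra_simps power2_eq_square)
    qed
    moreover have "1 / (t + u) = 1 / (u + t)" by (simp add: add.commute)
    ultimately show ?thesis using 1 2 3 R v a M1 unfolding T_def[symmetric] by linarith
  next
    case False
    have M3: "T * (k / 2) \<le> M"
    proof -
      have "(1 + k) ^ 3 \<le> (5/4) ^ 3" using k False by (intro power_mono) auto
      hence "(1 + k) ^ 3 \<le> 2" by (simp add: power3_eq_cube)
      hence "k / 2 \<le> k / (1 + k) ^ 3" using k by (intro divide_left_mono mult_pos_pos) auto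
      hence "T * (k / 2) \<le> curv u t" unfolding curv using T by (intro mult_left_mono) auto
      moreover have "T * (k / 2) \<le> T * (1/8)" using T False by (intro mult_left_mono) auto
      ultimately show ?thesis unfolding M by (simp add: T_def)
    qed
    have "49/50 \<le> 1 / (1 + k) + 3/4 * k"
    proof -
      have "0 \<le> 3/4 * (k - 23/150)\<^sup>2" by simp
      moreover have "3/4 * (k - 23/150)\<^sup>2 = 3/4 * k\<^sup>2 - 23/100 * k + 529/30000" by (simp add: field_simps power2_eq_square)
      moreover have "1 - (49/50 - 3/4 * k) * (1 + k) = 1/50 - 23/100 * k + 3/4 * k\<^sup>2"
        by (simp add: field_simps power2_eq_square)
      ultimately have "(49/50 - 3/4 * k) * (1 + k) \<le> 1" by linarith
      hence "49/50 - 3/4 * k \<le> 1 / (1 + k)" using k by (subst pos_le_divide_eq) auto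
      thus ?thesis by linarith
    qed
    hence "T * (49/50) \<le> T * (1 / (1 + k) + 3/4 * k)" using T by (intro mult_left_mono) auto
    also have "\<dots> = 1 / (u + t) + 3/2 * (T * (k / 2))" unfolding ut by (simp add: algebra_simps)
    finally have 1: "T * (49/50) \<le> 1 / (u + t) + 3/2 * M" using M3 by linarith
    have 2: "1 / (1 + u) \<le> 1" using u by simp
    have "0 \<le> 12/25 * T - 163/105 + 97/70 * t"
    proof (rule p1)
      have "0 \<le> 97/70 * (t - 56/100)\<^sup>2" by simp
      moreover have "97/70 * (t - 56/100)\<^sup>2 = 97/70 * t\<^sup>2 - 194/125 * t + 97/70 * (196/625)"
        by (simp add: field_simps power2_eq_square)
      ultimately have "0 \<le> 12/25 - 163/105 * t + 97/70 * t\<^sup>2" using t u by linarith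
      also have "\<dots> = 12/25 * (t * T) - 163/105 * t + 97/70 * t\<^sup>2" unfolding T by simp
      finally show "0 \<le> t * (12/25 * T - 163/105 + 97/70 * t)" by (simp add: algebra_simps power2_eq_square)
    qed
    thus ?thesis using 1 2 R v a unfolding T_def[symmetric] by linarith
  qed
qed

text \<open>Three triples are exchanged at once because the constraint on \<open>BBB\<close>
  involves both extremal slacks; each of \<open>u\<close>, \<open>v\<close>, \<open>t\<close> goes
  to a different new triple. The losses between inner and outer points add up to at most
  \<open>31/5 * a\<close>, since \<open>61/30 + 61/30 + 23/11 <= 31/5\<close>.\<close>

lemma exchange_ACC_BBB_AAC_unit:
  fixes x0 x1 x2 a u v t z Z z' :: real
  assumes x: "0 < x0" "x0 \<le> a" "0 < x1" "x1 \<le> a" "0 < x2" "x2 \<le> a"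
    and u: "0 < u" "u \<le> v" "v \<le> t" and Q: "aligned a u 1" "aligned a t 1" and z: "1 \<le> z" "z \<le> Z" "1 \<le> z'"
  shows "line_cost x0 t z + line_cost x1 u Z + line_cost x2 v z' \<le>
     anti_cost x0 z Z + anti_cost x1 x2 z' + anti_cost u v t + 3/2 * min (curv u t) (1 / (8 * t))"
proof -
  have a: "0 < a" and t: "0 < t" using x u by auto
  note q = aligned_less[OF a u(1) Q(1)] aligned_le_twelfth[OF a u(1) Q(1)] aligned_lt_one[OF a u(1) Q(1)]
    aligned_lt_one[OF a t Q(2)] aligned_le_seventh[OF a t Q(2)]
  define M where "M = min (curv u t) (1 / (8 * t))"
  have s0: "1 / (z - x0) - 1 / (z + x0) \<le> 61/30 * x0" by (rule sym_recip_bound) (use x q z in auto)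
  have s1: "1 / (t + x0) - 1 / (Z + x0) \<le> 1 / t - 1 / Z"
    using recip_diff_mono[of t Z 0 x0] x t q z by simp
  have s2: "1 / z' - 1 / Z - 23/11 * x1 \<le> 1 / (x1 + z') - 1 / (Z - x1)"
  proof -
    have "1 / z' - 1 / (x1 + z') = x1 / (z' * (x1 + z'))" using x z by (simp add: recip_diff)
    also have "\<dots> \<le> x1 / (1 * 1)" using x z by (intro divide_left_mono mult_mono) auto
    finally have 1: "1 / z' - 1 / (x1 + z') \<le> x1" by simp
    have "1 / (Z - x1) - 1 / Z = x1 / ((Z - x1) * Z)" using x q z by (simp add: recip_diff)
    also have "\<dots> \<le> x1 / ((11/12) * 1)" using x q z by (intro divide_left_mono mult_mono) auto
    finally have 2: "1 / (Z - x1) - 1 / Z \<le> 12/11 * x1" by simp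
    show ?thesis using 1 2 by linarith
  qed
  have s3: "1 / (z' - x2) - 1 / (z' + x2) \<le> 61/30 * x2" by (rule sym_recip_bound) (use x q z in auto)
  have s4: "1 / (x2 + a) - 1 / (u + a) \<le> 1 / (x2 + x1) - 1 / (u + x1)"
    using recip_diff_mono[of x2 u x1 a] x q by simp
  have s5: "1 / (a + a) - 1 / (v + a) \<le> 1 / (a + x2) - 1 / (v + x2)"
    using recip_diff_mono[of a v x2 a] x q u by simp
  have s6: "1 / (u + Z) - 1 / (z + Z) \<le> 1 / (u + z) - 1 / (2 * z)"
    using recip_diff_mono[of u z z Z] u q z by simp
  have s7: "(z - 1) / (4 * z) \<le> 1 / (1 + s) - 1 / (z + s)" if "0 < s" "s < 1" for s
  proof -
    have "(z - 1) / (4 * z) = (z - 1) / (2 * (2 * z))" by simp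
    also have "\<dots> \<le> (z - 1) / ((1 + s) * (z + s))"
      using that z by (intro divide_left_mono mult_mono mult_pos_pos) auto
    also have "\<dots> = 1 / (1 + s) - 1 / (z + s)" using that z by (simp add: recip_diff)
    finally show ?thesis .
  qed
  have s8: "(z - 1) / (4 * z) = 1/4 - 1 / (4 * z)" "1 / (4 * z) = 1 / 2 * (1 / (2 * z))" using z by (auto simp: field_simps)
  have s9: "1 / (v + z') \<le> 1 / z'" using u z by (intro divide_left_mono mult_pos_pos) auto
  \<comment> \<open>Worst case with the inner points at \<open>a\<close> and the outer ones
    eliminated. If \<open>v <= 2 * u\<close>, replacing \<open>v\<close> by \<open>u\<close> leaves
    the second difference at \<open>2 * a\<close>, \<open>a + u\<close>, \<open>2 * u\<close>.
    Otherwise \<open>1 / (a + v) - 1 / (u + v)\<close> is at most \<open>4/9\<close> of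
    \<open>J\<close>.\<close>
  have H: "0 \<le> 1 / (a + a) - 1 / (u + a) - 1 / (v + a) + anti_cost u v t - 1 / t - 31/5 * a + 1/2
        - 1 / (1 + u) - 1 / (1 + t) + 3/2 * M"
  proof (cases "v \<le> 2 * u")
    case True
    have 1: "1 / (a + v) - 1 / (u + v) \<le> 1 / (a + u) - 1 / (2 * u)"
      using recip_diff_mono[of a u u v] a q u by simp
    have 2: "8 * u \<le> 1 / (2 * a) + 1 / (2 * u) - 2 / (a + u)" by (rule aligned_convexity_gap[OF a u(1) Q(1)])
    have 3: "2 / (a + u) = 2 * (1 / (a + u))" by simp
    have 4: "31/5 * a \<le> 31/5 * u" using q by simp
    have 5: "0 \<le> 9/5 * u + 1 / (u + t) + 1 / (v + t) - 1 / t + 1/2 - 1 / (1 + u) - 1 / (1 + t) + 3/2 * M"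
      by (rule exchange_BBB_close) (use u True q M_def in auto)
    have 6: "1 / (u + a) = 1 / (a + u)" "1 / (v + a) = 1 / (a + v)" "1 / (a + a) = 1 / (2 * a)" by (simp_all add: add.commute)
    have "8 * u - 1 / (u + v) \<le> 1 / (a + a) - 1 / (u + a) - 1 / (v + a)" using 1 2 3 6 by linarith
    thus ?thesis using 4 5 unfolding anti_cost_def by linarith
  next
    case False
    define J where "J = 1 / (2 * a) - 1 / (a + u)"
    have J: "3/2 \<le> J" unfolding J_def by (rule aligned_recip_gap[OF a u(1) Q(1)])
    have "1 / (a + v) - 1 / (u + v) = (u - a) / ((a + v) * (u + v))" using a u by (simp add: recip_diff)
    also have "\<dots> \<le> (u - a) / ((3/2 * (a + u)) * (3 * a))"
      using a u q False by (intro divide_left_mono mult_mono mult_pos_pos) auto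
    also have "\<dots> = 4/9 * J"
    proof -
      define W where "W = a * (a + u)"
      have J2: "J = (u - a) / (2 * W)" using a u by (simp add: J_def W_def recip_diff mult_ac)
      have W2: "(3/2 * (a + u)) * (3 * a) = 9/2 * W" by (simp add: W_def)
      have "0 < W" using a u by (simp add: W_def)
      thus ?thesis unfolding J2 W2 by (simp add: field_simps)
    qed
    finally have 1: "1 / (a + v) - 1 / (u + v) \<le> 4/9 * J" .
    have 5: "0 \<le> 5/6 - 31/5 * a + 1 / (u + t) + 1 / (v + t) - 1 / t + 1/2 - 1 / (1 + u) - 1 / (1 + t) + 3/2 * M"
      by (rule exchange_BBB_spread) (use u False q M_def in auto)
    have 6: "1 / (u + a) = 1 / (a + u)" "1 / (v + a) = 1 / (a + v)" "1 / (a + a) = 1 / (2 * a)" by (simp_all add: add.commute)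
    have "5/6 - 1 / (u + v) \<le> 1 / (a + a) - 1 / (u + a) - 1 / (v + a)" using 1 J 6 J_def by linarith
    thus ?thesis using 5 unfolding anti_cost_def by linarith
  qed
  have e: "anti_cost x0 z Z + anti_cost x1 x2 z' + anti_cost u v t - (line_cost x0 t z + line_cost x1 u Z + line_cost x2 v z') =
      anti_cost u v t - (1 / (z - x0) - 1 / (z + x0)) - (1 / (t + x0) - 1 / (Z + x0))
      + (1 / (x1 + z') - 1 / (Z - x1)) - (1 / (z' - x2) - 1 / (z' + x2))
      + (1 / (x2 + x1) - 1 / (u + x1)) - 1 / (v + x2)
      - (1 / (u + Z) - 1 / (z + Z)) - 1 / (z + t) - 1 / (v + z')"
    by (simp add: anti_cost_def line_cost_def add.commute)
  have c: "1 / (x2 + a) = 1 / (a + x2)" by (simp add: add.commute)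
  have b: "61/30 * x0 \<le> 61/30 * a" "61/30 * x2 \<le> 61/30 * a" "23/11 * x1 \<le> 23/11 * a" using x by auto
  have d: "1 / (z + u) = 1 / (u + z)" by (simp add: add.commute)
  have A: "1 / (a + a) - 1 / (u + a) - 1 / (v + a) \<le> (1 / (x2 + x1) - 1 / (u + x1)) - 1 / (v + x2)"
    using s4 s5 c by linarith
  have B: "- (1 / t) - 31/5 * a \<le> - (1 / (z - x0) - 1 / (z + x0)) - (1 / (t + x0) - 1 / (Z + x0))
      + (1 / (x1 + z') - 1 / (Z - x1)) - (1 / (z' - x2) - 1 / (z' + x2)) - 1 / (v + z')"
    using s0 s1 s2 s3 s9 b a by linarith
  have C: "1/2 - 1 / (1 + u) - 1 / (1 + t) \<le> - (1 / (u + Z) - 1 / (z + Z)) - 1 / (z + t)"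
    using s6 s7[of u] s7[of t] s8 d q u t by linarith
  show ?thesis unfolding M_def[symmetric] using A B C H e by linarith
qed

section \<open>Homogeneity: removing the normalisation of the outer radius\<close>

lemma recip_scale: "0 < c \<Longrightarrow> 1 / (x / c + y / c) = c * (1 / (x + y))" for c x y :: real
  by (simp add: add_divide_distrib[symmetric])

lemma anti_cost_scale: "0 < c \<Longrightarrow> anti_cost (x / c) (y / c) (z / c) = c * anti_cost x y z"
  by (simp only: anti_cost_def recip_scale distrib_left)

lemma line_cost_scale: "0 < c \<Longrightarrow> line_cost (x / c) (y / c) (z / c) = c * line_cost x y z"
  by (simp add: line_cost_def distrib_left add_divide_distrib[symmetric] diff_divide_distrib[symmetric])

lemma curv_scale: "0 < c \<Longrightarrow> curv (x / c) (y / c) = c * curv x y"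
  by (simp add: curv_def add_divide_distrib[symmetric] power_divide power3_eq_cube)

lemma bent_cost_scale: "0 < c \<Longrightarrow> bent_cost (x / c) (y / c) (z / c) = c * bent_cost x y z"
  by (simp add: bent_cost_def anti_cost_scale curv_scale algebra_simps power2_eq_square)

lemma aligned_scale: "0 < c \<Longrightarrow> aligned (x / c) (y / c) (z / c) \<longleftrightarrow> aligned x y z"
proof -
  assume c: "0 < c"
  have "x / c * ((y / c)\<^sup>2 + 5 * (y / c) * (z / c) + (z / c)\<^sup>2) + (x / c) ^ 3
      = (x * (y\<^sup>2 + 5 * y * z + z\<^sup>2) + x ^ 3) / c ^ 3"
    using c by (simp add: field_simps power2_eq_square power3_eq_cube)
  moreover have "y / c * (z / c) * (z / c - y / c) = y * z * (z - y) / c ^ 3"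
    using c by (simp add: field_simps power3_eq_cube)
  ultimately show ?thesis using c by (simp add: aligned_def divide_le_cancel)
qed

lemma min_scale: "0 < c \<Longrightarrow> min (curv (x / c) (z / c)) (1 / (8 * (z / c))) = c * min (curv x z) (1 / (8 * z))" for c x z :: real
  by (simp add: curv_scale min_mult_distrib_left)

context
  fixes c :: real assumes c: "0 < c"
begin

lemma aligned_scale1: "aligned x y c \<Longrightarrow> aligned (x / c) (y / c) 1"
  using aligned_scale[OF c, of x y c] c by simp

lemma le_imp_scale_ge_one: "c \<le> z \<Longrightarrow> 1 \<le> z / c" using c by simp

lemma exchange_AAC_BBC:
  assumes "0 < x" "x \<le> X" "0 < y" "y \<le> Y" "aligned X y c" "c \<le> z" "c \<le> Z"
  shows "line_cost x Y Z + line_cost X y z \<le> anti_cost x X z + anti_cost y Y Z"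
proof -
  have "c * (line_cost x Y Z + line_cost X y z) \<le> c * (anti_cost x X z + anti_cost y Y Z)"
    using exchange_AAC_BBC_unit[of "x / c" "X / c" "y / c" "Y / c" "z / c" "Z / c"] assms c
    by (simp add: anti_cost_scale line_cost_scale aligned_scale1 le_imp_scale_ge_one divide_right_mono distrib_left)
  thus ?thesis using c by simp
qed

lemma exchange_ACC_ABB:
  assumes "0 < x" "aligned x Y c" "0 < X" "X \<le> y" "aligned X Y c" "y \<le> Y" "c \<le> Z"
  shows "line_cost x Y Z + line_cost X y c \<le> bent_cost x c Z + bent_cost X y Y"
proof -
  have 1: "line_cost (X / c) (y / c) 1 = c * line_cost X y c" "bent_cost (x / c) 1 (Z / c) = c * bent_cost x c Z"
    using line_cost_scale[OF c, of X y c] bent_cost_scale[OF c, of x c Z] c by auto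
  have "c * (line_cost x Y Z + line_cost X y c) \<le> c * (bent_cost x c Z + bent_cost X y Y)"
    using exchange_ACC_ABB_unit[of "x / c" "Y / c" "X / c" "y / c" "Z / c"] assms c
    by (simp add: bent_cost_scale line_cost_scale 1 aligned_scale1 le_imp_scale_ge_one divide_right_mono distrib_left)
  thus ?thesis using c by simp
qed

lemma exchange_ACC_BBB_AAC:
  assumes "0 < x0" "x0 \<le> a" "0 < x1" "x1 \<le> a" "0 < x2" "x2 \<le> a"
    and "0 < u" "u \<le> v" "v \<le> t" "aligned a u c" "aligned a t c" "c \<le> z" "z \<le> Z" "c \<le> z'"
  shows "line_cost x0 t z + line_cost x1 u Z + line_cost x2 v z' \<le>
     anti_cost x0 z Z + anti_cost x1 x2 z' + anti_cost u v t + 3/2 * min (curv u t) (1 / (8 * t))"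
proof -
  have "line_cost (x0 / c) (t / c) (z / c) + line_cost (x1 / c) (u / c) (Z / c) + line_cost (x2 / c) (v / c) (z' / c) \<le>
     anti_cost (x0 / c) (z / c) (Z / c) + anti_cost (x1 / c) (x2 / c) (z' / c) + anti_cost (u / c) (v / c) (t / c)
     + 3/2 * min (curv (u / c) (t / c)) (1 / (8 * (t / c)))"
    by (rule exchange_ACC_BBB_AAC_unit[of "x0 / c" "a / c"]) (use assms c in \<open>auto simp: aligned_scale1 divide_right_mono\<close>)
  hence "c * (line_cost x0 t z + line_cost x1 u Z + line_cost x2 v z') \<le>
     c * (anti_cost x0 z Z + anti_cost x1 x2 z' + anti_cost u v t + 3/2 * min (curv u t) (1 / (8 * t)))"
    unfolding min_scale[OF c] anti_cost_scale[OF c] line_cost_scale[OF c] by (simp add: distrib_left)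
  thus ?thesis using c by (simp only: mult_le_cancel_left_pos)
qed

lemma exchange_ACC_AAB:
  assumes "0 < x0" "x0 \<le> a" "0 < x1" "x1 \<le> a" "0 < x2" "x2 \<le> a" "0 < y" "aligned a y c" "c \<le> Z"
  shows "anti_cost x1 x2 c + line_cost x0 y Z \<le> anti_cost x0 c Z + anti_cost x1 x2 y"
proof -
  have 1: "anti_cost (x1 / c) (x2 / c) 1 = c * anti_cost x1 x2 c" "anti_cost (x0 / c) 1 (Z / c) = c * anti_cost x0 c Z"
    using anti_cost_scale[OF c, of x1 x2 c] anti_cost_scale[OF c, of x0 c Z] c by auto
  have "c * (anti_cost x1 x2 c + line_cost x0 y Z) \<le> c * (anti_cost x0 c Z + anti_cost x1 x2 y)"
    using exchange_ACC_AAB_unit[of "x0 / c" "a / c" "x1 / c" "x2 / c" "y / c" "Z / c"] assms c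
    by (simp add: anti_cost_scale line_cost_scale 1 aligned_scale1 le_imp_scale_ge_one divide_right_mono distrib_left)
  thus ?thesis using c by simp
qed

lemma exchange_ACC_AAA:
  assumes "0 < x0" "0 < x1" "x1 \<le> x2" "x2 \<le> x3" "12 * x3 \<le> c" "12 * x0 \<le> c" "c \<le> Z"
  shows "anti_cost x1 x2 c + anti_cost x3 x0 Z \<le> anti_cost x0 c Z + anti_cost x1 x2 x3 + 3/2 * min (curv x1 x3) (1 / (8 * x3))"
proof -
  have 1: "anti_cost (x1 / c) (x2 / c) 1 = c * anti_cost x1 x2 c" "anti_cost (x0 / c) 1 (Z / c) = c * anti_cost x0 c Z"
    using anti_cost_scale[OF c, of x1 x2 c] anti_cost_scale[OF c, of x0 c Z] c by auto
  have "anti_cost (x1 / c) (x2 / c) 1 + anti_cost (x3 / c) (x0 / c) (Z / c) \<le> anti_cost (x0 / c) 1 (Z / c)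
      + anti_cost (x1 / c) (x2 / c) (x3 / c) + 3/2 * min (curv (x1 / c) (x3 / c)) (1 / (8 * (x3 / c)))"
    by (rule exchange_ACC_AAA_unit) (use assms c in \<open>auto simp: divide_right_mono\<close>)
  hence "c * (anti_cost x1 x2 c + anti_cost x3 x0 Z) \<le> c * (anti_cost x0 c Z + anti_cost x1 x2 x3 + 3/2 * min (curv x1 x3) (1 / (8 * x3)))"
    unfolding min_scale[OF c] anti_cost_scale[OF c] 1 by (simp add: distrib_left)
  thus ?thesis using c by (simp only: mult_le_cancel_left_pos)
qed

lemma exchange_BCC_AAC:
  assumes "0 < x" "x \<le> a" "0 < X" "X \<le> a" "0 < y" "aligned a y c" "c \<le> z" "c \<le> Z" "c \<le> z'"
  shows "bent_cost x z Z + line_cost X y z' \<le> anti_cost y z Z + anti_cost x X z'"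
proof -
  have "c * (bent_cost x z Z + line_cost X y z') \<le> c * (anti_cost y z Z + anti_cost x X z')"
    using exchange_BCC_AAC_unit[of "x / c" "a / c" "X / c" "y / c" "z / c" "Z / c" "z' / c"] assms c
    by (simp add: anti_cost_scale bent_cost_scale line_cost_scale aligned_scale1 le_imp_scale_ge_one divide_right_mono distrib_left)
  thus ?thesis using c by simp
qed

lemma exchange_AAC_CCC:
  assumes "0 < x" "12 * x \<le> c" "0 < X" "12 * X \<le> c" "c \<le> z" "c \<le> z1" "c \<le> z2" "c \<le> z3" "c \<le> z4"
  shows "bent_cost x z1 z2 + bent_cost X z3 z4 \<le> anti_cost x X z"
proof -
  have "c * (bent_cost x z1 z2 + bent_cost X z3 z4) \<le> c * anti_cost x X z"
    using exchange_AAC_CCC_unit[of "x / c" "X / c" "z / c" "z1 / c" "z2 / c" "z3 / c" "z4 / c"] assms c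
    by (simp add: anti_cost_scale bent_cost_scale le_imp_scale_ge_one distrib_left)
  thus ?thesis using c by simp
qed

end

section \<open>Choice of the additive constants\<close>

lemma anti_cost_sym: "anti_cost x y z = anti_cost y x z" "anti_cost x y z = anti_cost x z y"
  by (simp_all add: anti_cost_def add.commute)

lemma aligned_props:
  assumes "0 < x" "0 < y" "0 < z" "aligned x y z"
  shows "x < y" "y < z" "12 * x \<le> z"
proof -
  have q: "aligned (x / z) (y / z) 1" using aligned_scale1[OF assms(3,4)] .
  show "x < y" "y < z" "12 * x \<le> z"
    using aligned_less[OF _ _ q] aligned_lt_one[OF _ _ q] aligned_le_twelfth[OF _ _ q] assms by (auto simp: field_simps)
qed

lemma dual_constants:
  fixes A B C :: "real set" and fA fB fC :: "real \<Rightarrow> real"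
  assumes ne: "A \<noteq> {}" "B \<noteq> {}" "C \<noteq> {}"
    and pos: "\<And>x. x \<in> A \<union> B \<union> C \<Longrightarrow> 0 < x"
    and Q: "\<And>x y z. x \<in> A \<Longrightarrow> y \<in> B \<Longrightarrow> z \<in> C \<Longrightarrow> aligned x y z"
    and f: "\<And>x y z. x \<in> A \<Longrightarrow> y \<in> B \<Longrightarrow> z \<in> C \<Longrightarrow> fA x + fB y + fC z \<le> line_cost x y z"
  obtains kA kB kC :: real where "kA + kB + kC = 0"
    "\<And>x y z. x \<in> A \<Longrightarrow> y \<in> A \<Longrightarrow> z \<in> A \<Longrightarrow> x \<le> y \<Longrightarrow> y \<le> z \<Longrightarrow>
       fA x + fA y + fA z + 3 * kA \<le> anti_cost x y z + 3/2 * min (curv x z) (1 / (8 * z))"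
    "\<And>x y z. x \<in> A \<Longrightarrow> y \<in> A \<Longrightarrow> z \<in> B \<Longrightarrow> x \<le> y \<Longrightarrow> fA x + fA y + fB z + (2 * kA + kB) \<le> anti_cost x y z"
    "\<And>x y z. x \<in> A \<Longrightarrow> y \<in> A \<Longrightarrow> z \<in> C \<Longrightarrow> x \<le> y \<Longrightarrow> fA x + fA y + fC z + (2 * kA + kC) \<le> anti_cost x y z"
    "\<And>x y z. x \<in> A \<Longrightarrow> y \<in> B \<Longrightarrow> z \<in> B \<Longrightarrow> y \<le> z \<Longrightarrow> fA x + fB y + fB z + (kA + 2 * kB) \<le> bent_cost x y z"
    "\<And>x y z. x \<in> A \<Longrightarrow> y \<in> C \<Longrightarrow> z \<in> C \<Longrightarrow> y \<le> z \<Longrightarrow> fA x + fC y + fC z + (kA + 2 * kC) \<le> bent_cost x y z"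
    "\<And>x y z. x \<in> B \<Longrightarrow> y \<in> B \<Longrightarrow> z \<in> B \<Longrightarrow> x \<le> y \<Longrightarrow> y \<le> z \<Longrightarrow>
       fB x + fB y + fB z + 3 * kB \<le> anti_cost x y z + 3/2 * min (curv x z) (1 / (8 * z))"
    "\<And>x y z. x \<in> B \<Longrightarrow> y \<in> B \<Longrightarrow> z \<in> C \<Longrightarrow> x \<le> y \<Longrightarrow> fB x + fB y + fC z + (2 * kB + kC) \<le> anti_cost x y z"
    "\<And>x y z. x \<in> B \<Longrightarrow> y \<in> C \<Longrightarrow> z \<in> C \<Longrightarrow> y \<le> z \<Longrightarrow> fB x + fC y + fC z + (kB + 2 * kC) \<le> anti_cost x y z"
    "\<And>x y z. x \<in> C \<Longrightarrow> y \<in> C \<Longrightarrow> z \<in> C \<Longrightarrow> x \<le> y \<Longrightarrow> y \<le> z \<Longrightarrow> fC x + fC y + fC z + 3 * kC \<le> 0"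
proof -
  define SP where "SP = {anti_cost x X z - fA x - fA X - fC z | x X z. x \<in> A \<and> X \<in> A \<and> z \<in> C \<and> x \<le> X}"
  define SQ where "SQ = {fA x + fC z + fC Z - bent_cost x z Z | x z Z. x \<in> A \<and> z \<in> C \<and> Z \<in> C \<and> z \<le> Z}"
  obtain a0 b0 c0 where abc: "a0 \<in> A" "b0 \<in> B" "c0 \<in> C" using ne by blast
  have SP0: "SP \<noteq> {}" and SQ0: "SQ \<noteq> {}" using abc unfolding SP_def SQ_def by blast+
  have pA: "0 < x" if "x \<in> A" for x using pos that by auto
  have pB: "0 < x" if "x \<in> B" for x using pos that by auto
  have pC: "0 < x" if "x \<in> C" for x using pos that by auto
  note pr = aligned_props[OF pA pB pC Q]
  have mC: "min z Z \<in> C" if "z \<in> C" "Z \<in> C" for z Z using that by (auto simp: min_def)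
  have mA: "max z Z \<in> A" if "z \<in> A" "Z \<in> A" for z Z using that by (auto simp: max_def)
  have fe: "anti_cost x z Z \<le> bent_cost x z Z" if "x \<in> A" "z \<in> C" "Z \<in> C" "z \<le> Z" for x z Z
    using pr(3)[of x b0 z] abc that pA[of x] pC[of z] by (intro bent_cost_ge_anti_cost) auto
  have e1: "fB y + fB Y + fC Z + (fA x + fA X + fC z) \<le> anti_cost x X z + anti_cost y Y Z"
    if "x \<in> A" "X \<in> A" "z \<in> C" "x \<le> X" "y \<in> B" "Y \<in> B" "Z \<in> C" "y \<le> Y" for x X z y Y Z
  proof -
    \<comment> \<open>Alignment is available for every choice from the three sets, so the scale may
      be the smaller of the two outer radii. The later exchanges use \<open>min\<close> and
      \<open>max\<close> in the same way.\<close>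
    have "line_cost x Y Z + line_cost X y z \<le> anti_cost x X z + anti_cost y Y Z"
      by (rule exchange_AAC_BBC[of "min z Z"]) (use that pA pB pC mC Q in auto)
    thus ?thesis using f[of x Y Z] f[of X y z] that by linarith
  qed
  have e2: "fA X + fB y + fB Y + (fA x + fC z + fC Z) \<le> bent_cost x z Z + bent_cost X y Y"
    if "x \<in> A" "z \<in> C" "Z \<in> C" "z \<le> Z" "X \<in> A" "y \<in> B" "Y \<in> B" "y \<le> Y" for x z Z X y Y
  proof -
    have "line_cost x Y Z + line_cost X y z \<le> bent_cost x z Z + bent_cost X y Y"
      by (rule exchange_ACC_ABB) (use that pA pB pC Q pr(1)[of X y z] in auto)
    thus ?thesis using f[of x Y Z] f[of X y z] that by linarith
  qed
  \<comment> \<open>Exchanging with one fixed \<open>BBC\<close> triple bounds all slacks in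
    \<open>SP\<close> at once; a fixed \<open>ABB\<close> triple does the same for
    \<open>SQ\<close>.\<close>
  have bP: "bdd_below SP"
    unfolding bdd_below_def SP_def using e1[OF _ _ _ _ abc(2,2,3)]
    by (intro exI[of _ "fB b0 + fB b0 + fC c0 - anti_cost b0 b0 c0"]) force
  have bQ: "bdd_above SQ"
    unfolding bdd_above_def SQ_def using e2[OF _ _ _ _ abc(1,2,2)]
    by (intro exI[of _ "bent_cost a0 b0 b0 - fA a0 - fB b0 - fB b0"]) force
  define p where "p = Inf SP"
  define q where "q = Sup SQ"
  have pl: "p \<le> anti_cost x X z - fA x - fA X - fC z" if "x \<in> A" "X \<in> A" "z \<in> C" for x X z
  proof (cases "x \<le> X")
    case True thus ?thesis unfolding p_def using that by (intro cInf_lower bP) (auto simp: SP_def)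
  next
    case False
    have "p \<le> anti_cost X x z - fA X - fA x - fC z"
      unfolding p_def using that False by (intro cInf_lower bP) (force simp: SP_def)
    thus ?thesis using anti_cost_sym(1)[of x X z] by linarith
  qed
  have pg: "r \<le> p" if "\<And>x X z. x \<in> A \<Longrightarrow> X \<in> A \<Longrightarrow> z \<in> C \<Longrightarrow> x \<le> X \<Longrightarrow> r \<le> anti_cost x X z - fA x - fA X - fC z" for r
    unfolding p_def using that by (intro cInf_greatest SP0) (auto simp: SP_def)
  have qu: "fA x + fC z + fC Z - bent_cost x z Z \<le> q" if "x \<in> A" "z \<in> C" "Z \<in> C" "z \<le> Z" for x z Z
    unfolding q_def using that by (intro cSup_upper bQ) (auto simp: SQ_def)
  have ql: "q \<le> r" if "\<And>x z Z. x \<in> A \<Longrightarrow> z \<in> C \<Longrightarrow> Z \<in> C \<Longrightarrow> z \<le> Z \<Longrightarrow> fA x + fC z + fC Z - bent_cost x z Z \<le> r" for r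
    unfolding q_def using that by (intro cSup_least SQ0) (auto simp: SQ_def)
  show ?thesis
  \<comment> \<open>The solution of \<open>2 * kA + kC = p\<close>, \<open>kA + 2 * kC = - q\<close>
    and \<open>kA + kB + kC = 0\<close>. Hence \<open>3 * kA = 2 * p + q\<close>,
    \<open>2 * kA + kB = p + q\<close>, \<open>kA + 2 * kB = q\<close>,
    \<open>3 * kB = q - p\<close>, \<open>2 * kB + kC = - p\<close>,
    \<open>kB + 2 * kC = - p - q\<close> and \<open>3 * kC = - p - 2 * q\<close>. Each
    \<open>p\<close> stands for an \<open>AAC\<close> triple and each \<open>q\<close> for an
    \<open>ACC\<close> triple in the matching exchange.\<close>
  proof (rule that[of "(2 * p + q) / 3" "(q - p) / 3" "(- p - 2 * q) / 3"], goal_cases)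
    case 1 show ?case by (simp add: field_simps)
  next
    case (2 x1 x2 x3)
    have "q \<le> anti_cost x1 x2 x3 + 3/2 * min (curv x1 x3) (1 / (8 * x3)) - fA x1 - fA x2 - fA x3 - 2 * p"
    proof (rule ql)
      fix x z Z assume h: "x \<in> A" "z \<in> C" "Z \<in> C" "z \<le> Z"
      have "anti_cost x1 x2 z + anti_cost x3 x Z \<le> anti_cost x z Z + anti_cost x1 x2 x3 + 3/2 * min (curv x1 x3) (1 / (8 * x3))"
        by (rule exchange_ACC_AAA) (use h 2 abc pA pC pr(3)[of x3 b0 z] pr(3)[of x b0 z] in auto)
      thus "fA x + fC z + fC Z - bent_cost x z Z \<le> anti_cost x1 x2 x3 + 3/2 * min (curv x1 x3) (1 / (8 * x3)) - fA x1 - fA x2 - fA x3 - 2 * p"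
        using pl[of x1 x2 z] pl[of x3 x Z] fe[of x z Z] 2 h by linarith
    qed
    thus ?case by (simp add: field_simps)
  next
    case (3 x1 x2 y)
    have "q \<le> anti_cost x1 x2 y - fA x1 - fA x2 - fB y - p"
    proof (rule ql)
      fix x z Z assume h: "x \<in> A" "z \<in> C" "Z \<in> C" "z \<le> Z"
      have "anti_cost x1 x2 z + line_cost x y Z \<le> anti_cost x z Z + anti_cost x1 x2 y"
        by (rule exchange_ACC_AAB[of z x "max x (max x1 x2)"]) (use h 3 abc pA pB pC Q mA in auto)
      thus "fA x + fC z + fC Z - bent_cost x z Z \<le> anti_cost x1 x2 y - fA x1 - fA x2 - fB y - p"
        using pl[of x1 x2 z] f[of x y Z] fe[of x z Z] 3 h by linarith
    qed
    thus ?case by (simp add: field_simps)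
  next
    case (4 x y z)
    thus ?case using pl[of x y z] by (simp add: field_simps)
  next
    case (5 x y z)
    have "q \<le> bent_cost x y z - fA x - fB y - fB z"
      by (rule ql) (use e2[OF _ _ _ _ 5] in \<open>force\<close>)
    thus ?case by (simp add: field_simps)
  next
    case (6 x y z)
    thus ?case using qu[of x y z] by (simp add: field_simps)
  next
    case (7 u v t)
    have "q \<le> anti_cost u v t + 3/2 * min (curv u t) (1 / (8 * t)) - fB u - fB v - fB t + p"
    proof (rule ql)
      fix x0 z Z assume h: "x0 \<in> A" "z \<in> C" "Z \<in> C" "z \<le> Z"
      have "fA x0 + fC z + fC Z - bent_cost x0 z Z - (anti_cost u v t + 3/2 * min (curv u t) (1 / (8 * t)) - fB u - fB v - fB t) \<le> p"
      proof (rule pg)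
        fix x1 x2 z' assume g: "x1 \<in> A" "x2 \<in> A" "z' \<in> C" "x1 \<le> x2"
        have "line_cost x0 t z + line_cost x1 u Z + line_cost x2 v z' \<le>
            anti_cost x0 z Z + anti_cost x1 x2 z' + anti_cost u v t + 3/2 * min (curv u t) (1 / (8 * t))"
          by (rule exchange_ACC_BBB_AAC[of "min z z'" x0 "max x0 x2"]) (use h g 7 pA pB pC mC mA Q in auto)
        thus "fA x0 + fC z + fC Z - bent_cost x0 z Z - (anti_cost u v t + 3/2 * min (curv u t) (1 / (8 * t)) - fB u - fB v - fB t)
            \<le> anti_cost x1 x2 z' - fA x1 - fA x2 - fC z'"
          using f[of x0 t z] f[of x1 u Z] f[of x2 v z'] fe[of x0 z Z] h g 7 by linarith
      qed
      thus "fA x0 + fC z + fC Z - bent_cost x0 z Z \<le> anti_cost u v t + 3/2 * min (curv u t) (1 / (8 * t)) - fB u - fB v - fB t + p"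
        by linarith
    qed
    thus ?case by (simp add: field_simps)
  next
    case (8 y Y Z)
    have "fB y + fB Y + fC Z - anti_cost y Y Z \<le> p"
      by (rule pg) (use e1[OF _ _ _ _ 8(1,2,3,4)] in force)
    thus ?case by (simp add: field_simps)
  next
    case (9 y z Z)
    have "fB y + fC z + fC Z - anti_cost y z Z - q \<le> p"
    proof (rule pg)
      fix x X z' assume g: "x \<in> A" "X \<in> A" "z' \<in> C" "x \<le> X"
      have "bent_cost x z Z + line_cost X y z' \<le> anti_cost y z Z + anti_cost x X z'"
        by (rule exchange_BCC_AAC[of "min z z'" x X]) (use g 9 pA pB pC mC Q in auto)
      thus "fB y + fC z + fC Z - anti_cost y z Z - q \<le> anti_cost x X z' - fA x - fA X - fC z'"
        using f[of X y z'] qu[of x z Z] g 9 by linarith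
    qed
    thus ?case by (simp add: field_simps)
  next
    case (10 z1 z2 z3)
    have "fC z1 + fC z2 + fC z3 - 2 * q \<le> p"
    proof (rule pg)
      fix x X z assume g: "x \<in> A" "X \<in> A" "z \<in> C" "x \<le> X"
      \<comment> \<open>\<open>bent_cost\<close> is not symmetric in its last two arguments, and
        \<open>q\<close> only controls pairs in increasing order.\<close>
      define w1 where "w1 = min z z3"
      define w2 where "w2 = max z z3"
      have w: "w1 \<in> C" "w2 \<in> C" "w1 \<le> w2" "fC w1 + fC w2 = fC z + fC z3"
        using g 10 by (auto simp: w1_def w2_def min_def max_def)
      have "bent_cost x z1 z2 + bent_cost X w1 w2 \<le> anti_cost x X z"
        by (rule exchange_AAC_CCC[of "min z1 w1"])
          (use g 10 w pA pC mC abc pr(3)[of x b0 "min z1 w1"]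
             pr(3)[of X b0 "min z1 w1"] in \<open>auto simp: w1_def w2_def\<close>)
      thus "fC z1 + fC z2 + fC z3 - 2 * q \<le> anti_cost x X z - fA x - fA X - fC z"
        using qu[of x z1 z2] qu[of X w1 w2] w g 10 by linarith
    qed
    thus ?case by (simp add: field_simps)
  qed
qed

section \<open>Lower bounds for the radial cost\<close>

text \<open>The left side is the tangent at \<open>d0\<close> of \<open>1 / d\<close> as a convex
  function of \<open>d^2\<close>. Where it is negative \<open>ennreal\<close> turns it into
  \<open>0\<close>, which is harmless for a lower bound.\<close>

lemma recip_dist_tangent:
  assumes "0 < d0" "0 \<le> d"
  shows "ennreal (3 / (2 * d0) - d\<^sup>2 / (2 * d0 ^ 3)) \<le> recip_dist d"
proof (cases "d = 0")
  case False
  hence d: "0 < d" using assms by simp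
  have "0 \<le> (d - d0)\<^sup>2 * (d + 2 * d0) / (2 * d * d0 ^ 3)" using d assms by simp
  also have "\<dots> = 1 / d - (3 / (2 * d0) - d\<^sup>2 / (2 * d0 ^ 3))"
    using d assms by (simp add: field_simps power2_eq_square power3_eq_cube)
  finally show ?thesis using False by (simp add: recip_dist_def ennreal_leI)
qed (simp add: recip_dist_def)

lemma ennreal_add_le: "ennreal (a + b) \<le> ennreal a + ennreal b"
  by (cases "0 \<le> a"; cases "0 \<le> b")
     (auto simp: ennreal_neg ennreal_plus[symmetric] simp del: ennreal_plus intro!: ennreal_leI)

lemma law_of_cosines_nonneg: "0 \<le> r \<Longrightarrow> 0 \<le> s \<Longrightarrow> 0 \<le> r\<^sup>2 + s\<^sup>2 - 2 * r * s * cos a" for r s a :: real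
proof -
  assume "0 \<le> r" "0 \<le> s"
  hence "0 \<le> (r - s)\<^sup>2 + 2 * r * s * (1 - cos a)" by (intro add_nonneg_nonneg mult_nonneg_nonneg) auto
  thus ?thesis by (simp add: algebra_simps power2_eq_square)
qed

lemma recip_half_diff: "3 / (2 * w) - 1 / (2 * w) = 1 / w" for w :: real
  by (cases "w = 0") (auto simp: field_simps)

lemma one_plus_cos: "1 + cos t = 2 * \<bar>cos (t / 2)\<bar>\<^sup>2" for t :: real
  using cos_double_cos[of "t / 2"] by simp

lemma one_minus_cos: "1 - cos t = 2 * \<bar>sin (t / 2)\<bar>\<^sup>2" for t :: real
  using cos_double_sin[of "t / 2"] by simp

lemma recip_dist_cos_ge:
  assumes "0 < r" "0 < s"
  shows "ennreal (1 / (r + s) + curv r s * (1 + cos a)) \<le> recip_dist (sqrt (r\<^sup>2 + s\<^sup>2 - 2 * r * s * cos a))"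
proof -
  define D where "D = r\<^sup>2 + s\<^sup>2 - 2 * r * s * cos a"
  have D: "0 \<le> D" unfolding D_def using assms by (intro law_of_cosines_nonneg) auto
  have "D = (r + s)\<^sup>2 - 2 * (r * s * (1 + cos a))" by (simp add: D_def algebra_simps power2_eq_square)
  hence "3 / (2 * (r + s)) - D / (2 * (r + s) ^ 3)
      = 3 / (2 * (r + s)) - (r + s)\<^sup>2 / (2 * (r + s) ^ 3) + (r * s * (1 + cos a)) / (r + s) ^ 3"
    by (simp add: diff_divide_distrib)
  also have "(r + s)\<^sup>2 / (2 * (r + s) ^ 3) = 1 / (2 * (r + s))"
    using assms by (simp add: power2_eq_square power3_eq_cube)
  also have "3 / (2 * (r + s)) - 1 / (2 * (r + s)) = 1 / (r + s)"
    by (rule recip_half_diff)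
  finally have "3 / (2 * (r + s)) - (sqrt D)\<^sup>2 / (2 * (r + s) ^ 3) = 1 / (r + s) + curv r s * (1 + cos a)"
    using D by (simp add: curv_def)
  thus ?thesis using recip_dist_tangent[of "r + s" "sqrt D"] assms D by (simp add: D_def)
qed

text \<open>The counterpart of \<open>recip_dist_cos_ge\<close> with the tangent taken at
  \<open>s - r\<close>, the distance of two points on the same ray.\<close>

lemma recip_dist_cos_ge':
  assumes "0 < r" "r < s"
  shows "ennreal (1 / (s - r) - r * s / (s - r) ^ 3 * (1 - cos a)) \<le> recip_dist (sqrt (r\<^sup>2 + s\<^sup>2 - 2 * r * s * cos a))"
proof -
  define D where "D = r\<^sup>2 + s\<^sup>2 - 2 * r * s * cos a"
  have D: "0 \<le> D" unfolding D_def using assms by (intro law_of_cosines_nonneg) auto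
  have "D = (s - r)\<^sup>2 + 2 * (r * s * (1 - cos a))" by (simp add: D_def algebra_simps power2_eq_square)
  hence "3 / (2 * (s - r)) - D / (2 * (s - r) ^ 3)
      = 3 / (2 * (s - r)) - (s - r)\<^sup>2 / (2 * (s - r) ^ 3) - (r * s * (1 - cos a)) / (s - r) ^ 3"
    by (simp add: add_divide_distrib)
  also have "(s - r)\<^sup>2 / (2 * (s - r) ^ 3) = 1 / (2 * (s - r))"
    using assms by (simp add: power2_eq_square power3_eq_cube)
  also have "3 / (2 * (s - r)) - 1 / (2 * (s - r)) = 1 / (s - r)"
    by (rule recip_half_diff)
  finally have "3 / (2 * (s - r)) - (sqrt D)\<^sup>2 / (2 * (s - r) ^ 3) = 1 / (s - r) - r * s / (s - r) ^ 3 * (1 - cos a)"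
    using D by simp
  thus ?thesis using recip_dist_tangent[of "s - r" "sqrt D"] assms D by (simp add: D_def)
qed

lemma ennreal_sum3_le:
  assumes "ennreal a \<le> A" "ennreal b \<le> B" "ennreal c \<le> C" "k \<le> a + b + c"
  shows "ennreal k \<le> A + B + C"
proof -
  have "ennreal k \<le> ennreal (a + b + c)" using assms by (intro ennreal_leI)
  also have "\<dots> \<le> ennreal (a + b) + ennreal c" by (rule ennreal_add_le)
  also have "\<dots> \<le> ennreal a + ennreal b + ennreal c" by (intro add_right_mono ennreal_add_le)
  also have "\<dots> \<le> A + B + C" using assms by (intro add_mono)
  finally show ?thesis .
qed

section \<open>Bounds uniform in the angles\<close>

lemma radial_cost_geI:
  assumes "\<And>\<alpha> \<beta>. ennreal k \<le> coulomb_C r1 r2 r3 \<alpha> \<beta>"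
  shows "ennreal k \<le> radial_cost (r1, r2, r3)"
  unfolding radial_cost_def using assms by (auto intro: INF_greatest)

lemma coulomb_ge:
  assumes "0 < x" "0 < y" "0 < z"
    and "k \<le> anti_cost x y z + curv x y * (1 + cos \<alpha>) + curv x z * (1 + cos \<beta>) + curv y z * (1 + cos (\<alpha> - \<beta>))"
  shows "ennreal k \<le> coulomb_C x y z \<alpha> \<beta>"
  unfolding coulomb_C_def
  by (rule ennreal_sum3_le[OF recip_dist_cos_ge[OF assms(1,2)] recip_dist_cos_ge[OF assms(1,3)]
        recip_dist_cos_ge[OF assms(2,3)]])
     (use assms(4) in \<open>simp add: anti_cost_def\<close>)

lemma curv_nonneg: "0 < r \<Longrightarrow> 0 < s \<Longrightarrow> 0 \<le> curv r s * (1 + cos a)"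
  using curv_pos[of r s] cos_ge_minus_one[of a] by (intro mult_nonneg_nonneg) linarith+

lemma radial_cost_ge_anti_cost:
  assumes "0 < x" "0 < y" "0 < z"
  shows "ennreal (anti_cost x y z) \<le> radial_cost (x, y, z)"
  by (intro radial_cost_geI coulomb_ge)
     (use assms curv_nonneg[OF assms(1,2)] curv_nonneg[OF assms(1,3)] curv_nonneg[OF assms(2,3)] in
       \<open>auto intro!: add_nonneg_nonneg\<close>)

text \<open>For fixed \<open>x\<close>, the function \<open>s / (x + s)^3\<close> peaks at
  \<open>s = x / 2\<close> and decreases afterwards.\<close>

lemma curv_antimono:
  assumes "0 < x" "x \<le> y" "y \<le> z"
  shows "curv x z \<le> curv x y"
proof -
  define p q where "p = y - x" and "q = z - y"
  have n: "0 \<le> p" "0 \<le> q" "y = x + p" "z = x + p + q" using assms by (auto simp: p_def q_def)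
  have "y * (x + z) ^ 3 - z * (x + y) ^ 3 = 
     q * (4 * x ^ 3 + 12 * x\<^sup>2 * p + 6 * x\<^sup>2 * q + 9 * x * p\<^sup>2 + 9 * x * p * q + x * q\<^sup>2 + 2 * p ^ 3 + 3 * p\<^sup>2 * q + p * q\<^sup>2)"
    unfolding n by (simp add: algebra_simps power2_eq_square power3_eq_cube)
  also have "\<dots> \<ge> 0" using n assms by simp
  finally have "z * (x + y) ^ 3 \<le> y * (x + z) ^ 3" by simp
  hence "x * (z * (x + y) ^ 3) \<le> x * (y * (x + z) ^ 3)" using assms by simp
  thus ?thesis unfolding curv_def using assms by (simp add: divide_le_eq le_divide_eq mult_ac)
qed

text \<open>For fixed \<open>z\<close>, \<open>curv r z\<close> increases up to
  \<open>r = z / 2\<close> and then decreases, so on \<open>[x, z]\<close> its minimum is at an end;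
  the value at \<open>r = z\<close> is \<open>1 / (8 * z)\<close>. With \<open>curv_antimono\<close>
  this gives one lower bound for all three coefficients.\<close>

lemma min_curv_le:
  assumes "0 < x" "x \<le> y" "y \<le> z"
  shows "min (curv x z) (1 / (8 * z)) \<le> curv y z"
proof (cases "4 * y \<le> z")
  case True
  have "x * y \<le> (z / 4) * (z / 4)" using assms True by (intro mult_mono) auto
  hence 1: "x * y * (3 * z + x + y) \<le> (z / 4) * (z / 4) * (4 * z)" using assms True by (intro mult_mono) auto
  also have "\<dots> \<le> z ^ 3" using assms by (simp add: power3_eq_cube)
  finally have "0 \<le> (y - x) * (z ^ 3 - x * y * (3 * z + x + y))" using assms by simp
  also have "\<dots> = y * (x + z) ^ 3 - x * (y + z) ^ 3" by (simp add: algebra_simps power2_eq_square power3_eq_cube)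
  finally have "x * (y + z) ^ 3 \<le> y * (x + z) ^ 3" by simp
  hence "z * (x * (y + z) ^ 3) \<le> z * (y * (x + z) ^ 3)" using assms by simp
  hence "curv x z \<le> curv y z" unfolding curv_def using assms by (simp add: divide_le_eq le_divide_eq mult_ac)
  thus ?thesis by simp
next
  case False
  define d where "d = z - y"
  have d: "0 \<le> d" "y = z - d" "4 * d \<le> 3 * z" using assms False by (auto simp: d_def)
  have "8 * (y * z\<^sup>2) - (y + z) ^ 3 = d * (4 * z\<^sup>2 - 6 * (z * d) + d\<^sup>2)"
    unfolding d by (simp add: algebra_simps power2_eq_square power3_eq_cube)
  moreover have "0 \<le> 4 * z\<^sup>2 - 6 * (z * d) + d\<^sup>2"
  proof -
    have "0 \<le> (3 * z - 4 * d) * (21 * z - 4 * d)" using d assms by (intro mult_nonneg_nonneg) auto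
    moreover have "(3 * z - 4 * d) * (21 * z - 4 * d) = 63 * z\<^sup>2 - 96 * (z * d) + 16 * d\<^sup>2"
      by (simp add: algebra_simps power2_eq_square)
    ultimately show ?thesis using zero_le_power2[of z] by linarith
  qed
  ultimately have "(y + z) ^ 3 \<le> 8 * (y * z\<^sup>2)"
    using mult_nonneg_nonneg[OF d(1)] by fastforce
  hence "1 / (8 * z) \<le> curv y z" unfolding curv_def using assms
    by (simp add: divide_le_eq le_divide_eq mult_ac power2_eq_square)
  thus ?thesis by simp
qed

text \<open>With \<open>S\<close> the modulus of the half-angle cosine of the pair
  \<open>y, z\<close>, the sum-to-product formula bounds the angular part below by
  \<open>2 * m - 2 * m * S + 2 * k * S^2\<close>. The square is completed at
  \<open>S = m / (2 * k)\<close>.\<close>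

lemma radial_cost_ge_bent_cost:
  assumes "0 < x" "x \<le> y" "y \<le> z"
  shows "ennreal (bent_cost x y z) \<le> radial_cost (x, y, z)"
proof (intro radial_cost_geI coulomb_ge)
  fix \<alpha> \<beta> :: real
  define m k where "m = curv x z" and "k = curv y z"
  have p: "0 < m" "0 < k" using assms by (auto simp: m_def k_def intro: curv_pos)
  have "m * (1 + cos \<alpha>) \<le> curv x y * (1 + cos \<alpha>)"
    using curv_antimono[OF assms] cos_ge_minus_one[of \<alpha>] unfolding m_def by (intro mult_right_mono) linarith+
  moreover have "2 * m - m\<^sup>2 / (2 * k) \<le> m * (1 + cos \<alpha>) + m * (1 + cos \<beta>) + k * (1 + cos (\<alpha> - \<beta>))"
  proof -
    define S where "S = \<bar>cos ((\<alpha> - \<beta>) / 2)\<bar>"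
    have c1: "1 + cos (\<alpha> - \<beta>) = 2 * S\<^sup>2" unfolding S_def by (rule one_plus_cos)
    have "cos \<alpha> + cos \<beta> = 2 * cos ((\<alpha> + \<beta>) / 2) * cos ((\<alpha> - \<beta>) / 2)" by (rule cos_plus_cos)
    moreover have "\<bar>cos ((\<alpha> + \<beta>) / 2) * cos ((\<alpha> - \<beta>) / 2)\<bar> \<le> 1 * S"
      unfolding abs_mult S_def by (intro mult_right_mono) auto
    ultimately have c2: "- 2 * S \<le> cos \<alpha> + cos \<beta>" by linarith
    have "m * (- 2 * S) \<le> m * (cos \<alpha> + cos \<beta>)" using c2 p by (intro mult_left_mono) auto
    moreover have "m * (1 + cos \<alpha>) + m * (1 + cos \<beta>) = 2 * m + m * (cos \<alpha> + cos \<beta>)" by (simp add: algebra_simps)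
    moreover have "0 \<le> (2 * k * S - m)\<^sup>2 / (2 * k)" using p by simp
    moreover have "(2 * k * S - m)\<^sup>2 / (2 * k) = k * (2 * S\<^sup>2) + m * (- 2 * S) + m\<^sup>2 / (2 * k)"
      using p by (simp add: field_simps power2_eq_square)
    ultimately show ?thesis unfolding c1 by linarith
  qed
  ultimately show "bent_cost x y z \<le> anti_cost x y z + curv x y * (1 + cos \<alpha>) + curv x z * (1 + cos \<beta>) + curv y z * (1 + cos (\<alpha> - \<beta>))"
    unfolding bent_cost_def m_def[symmetric] k_def[symmetric] by linarith
qed (use assms in auto)

text \<open>The squared length of a sum of three unit vectors is nonnegative, so the cosines of
  their pairwise angles add up to at least \<open>-3/2\<close>, and
  \<open>3 - 3/2 = 3/2\<close>.\<close>

lemma radial_cost_ge_tri: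
  assumes "0 < x" "x \<le> y" "y \<le> z"
  shows "ennreal (anti_cost x y z + 3/2 * min (curv x z) (1 / (8 * z))) \<le> radial_cost (x, y, z)"
proof (intro radial_cost_geI coulomb_ge)
  fix \<alpha> \<beta> :: real
  define M where "M = min (curv x z) (1 / (8 * z))"
  have M: "0 \<le> M" "M \<le> curv x z" "M \<le> curv x y" "M \<le> curv y z"
    using assms curv_antimono[OF assms] min_curv_le[OF assms] curv_pos[of x z] by (auto simp: M_def)
  have "M * (1 + cos \<alpha>) \<le> curv x y * (1 + cos \<alpha>)" "M * (1 + cos \<beta>) \<le> curv x z * (1 + cos \<beta>)"
     "M * (1 + cos (\<alpha> - \<beta>)) \<le> curv y z * (1 + cos (\<alpha> - \<beta>))"
    using M cos_ge_minus_one[of \<alpha>] cos_ge_minus_one[of \<beta>] cos_ge_minus_one[of "\<alpha> - \<beta>"]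
    by (intro mult_right_mono; linarith)+
  moreover have "0 \<le> (1 + cos \<alpha> + cos \<beta>)\<^sup>2 + (sin \<alpha> + sin \<beta>)\<^sup>2" by simp
  moreover have "(1 + cos \<alpha> + cos \<beta>)\<^sup>2 + (sin \<alpha> + sin \<beta>)\<^sup>2 = 3 + 2 * cos \<alpha> + 2 * cos \<beta> + 2 * cos (\<alpha> - \<beta>)"
    using sin_cos_squared_add[of \<alpha>] sin_cos_squared_add[of \<beta>] unfolding cos_diff by algebra
  moreover have "M * (3/2) \<le> M * (3 + (cos \<alpha> + cos \<beta> + cos (\<alpha> - \<beta>)))"
    using M calculation by (intro mult_left_mono) linarith+
  ultimately show "anti_cost x y z + 3/2 * min (curv x z) (1 / (8 * z))
     \<le> anti_cost x y z + curv x y * (1 + cos \<alpha>) + curv x z * (1 + cos \<beta>) + curv y z * (1 + cos (\<alpha> - \<beta>))"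
    unfolding M_def[symmetric] by (simp add: algebra_simps)
qed (use assms in auto)

text \<open>The upper bound is the collinear configuration \<open>\<alpha> = pi\<close>,
  \<open>\<beta> = 0\<close>. For the lower bound, tangents at its three distances leave a quadratic
  inequality between half angles.\<close>

lemma radial_cost_eq_line_cost:
  assumes x: "0 < x" "0 < y" "0 < z" and Q: "aligned x y z"
  shows "radial_cost (x, y, z) = ennreal (line_cost x y z)"
proof (rule antisym)
  note o = aligned_props[OF x Q]
  show "ennreal (line_cost x y z) \<le> radial_cost (x, y, z)"
  proof (rule radial_cost_geI)
    fix \<alpha> \<beta> :: real
    define m k \<nu> where "m = curv x y" and "k = curv y z" and "\<nu> = x * z / (z - x) ^ 3"
    have p: "0 < m" "0 < k" "0 < \<nu>" using x o by (auto simp: m_def k_def \<nu>_def intro: curv_pos)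
    \<comment> \<open>Divided by \<open>x * y * z\<close>, the cubic hypothesis says precisely
      \<open>1 / m + 1 / k <= 1 / \<nu>\<close>.\<close>
    have nk: "\<nu> * (m + k) \<le> m * k"
    proof -
      have "0 \<le> (y + z) * (y * z * (z - y) - (x * (y\<^sup>2 + 5 * y * z + z\<^sup>2) + x ^ 3))"
        using Q x unfolding aligned_def by (intro mult_nonneg_nonneg) auto
      hence "x * (z + y) ^ 3 + z * (x + y) ^ 3 \<le> y * (z - x) ^ 3"
        using condition_factor[of y z x] by linarith
      hence "(x * (z + y) ^ 3 + z * (x + y) ^ 3) / (x * y * z) \<le> y * (z - x) ^ 3 / (x * y * z)"
        using x by (intro divide_right_mono) auto
      moreover have "(x * (z + y) ^ 3 + z * (x + y) ^ 3) / (x * y * z) = 1 / k + 1 / m"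
        using x by (simp add: m_def k_def curv_def add_divide_distrib add.commute)
      moreover have "y * (z - x) ^ 3 / (x * y * z) = 1 / \<nu>" using x by (simp add: \<nu>_def)
      ultimately have "1 / k + 1 / m \<le> 1 / \<nu>" by simp
      hence "\<nu> * (m * k) * (1 / k + 1 / m) \<le> \<nu> * (m * k) * (1 / \<nu>)" using p by (intro mult_left_mono) auto
      thus ?thesis using p by (simp add: distrib_left)
    qed
    define s1 s2 s3 where "s1 = \<bar>cos (\<alpha> / 2)\<bar>" and "s2 = \<bar>sin (\<beta> / 2)\<bar>" and "s3 = \<bar>cos ((\<alpha> - \<beta>) / 2)\<bar>"
    have c1: "1 + cos \<alpha> = 2 * s1\<^sup>2" unfolding s1_def by (rule one_plus_cos)
    have c2: "1 - cos \<beta> = 2 * s2\<^sup>2" unfolding s2_def by (rule one_minus_cos)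
    have c3: "1 + cos (\<alpha> - \<beta>) = 2 * s3\<^sup>2" unfolding s3_def by (rule one_plus_cos)
    \<comment> \<open>The addition formula for the sine ties the three half angles together.
      Cauchy-Schwarz then bounds \<open>(s1 + s3)^2\<close> by
      \<open>(1 / m + 1 / k) * (m * s1^2 + k * s3^2)\<close>.\<close>
    have "s2 \<le> s1 + s3"
    proof -
      have "\<beta> / 2 = \<alpha> / 2 - (\<alpha> - \<beta>) / 2" by (simp add: field_simps)
      hence "sin (\<beta> / 2) = sin (\<alpha> / 2 - (\<alpha> - \<beta>) / 2)" by (rule arg_cong)
      also have "\<dots> = sin (\<alpha> / 2) * cos ((\<alpha> - \<beta>) / 2) - cos (\<alpha> / 2) * sin ((\<alpha> - \<beta>) / 2)" by (rule sin_diff)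
      finally have "s2 \<le> \<bar>sin (\<alpha> / 2) * cos ((\<alpha> - \<beta>) / 2)\<bar> + \<bar>cos (\<alpha> / 2) * sin ((\<alpha> - \<beta>) / 2)\<bar>"
        unfolding s2_def by (simp only: abs_triangle_ineq4)
      hence "s2 \<le> \<bar>sin (\<alpha> / 2)\<bar> * s3 + s1 * \<bar>sin ((\<alpha> - \<beta>) / 2)\<bar>"
        unfolding s1_def s3_def abs_mult .
      also have "\<dots> \<le> 1 * s3 + s1 * 1"
        by (intro add_mono mult_right_mono mult_left_mono) (auto simp: s1_def s3_def)
      finally show ?thesis by simp
    qed
    hence "s2\<^sup>2 \<le> (s1 + s3)\<^sup>2" by (intro power_mono) (auto simp: s2_def)
    hence "\<nu> * s2\<^sup>2 * (m + k) \<le> \<nu> * (m + k) * (s1 + s3)\<^sup>2" using p by simp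
    also have "\<dots> \<le> m * k * (s1 + s3)\<^sup>2" using nk by (intro mult_right_mono) auto
    also have "\<dots> \<le> (m * s1\<^sup>2 + k * s3\<^sup>2) * (m + k)"
    proof -
      have "0 \<le> (m * s1 - k * s3)\<^sup>2" by simp
      thus ?thesis by (simp add: algebra_simps power2_eq_square)
    qed
    finally have "\<nu> * s2\<^sup>2 \<le> m * s1\<^sup>2 + k * s3\<^sup>2" using p by simp
    hence "line_cost x y z \<le> (1 / (x + y) + curv x y * (1 + cos \<alpha>)) + (1 / (z - x) - \<nu> * (1 - cos \<beta>))
       + (1 / (y + z) + curv y z * (1 + cos (\<alpha> - \<beta>)))"
      unfolding line_cost_def c1 c2 c3 m_def k_def by (simp add: algebra_simps)
    thus "ennreal (line_cost x y z) \<le> coulomb_C x y z \<alpha> \<beta>"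
      unfolding coulomb_C_def \<nu>_def using x o
      by (intro ennreal_sum3_le[OF recip_dist_cos_ge recip_dist_cos_ge' recip_dist_cos_ge]) auto
  qed
  have "radial_cost (x, y, z) \<le> coulomb_C x y z pi 0"
    using INF_lower[of "(pi, 0 :: real)" UNIV "\<lambda>ab. coulomb_C x y z (fst ab) (snd ab)"]
    by (simp add: radial_cost_def)
  also have "\<dots> = ennreal (1 / (x + y)) + ennreal (1 / (z - x)) + ennreal (1 / (y + z))"
  proof -
    have "x\<^sup>2 + y\<^sup>2 - 2 * x * y * cos pi = (x + y)\<^sup>2" "x\<^sup>2 + z\<^sup>2 - 2 * x * z * cos 0 = (z - x)\<^sup>2"
      "y\<^sup>2 + z\<^sup>2 - 2 * y * z * cos (pi - 0) = (y + z)\<^sup>2"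
      by (simp_all add: algebra_simps power2_eq_square)
    thus ?thesis using x o by (simp add: coulomb_C_def recip_dist_def)
  qed
  also have "\<dots> = ennreal (line_cost x y z)" using x o by (simp add: line_cost_def ennreal_plus)
  finally show "radial_cost (x, y, z) \<le> ennreal (line_cost x y z)" .
qed

section \<open>Symmetry of the radial cost and feasibility on all triples\<close>

lemma radial_cost_swap12: "radial_cost (b, a, c) = radial_cost (a, b, c)"
proof -
  have "radial_cost (a, b, c) \<le> radial_cost (b, a, c)" for a b c
    unfolding radial_cost_def prod.case
  proof (rule INF_greatest)
    fix ab :: "real \<times> real"
    have "coulomb_C a b c (fst ab) (fst ab - snd ab) = coulomb_C b a c (fst ab) (snd ab)"
      unfolding coulomb_C_def by (simp add: ac_simps)
    thus "(INF ab. coulomb_C a b c (fst ab) (snd ab)) \<le> coulomb_C b a c (fst ab) (snd ab)"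
      using INF_lower[of "(fst ab, fst ab - snd ab)" UNIV "\<lambda>ab. coulomb_C a b c (fst ab) (snd ab)"] by simp
  qed
  thus ?thesis by (intro antisym)
qed

lemma radial_cost_swap23: "radial_cost (a, c, b) = radial_cost (a, b, c)"
proof -
  have "radial_cost (a, b, c) \<le> radial_cost (a, c, b)" for a b c
    unfolding radial_cost_def prod.case
  proof (rule INF_greatest)
    fix ab :: "real \<times> real"
    have "cos (snd ab - fst ab) = cos (fst ab - snd ab)" by (metis cos_minus minus_diff_eq)
    hence "coulomb_C a b c (snd ab) (fst ab) = coulomb_C a c b (fst ab) (snd ab)"
      unfolding coulomb_C_def by (simp add: ac_simps)
    thus "(INF ab. coulomb_C a b c (fst ab) (snd ab)) \<le> coulomb_C a c b (fst ab) (snd ab)"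
      using INF_lower[of "(snd ab, fst ab)" UNIV "\<lambda>ab. coulomb_C a b c (fst ab) (snd ab)"] by simp
  qed
  thus ?thesis by (intro antisym)
qed

text \<open>The conclusion holds for every \<open>\<phi>\<close> with the prescribed values on the
  three sets, so that a measurable function on the whole line can be inserted later, whatever it
  does elsewhere.\<close>

lemma dual_feasible:
  fixes A B C :: "real set" and fA fB fC :: "real \<Rightarrow> real"
  assumes ne: "A \<noteq> {}" "B \<noteq> {}" "C \<noteq> {}"
    and pos: "\<And>x. x \<in> A \<union> B \<union> C \<Longrightarrow> 0 < x"
    and Q: "\<And>x y z. x \<in> A \<Longrightarrow> y \<in> B \<Longrightarrow> z \<in> C \<Longrightarrow> aligned x y z"
    and f: "\<And>x y z. x \<in> A \<Longrightarrow> y \<in> B \<Longrightarrow> z \<in> C \<Longrightarrow> fA x + fB y + fC z \<le> line_cost x y z"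
  obtains kA kB kC :: real where "kA + kB + kC = 0"
    "\<forall>\<phi>. (\<forall>x\<in>A. \<phi> x = fA x + kA) \<longrightarrow> (\<forall>x\<in>B. \<phi> x = fB x + kB) \<longrightarrow> (\<forall>x\<in>C. \<phi> x = fC x + kC) \<longrightarrow>
       (\<forall>x\<in>A \<union> B \<union> C. \<forall>y\<in>A \<union> B \<union> C. \<forall>z\<in>A \<union> B \<union> C. ennreal (\<phi> x + \<phi> y + \<phi> z) \<le> radial_cost (x, y, z))"
proof -
  show ?thesis
  proof (rule dual_constants[OF ne pos Q f])
    fix kA kB kC :: real
    assume k0: "kA + kB + kC = 0" and k: "\<And>x y z. x \<in> A \<Longrightarrow> y \<in> A \<Longrightarrow> z \<in> A \<Longrightarrow> x \<le> y \<Longrightarrow> y \<le> z \<Longrightarrow>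
       fA x + fA y + fA z + 3 * kA \<le> anti_cost x y z + 3/2 * min (curv x z) (1 / (8 * z))"
    "\<And>x y z. x \<in> A \<Longrightarrow> y \<in> A \<Longrightarrow> z \<in> B \<Longrightarrow> x \<le> y \<Longrightarrow> fA x + fA y + fB z + (2 * kA + kB) \<le> anti_cost x y z"
    "\<And>x y z. x \<in> A \<Longrightarrow> y \<in> A \<Longrightarrow> z \<in> C \<Longrightarrow> x \<le> y \<Longrightarrow> fA x + fA y + fC z + (2 * kA + kC) \<le> anti_cost x y z"
    "\<And>x y z. x \<in> A \<Longrightarrow> y \<in> B \<Longrightarrow> z \<in> B \<Longrightarrow> y \<le> z \<Longrightarrow> fA x + fB y + fB z + (kA + 2 * kB) \<le> bent_cost x y z"
    "\<And>x y z. x \<in> A \<Longrightarrow> y \<in> C \<Longrightarrow> z \<in> C \<Longrightarrow> y \<le> z \<Longrightarrow> fA x + fC y + fC z + (kA + 2 * kC) \<le> bent_cost x y z"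
    "\<And>x y z. x \<in> B \<Longrightarrow> y \<in> B \<Longrightarrow> z \<in> B \<Longrightarrow> x \<le> y \<Longrightarrow> y \<le> z \<Longrightarrow>
       fB x + fB y + fB z + 3 * kB \<le> anti_cost x y z + 3/2 * min (curv x z) (1 / (8 * z))"
    "\<And>x y z. x \<in> B \<Longrightarrow> y \<in> B \<Longrightarrow> z \<in> C \<Longrightarrow> x \<le> y \<Longrightarrow> fB x + fB y + fC z + (2 * kB + kC) \<le> anti_cost x y z"
    "\<And>x y z. x \<in> B \<Longrightarrow> y \<in> C \<Longrightarrow> z \<in> C \<Longrightarrow> y \<le> z \<Longrightarrow> fB x + fC y + fC z + (kB + 2 * kC) \<le> anti_cost x y z"
    "\<And>x y z. x \<in> C \<Longrightarrow> y \<in> C \<Longrightarrow> z \<in> C \<Longrightarrow> x \<le> y \<Longrightarrow> y \<le> z \<Longrightarrow> fC x + fC y + fC z + 3 * kC \<le> 0"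
    show thesis
    proof (rule that[OF k0], intro allI impI ballI)
      fix \<phi> :: "real \<Rightarrow> real" and x y z
      assume \<phi>': "\<forall>x\<in>A. \<phi> x = fA x + kA" "\<forall>x\<in>B. \<phi> x = fB x + kB" "\<forall>x\<in>C. \<phi> x = fC x + kC"
        and xyz: "x \<in> A \<union> B \<union> C" "y \<in> A \<union> B \<union> C" "z \<in> A \<union> B \<union> C"
      note \<phi> = \<phi>'[THEN bspec]
      define R where "R u v w \<longleftrightarrow> ennreal (\<phi> u + \<phi> v + \<phi> w) \<le> radial_cost (u, v, w)" for u v w
      have s12: "R v u w \<longleftrightarrow> R u v w" and s23: "R u w v \<longleftrightarrow> R u v w" for u v w
        unfolding R_def radial_cost_swap12[of v u w] radial_cost_swap23[of u w v] by (simp_all add: add_ac)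
      obtain a0 b0 c0 where abc: "a0 \<in> A" "b0 \<in> B" "c0 \<in> C" using ne by blast
      have pA: "0 < x" if "x \<in> A" for x using pos that by auto
      have pB: "0 < x" if "x \<in> B" for x using pos that by auto
      have pC: "0 < x" if "x \<in> C" for x using pos that by auto
      note pr = aligned_props[OF pA pB pC Q]
      have AB: "u < v" if "u \<in> A" "v \<in> B" for u v using pr(1)[of u v c0] that abc by auto
      have BC: "u < v" if "u \<in> B" "v \<in> C" for u v using pr(2)[of a0 u v] that abc by auto
      have AC: "u < v" if "u \<in> A" "v \<in> C" for u v using AB[OF that(1) abc(2)] BC[OF abc(2) that(2)] by simp
      \<comment> \<open>Points of \<open>A\<close> lie below those of \<open>B\<close>, and these
        below those of \<open>C\<close>, so a sorted triple has one of ten types; the symmetry of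
        \<open>R\<close> covers the other orders.\<close>
      have sorted: "R u v w" if o: "u \<le> v" "v \<le> w" and m: "u \<in> A \<union> B \<union> C" "v \<in> A \<union> B \<union> C" "w \<in> A \<union> B \<union> C" for u v w
      proof -
        have p: "0 < u" "0 < v" "0 < w" using pos m by auto
        have le: "R u v w" if "\<phi> u + \<phi> v + \<phi> w \<le> r" "ennreal r \<le> radial_cost (u, v, w)" for r
          unfolding R_def using ennreal_leI[OF that(1)] that(2) by (rule order_trans)
        note g1 = radial_cost_ge_anti_cost[OF p] and g2 = radial_cost_ge_bent_cost[OF p(1) o] and g3 = radial_cost_ge_tri[OF p(1) o]
        have n: "\<not> (u \<in> B \<and> v \<in> A)" "\<not> (u \<in> C \<and> v \<in> A)" "\<not> (u \<in> C \<and> v \<in> B)"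
             "\<not> (v \<in> B \<and> w \<in> A)" "\<not> (v \<in> C \<and> w \<in> A)" "\<not> (v \<in> C \<and> w \<in> B)"
          using AB[of v u] AC[of v u] BC[of v u] AB[of w v] AC[of w v] BC[of w v] o by auto
        consider "u \<in> A" "v \<in> A" "w \<in> A" | "u \<in> A" "v \<in> A" "w \<in> B" | "u \<in> A" "v \<in> A" "w \<in> C"
          | "u \<in> A" "v \<in> B" "w \<in> B" | "u \<in> A" "v \<in> B" "w \<in> C" | "u \<in> A" "v \<in> C" "w \<in> C"
          | "u \<in> B" "v \<in> B" "w \<in> B" | "u \<in> B" "v \<in> B" "w \<in> C" | "u \<in> B" "v \<in> C" "w \<in> C"
          | "u \<in> C" "v \<in> C" "w \<in> C" using m n by (elim UnE) simp_all
        thus ?thesis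
        proof cases
          case 1 show ?thesis
            by (rule le[OF _ g3]) (use k(1)[OF 1 o] \<phi>(1)[OF 1(1)] \<phi>(1)[OF 1(2)] \<phi>(1)[OF 1(3)] in linarith)
        next
          case 2 show ?thesis
            by (rule le[OF _ g1]) (use k(2)[OF 2 o(1)] \<phi>(1)[OF 2(1)] \<phi>(1)[OF 2(2)] \<phi>(2)[OF 2(3)] in linarith)
        next
          case 3 show ?thesis
            by (rule le[OF _ g1]) (use k(3)[OF 3 o(1)] \<phi>(1)[OF 3(1)] \<phi>(1)[OF 3(2)] \<phi>(3)[OF 3(3)] in linarith)
        next
          case 4 show ?thesis
            by (rule le[OF _ g2]) (use k(4)[OF 4 o(2)] \<phi>(1)[OF 4(1)] \<phi>(2)[OF 4(2)] \<phi>(2)[OF 4(3)] in linarith)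
        next
          case 5
          have "ennreal (line_cost u v w) \<le> radial_cost (u, v, w)" using radial_cost_eq_line_cost[OF p Q[OF 5]] by simp
          moreover have "\<phi> u + \<phi> v + \<phi> w \<le> line_cost u v w" using f[OF 5] \<phi>(1)[OF 5(1)] \<phi>(2)[OF 5(2)] \<phi>(3)[OF 5(3)] k0 by linarith
          ultimately show ?thesis using le by blast
        next
          case 6 show ?thesis
            by (rule le[OF _ g2]) (use k(5)[OF 6 o(2)] \<phi>(1)[OF 6(1)] \<phi>(3)[OF 6(2)] \<phi>(3)[OF 6(3)] in linarith)
        next
          case 7 show ?thesis
            by (rule le[OF _ g3]) (use k(6)[OF 7 o] \<phi>(2)[OF 7(1)] \<phi>(2)[OF 7(2)] \<phi>(2)[OF 7(3)] in linarith)
        next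
          case 8 show ?thesis
            by (rule le[OF _ g1]) (use k(7)[OF 8 o(1)] \<phi>(2)[OF 8(1)] \<phi>(2)[OF 8(2)] \<phi>(3)[OF 8(3)] in linarith)
        next
          case 9 show ?thesis
            by (rule le[OF _ g1]) (use k(8)[OF 9 o(2)] \<phi>(2)[OF 9(1)] \<phi>(3)[OF 9(2)] \<phi>(3)[OF 9(3)] in linarith)
        next
          case 10 show ?thesis
            using k(9)[OF 10 o] \<phi>(3)[OF 10(1)] \<phi>(3)[OF 10(2)] \<phi>(3)[OF 10(3)] by (intro le[of 0]) (linarith, simp)
        qed
      qed
      have p1: "R x z y = R x y z" by (rule s23)
      have p2: "R y x z = R x y z" by (rule s12)
      have p3: "R y z x = R x y z" using s23 p2 by (rule trans)
      have p4: "R z x y = R x y z" using s12 p1 by (rule trans)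
      have p5: "R z y x = R x y z" using s23 p4 by (rule trans)
      consider "x \<le> y" "y \<le> z" | "x \<le> z" "z \<le> y" | "y \<le> x" "x \<le> z" | "y \<le> z" "z \<le> x"
        | "z \<le> x" "x \<le> y" | "z \<le> y" "y \<le> x" by linarith
      hence "R x y z"
      proof cases
        case 1 from sorted[OF 1 xyz(1,2,3)] show ?thesis .
      next
        case 2 from sorted[OF 2 xyz(1,3,2)] show ?thesis unfolding p1 .
      next
        case 3 from sorted[OF 3 xyz(2,1,3)] show ?thesis unfolding p2 .
      next
        case 4 from sorted[OF 4 xyz(2,3,1)] show ?thesis unfolding p3 .
      next
        case 5 from sorted[OF 5 xyz(3,1,2)] show ?thesis unfolding p4 .
      next
        case 6 from sorted[OF 6 xyz(3,2,1)] show ?thesis unfolding p5 .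
      qed
      thus "ennreal (\<phi> x + \<phi> y + \<phi> z) \<le> radial_cost (x, y, z)" by (simp add: R_def)
    qed
  qed
qed

section \<open>Potentials for two-marginal problems on the line\<close>

text \<open>\<open>u\<close> is a primitive of \<open>D s (S s)\<close>, the derivative of the cost
  along the coupling. The hypothesis \<open>anti\<close> says that \<open>S\<close> is monotone in
  the direction favoured by the cost, and comparing integrands then yields the inequality. The
  second potential lives at the point \<open>S t\<close> and is written through its parameter
  \<open>t\<close>.\<close>

lemma pair_potential:
  fixes I :: "real set" and D k :: "real \<Rightarrow> real \<Rightarrow> real" and S :: "real \<Rightarrow> real" and K M :: real
  assumes conv: "\<And>a b s. a \<in> I \<Longrightarrow> b \<in> I \<Longrightarrow> a \<le> s \<Longrightarrow> s \<le> b \<Longrightarrow> s \<in> I"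
    and I: "I \<subseteq> {0..K}" "I \<in> sets borel"
    and der: "\<And>s t. s \<in> I \<Longrightarrow> t \<in> I \<Longrightarrow> ((\<lambda>s. k s (S t)) has_real_derivative D s (S t)) (at s)"
    and anti: "\<And>s r t. s \<in> I \<Longrightarrow> r \<in> I \<Longrightarrow> t \<in> I \<Longrightarrow> r \<le> t \<Longrightarrow> D s (S t) \<le> D s (S r)"
    and meas: "(\<lambda>s. D s (S s)) \<in> borel_measurable borel"
    and bd: "\<And>s. s \<in> I \<Longrightarrow> \<bar>D s (S s)\<bar> \<le> M"
  obtains u :: "real \<Rightarrow> real" and B :: real where "u \<in> borel_measurable borel" "\<And>x. \<bar>u x\<bar> \<le> B"
    "\<And>x t. x \<in> I \<Longrightarrow> t \<in> I \<Longrightarrow> u x + (k t (S t) - u t) \<le> k x (S t)"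
proof (cases "I = {}")
  case True
  thus ?thesis by (intro that[of "\<lambda>_. 0" 0]) auto
next
  case False
  then obtain i0 where i0: "i0 \<in> I" by blast
  have K: "0 \<le> K" using i0 I by force
  have M: "0 \<le> M" using bd[OF i0] by linarith
  define g where "g s = indicator I s * D s (S s)" for s
  have gI: "g s = D s (S s)" if "s \<in> I" for s using that by (simp add: g_def)
  have g_meas: "g \<in> borel_measurable borel" unfolding g_def using meas I by measurable
  have g_bd: "\<bar>g s\<bar> \<le> M" for s using bd M by (auto simp: g_def indicator_def)
  have g_int: "g integrable_on {a..b}" for a b
  proof -
    have "g absolutely_integrable_on {a..b}"
    proof (rule measurable_bounded_by_integrable_imp_absolutely_integrable)
      show "g \<in> borel_measurable (lebesgue_on {a..b})"
        using g_meas by (intro measurable_restrict_space1 measurable_completion) simp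
    qed (use g_bd in auto)
    thus ?thesis by (rule set_lebesgue_integral_eq_integral(1))
  qed
  define U where "U x = integral {0..x} g" for x
  \<comment> \<open>Clamping the argument extends \<open>U\<close> continuously and boundedly to the
    whole line, so \<open>u\<close> is measurable.\<close>
  define u where "u x = U (max 0 (min K x))" for x
  have uU: "u x = U x" if "x \<in> I" for x using that I by (auto simp: u_def)
  have U_cont: "continuous_on {0..K} U" unfolding U_def by (rule indefinite_integral_continuous_1[OF g_int])
  have u_cont: "continuous_on UNIV u"
    unfolding u_def by (rule continuous_on_compose2[OF U_cont]) (use K in \<open>auto intro!: continuous_intros\<close>)
  have u_bd: "\<bar>u x\<bar> \<le> M * K" for x
  proof -
    define y where "y = max 0 (min K x)"
    have y: "0 \<le> y" "y \<le> K" using K by (auto simp: y_def)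
    have "\<bar>integral {0..y} g\<bar> \<le> M * (y - 0)"
      using has_integral_bound[of M g "integral {0..y} g" 0 y] g_bd M y integrable_integral[OF g_int[of 0 y]] by simp
    also have "\<dots> \<le> M * K" using y M by (intro mult_left_mono) auto
    finally show ?thesis by (simp add: u_def U_def y_def)
  qed
  have U_diff: "U b - U a = integral {a..b} g" if "a \<in> I" "b \<in> I" "a \<le> b" for a b
  proof -
    have "0 \<le> a" using that I by force
    thus ?thesis unfolding U_def
      using Henstock_Kurzweil_Integration.integral_combine[of 0 a b g] that g_int by simp
  qed
  have k_int: "((\<lambda>s. D s (S t)) has_integral (k b (S t) - k a (S t))) {a..b}"
    if "a \<in> I" "b \<in> I" "a \<le> b" "t \<in> I" for a b t
    by (rule fundamental_theorem_of_calculus)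
       (use that conv[of a b] der[of _ t] in
        \<open>auto simp: has_real_derivative_iff_has_vector_derivative[symmetric] intro: has_field_derivative_at_within\<close>)
  show ?thesis
  proof (rule that)
    show "u \<in> borel_measurable borel" using u_cont by (rule borel_measurable_continuous_onI)
    show "\<bar>u x\<bar> \<le> M * K" for x by (rule u_bd)
    fix x t assume x: "x \<in> I" and t: "t \<in> I"
    \<comment> \<open>Both sides are integrals from \<open>t\<close> to \<open>x\<close>, one with
      the partner \<open>S s\<close> moving along, the other with the partner frozen at
      \<open>S t\<close>.\<close>
    have "U x - U t \<le> k x (S t) - k t (S t)"
    proof (cases "t \<le> x")
      case True
      have "U x - U t = integral {t..x} g" using U_diff x t True by simp
      also have "\<dots> \<le> integral {t..x} (\<lambda>s. D s (S t))"
      proof (rule integral_le)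
        fix s assume s: "s \<in> {t..x}"
        hence "s \<in> I" using conv[of t x s] x t by auto
        thus "g s \<le> D s (S t)" using gI anti[of s t s] t s by auto
      qed (use g_int k_int[of t x t] x t True in auto)
      also have "\<dots> = k x (S t) - k t (S t)" using k_int[of t x t] x t True by (simp add: integral_unique)
      finally show ?thesis .
    next
      case False
      have "k t (S t) - k x (S t) = integral {x..t} (\<lambda>s. D s (S t))"
        using k_int[of x t t] x t False by (simp add: integral_unique)
      also have "\<dots> \<le> integral {x..t} g"
      proof (rule integral_le)
        fix s assume s: "s \<in> {x..t}"
        hence "s \<in> I" using conv[of x t s] x t by auto
        thus "D s (S t) \<le> g s" using gI anti[of s s t] t s by auto
      qed (use g_int k_int[of x t t] x t False in auto)
      also have "\<dots> = U t - U x" using U_diff x t False by simp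
      finally show ?thesis by simp
    qed
    thus "u x + (k t (S t) - u t) \<le> k x (S t)" using uU x t by simp
  qed
qed

lemma recip_add_derivative:
  "s + c \<noteq> 0 \<Longrightarrow> ((\<lambda>s. 1 / (s + c)) has_real_derivative - (1 / (s + c)\<^sup>2)) (at s)" for s c :: real
  by (auto intro!: derivative_eq_intros simp: power2_eq_square)

lemma recip_diff_derivative:
  "c - s \<noteq> 0 \<Longrightarrow> ((\<lambda>s. 1 / (c - s)) has_real_derivative 1 / (c - s)\<^sup>2) (at s)" for s c :: real
  by (auto intro!: derivative_eq_intros simp: power2_eq_square)

lemma recip_sq_mono: "0 < a \<Longrightarrow> a \<le> b \<Longrightarrow> 1 / b\<^sup>2 \<le> 1 / a\<^sup>2" for a b :: real
  by (intro divide_left_mono power_mono mult_pos_pos) auto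

lemma measurable_triple_proj [measurable]:
  "(\<lambda>r :: real \<times> real \<times> real. fst r) \<in> borel_measurable borel"
  "(\<lambda>r :: real \<times> real \<times> real. fst (snd r)) \<in> borel_measurable borel"
  "(\<lambda>r :: real \<times> real \<times> real. snd (snd r)) \<in> borel_measurable borel"
  by (intro borel_measurable_continuous_onI continuous_intros)+

section \<open>The DDI map\<close>

locale ddi =
  fixes \<rho> :: "real measure" and s1 s2 :: real
  assumes sets_rho: "sets \<rho> = sets borel"
    and prob: "prob_space \<rho>"
    and supp: "emeasure \<rho> {..<0} = 0"
    and ac: "absolutely_continuous lborel \<rho>"
    and s12: "s1 < s2"
    and m1: "measure \<rho> {0..<s1} = 1/3"
    and m2: "measure \<rho> {s1..<s2} = 1/3"
begin

sublocale real_distribution \<rho>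
  using prob sets_rho sets_eq_imp_space_eq[OF sets_rho]
  by (auto simp: real_distribution_def real_distribution_axioms_def)

abbreviation "F \<equiv> cdfF \<rho>"
abbreviation "G \<equiv> cdfFinv \<rho>"
abbreviation "T \<equiv> DDI \<rho> s1 s2"

lemma measurable_rho [simp]: "measurable \<rho> N = measurable borel N"
  by (rule measurable_cong_sets[OF sets_rho refl])

section \<open>The distribution function and its generalized inverse\<close>

lemma atom_free: "measure \<rho> {x} = 0"
proof -
  have "{x} \<in> null_sets lborel" by (simp add: null_sets_def)
  hence "{x} \<in> null_sets \<rho>" using ac unfolding absolutely_continuous_def by blast
  thus ?thesis by (simp add: measure_eq_0_null_sets)
qed

text \<open>Without atoms and without mass below \<open>0\<close>, the half-open
  \<open>[0, x)\<close> and the closed half-line up to \<open>x\<close> have the same measure;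
  continuity and monotonicity are then inherited from \<open>cdf\<close>.\<close>

lemma F_eq_cdf: "F x = cdf \<rho> x"
proof -
  have n: "{..<0} \<in> null_sets \<rho>" using supp by (simp add: null_sets_def)
  have m: "measure \<rho> {x} = 0" by (rule atom_free)
  have "AE y in \<rho>. 0 \<le> y" by (rule AE_I'[OF n]) auto
  moreover have "AE y in \<rho>. y \<noteq> x"
    using m by (intro AE_I'[of "{x}"]) (auto simp: null_sets_def emeasure_eq_measure)
  ultimately have "AE y in \<rho>. y \<in> {0..<x} \<longleftrightarrow> y \<in> {..x}" by eventually_elim auto
  hence "measure \<rho> {0..<x} = measure \<rho> {..x}" by (intro finite_measure_eq_AE) auto
  thus ?thesis by (simp add: cdfF_def cdf_def)
qed

lemma F_mono: "x \<le> y \<Longrightarrow> F x \<le> F y" by (simp add: F_eq_cdf cdf_nondecreasing)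
lemma F_less: "F x < F y \<Longrightarrow> x < y" using F_mono[of y x] by linarith
lemma F_cont: "isCont F x" using atom_free[of x] isCont_cdf[of x] by (simp add: F_eq_cdf[abs_def])
lemma F_bounds: "0 \<le> F x" "F x \<le> 1" by (simp_all add: cdfF_def)
lemma F_nonpos: "x \<le> 0 \<Longrightarrow> F x = 0" by (simp add: cdfF_def)
lemma F_pos: "0 < F x \<Longrightarrow> 0 < x" using F_nonpos[of x] by force
lemma F_measurable [measurable]: "F \<in> borel_measurable borel"
  by (intro borel_measurable_mono monoI F_mono)

lemma F_s1: "F s1 = 1/3" by (simp add: cdfF_def m1)

lemma s1_pos: "0 < s1" using F_pos[of s1] F_s1 by simp

lemma F_s2: "F s2 = 2/3"
proof -
  have "measure \<rho> {0..<s2} = measure \<rho> ({0..<s1} \<union> {s1..<s2})"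
    using s1_pos s12 by (intro arg_cong[where f = "measure \<rho>"]) auto
  also have "\<dots> = 1/3 + 1/3" using m1 m2 by (subst finite_measure_Union) auto
  finally show ?thesis by (simp add: cdfF_def)
qed

lemma F_attains:
  assumes "0 < t" "t < 1" obtains x where "0 \<le> x" "F x = t"
proof -
  have "(F \<longlongrightarrow> 1) at_top" using cdf_lim_at_top_prob by (simp add: F_eq_cdf[abs_def])
  hence "eventually (\<lambda>x. t < F x) at_top" using assms by (intro order_tendstoD) auto
  then obtain b where b: "t < F b" "0 \<le> b"
    using eventually_conj[OF _ eventually_ge_at_top[of 0]] eventually_happens'[OF trivial_limit_at_top_linorder] by blast
  have "\<exists>x. 0 \<le> x \<and> x \<le> b \<and> F x = t"
    using b assms F_cont F_nonpos[of 0] by (intro IVT) auto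
  thus ?thesis using that by blast
qed

text \<open>Continuity of \<open>F\<close> makes the set in \<open>cdfFinv\<close> closed, so its
  infimum is attained. The end values are excluded: for \<open>t = 1\<close> the set may be empty,
  and for \<open>t = 0\<close> the equivalence fails at negative \<open>c\<close>.\<close>

lemma
  assumes "0 < t" "t < 1" shows G_le_iff: "G t \<le> c \<longleftrightarrow> t \<le> F c" and F_G: "F (G t) = t"
proof -
  define S where "S = {x. 0 \<le> x \<and> t \<le> F x}"
  obtain x where x: "0 \<le> x" "F x = t" using F_attains[OF assms] .
  have S: "S \<noteq> {}" "bdd_below S" using x by (auto simp: S_def intro!: bdd_belowI[of _ 0])
  have "closed S"
  proof -
    have "continuous_on UNIV F" using F_cont by (simp add: continuous_on_eq_continuous_at)
    hence "closed {x. t \<le> F x}" by (intro closed_Collect_le continuous_intros) auto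
    moreover have "S = {0..} \<inter> {x. t \<le> F x}" by (auto simp: S_def)
    ultimately show ?thesis by auto
  qed
  hence "Inf S \<in> S" using S by (intro closed_contains_Inf) auto
  hence 1: "t \<le> F (G t)" by (simp add: S_def cdfFinv_def)
  have le: "G t \<le> c" if "t \<le> F c" for c
    unfolding cdfFinv_def using that assms F_pos[of c] by (intro cInf_lower bdd_belowI[of _ 0]) auto
  have "F (G t) \<le> t" using F_mono[OF le[of x]] x by simp
  thus "F (G t) = t" using 1 by simp
  show "G t \<le> c \<longleftrightarrow> t \<le> F c" using le[of c] F_mono[of "G t" c] 1 by auto
qed

lemma G_mono: "0 < t \<Longrightarrow> t \<le> t' \<Longrightarrow> t' < 1 \<Longrightarrow> G t \<le> G t'"
  using G_le_iff[of t "G t'"] F_G[of t'] by simp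

lemma G_measurable [measurable]: "G \<in> borel_measurable borel"
proof (rule borel_measurableI_le)
  fix c :: real
  have neg: "G t = 0" if "t \<le> 0" for t
  proof -
    have "{x. 0 \<le> x \<and> t \<le> F x} = {0..}" using that F_bounds(1) by (auto intro: order_trans)
    thus ?thesis by (simp add: cdfFinv_def)
  qed
  have big: "G t = Inf {}" if "1 < t" for t
  proof -
    have "{x. 0 \<le> x \<and> t \<le> F x} = {}" using that F_bounds(2) by (auto simp: not_le intro: le_less_trans)
    thus ?thesis unfolding cdfFinv_def by (rule arg_cong)
  qed
  \<comment> \<open>Whether \<open>1\<close> is attained by \<open>F\<close> depends on
    \<open>\<rho>\<close>, so the single point \<open>t = 1\<close> enters only through a fixed
    truth value; for \<open>t > 1\<close> the inverse is the constant \<open>Inf {}\<close>.\<close>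
  define b where "b \<longleftrightarrow> G 1 \<le> c"
  have iff: "G t \<le> c \<longleftrightarrow> (t \<le> 0 \<and> 0 \<le> c) \<or> (0 < t \<and> t < 1 \<and> t \<le> F c) \<or> (t = 1 \<and> b) \<or> (1 < t \<and> Inf {} \<le> c)" for t
  proof -
    consider "t \<le> 0" | "0 < t" "t < 1" | "t = 1" | "1 < t" by linarith
    thus ?thesis
    proof cases
      case 1 thus ?thesis unfolding neg[OF 1] by auto
    next
      case 2 thus ?thesis unfolding G_le_iff[OF 2] by auto
    next
      case 3 thus ?thesis by (auto simp: b_def)
    next
      case 4 thus ?thesis unfolding big[OF 4] by auto
    qed
  qed
  show "{t \<in> space borel. G t \<le> c} \<in> sets borel" unfolding iff by measurable
qed

lemma T_measurable [measurable]: "T \<in> borel_measurable borel"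
  unfolding DDI_def[abs_def] by measurable

lemma F_sets [simp]: "{x. F x < t} \<in> sets borel" "{x. F x = t} \<in> sets borel"
    "{x. a \<le> F x \<and> F x < b} \<in> sets borel"
  by measurable

text \<open>\<open>F\<close> transports \<open>\<rho>\<close> to the uniform distribution on
  \<open>[0, 1]\<close>. The value \<open>1\<close> need not be attained by \<open>F\<close>, so
  \<open>t = 1\<close> is reached by approximation from below.\<close>

lemma measure_F_less:
  assumes "0 \<le> t" "t \<le> 1" shows "measure \<rho> {x. F x < t} = t"
proof -
  have main: "measure \<rho> {x. F x < t} = t" if "0 < t" "t < 1" for t
  proof -
    have "F x < t \<longleftrightarrow> x < G t" for x using G_le_iff[OF that, of x] by linarith
    hence "{x. F x < t} = {..<G t}" by auto
    also have "measure \<rho> {..<G t} = measure \<rho> {..G t}"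
    proof -
      have "AE y in \<rho>. y \<noteq> G t"
        using atom_free by (intro AE_I'[of "{G t}"]) (auto simp: null_sets_def emeasure_eq_measure)
      thus ?thesis by (intro finite_measure_eq_AE) auto
    qed
    also have "\<dots> = t" using F_G[OF that] by (simp add: F_eq_cdf cdf_def)
    finally show ?thesis .
  qed
  consider "t = 0" | "0 < t" "t < 1" | "t = 1" using assms by linarith
  thus ?thesis
  proof cases
    case 1
    hence "{x. F x < t} = {}" using F_bounds(1) by (auto simp: not_less)
    thus ?thesis using 1 by simp
  next
    case 2 thus ?thesis by (rule main)
  next
    case 3
    have "1 \<le> measure \<rho> {x. F x < t}"
    proof (rule field_le_epsilon)
      fix e :: real assume e: "0 < e"
      define s where "s = max (1/2) (1 - e)"
      have s: "0 < s" "s < 1" "1 - e \<le> s" using e by (auto simp: s_def)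
      have "s = measure \<rho> {x. F x < s}" using main[of s] s by simp
      also have "\<dots> \<le> measure \<rho> {x. F x < t}" by (rule finite_measure_mono) (use 3 s in auto)
      finally show "1 \<le> measure \<rho> {x. F x < t} + e" using s by linarith
    qed
    moreover have "measure \<rho> {x. F x < t} \<le> 1" by (rule prob_le_1)
    ultimately show ?thesis using 3 by linarith
  qed
qed

lemma measure_F_between:
  assumes "0 \<le> a" "a \<le> b" "b \<le> 1" shows "measure \<rho> {x. a \<le> F x \<and> F x < b} = b - a"
proof -
  have "{x. F x < b} = {x. F x < a} \<union> {x. a \<le> F x \<and> F x < b}" using assms by auto
  hence "measure \<rho> {x. F x < b} = measure \<rho> {x. F x < a} + measure \<rho> {x. a \<le> F x \<and> F x < b}"
    using finite_measure_Union[of "{x. F x < a}" "{x. a \<le> F x \<and> F x < b}"] by (simp add: disjoint_iff)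
  thus ?thesis using measure_F_less[of a] measure_F_less[of b] assms by simp
qed

lemma AE_F_neq: "AE x in \<rho>. F x \<noteq> t"
proof (cases "0 \<le> t \<and> t \<le> 1")
  case False
  thus ?thesis using F_bounds by (intro AE_I2) auto
next
  case True
  have "measure \<rho> {x. F x = t} \<le> 0"
  proof (rule field_le_epsilon)
    fix e :: real assume e: "0 < e"
    show "measure \<rho> {x. F x = t} \<le> 0 + e"
    proof (cases "t < 1")
      case t: True
      define b where "b = min 1 (t + e)"
      have b: "t < b" "b \<le> 1" "b \<le> t + e" using t e by (auto simp: b_def)
      have "measure \<rho> {x. F x = t} \<le> measure \<rho> {x. t \<le> F x \<and> F x < b}" by (rule finite_measure_mono) (use b in auto)
      also have "\<dots> = b - t" by (rule measure_F_between) (use b True in auto)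
      finally show ?thesis using b by simp
    next
      case False
      hence t: "t = 1" using True by simp
      have "measure \<rho> ({x. F x = t} \<union> {x. F x < 1}) = measure \<rho> {x. F x = t} + measure \<rho> {x. F x < 1}"
        by (rule finite_measure_Union) (use t in auto)
      moreover have "measure \<rho> {x. F x < 1} = 1" by (rule measure_F_less) auto
      moreover have "measure \<rho> ({x. F x = t} \<union> {x. F x < 1}) \<le> 1" by (rule prob_le_1)
      ultimately show ?thesis using e by linarith
    qed
  qed
  hence "measure \<rho> {x. F x = t} = 0" using measure_nonneg[of \<rho> "{x. F x = t}"] by linarith
  thus ?thesis by (intro AE_I'[of "{x. F x = t}"]) (auto simp: null_sets_def emeasure_eq_measure)
qed

text \<open>The DDI map in the coordinate \<open>F\<close>: a piecewise isometry permuting the three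
  thirds of the unit interval.\<close>

definition tau :: "real \<Rightarrow> real" where
  "tau u = (if u < 1/3 then 2/3 - u else if u < 2/3 then 4/3 - u else u - 2/3)"

text \<open>Excludes the end values, where \<open>cdfFinv\<close> is delicate, and the two break
  points of \<open>tau\<close>; all four levels are negligible.\<close>

definition regular :: "real \<Rightarrow> bool" where
  "regular x \<longleftrightarrow> 0 < F x \<and> F x < 1 \<and> F x \<noteq> 1/3 \<and> F x \<noteq> 2/3"

lemma T_eq_G_tau: assumes "regular x" shows "T x = G (tau (F x))"
proof -
  have "x < s1 \<longleftrightarrow> F x < 1/3"
    using F_less[of x s1] F_mono[of x s1] F_s1 assms by (auto simp: regular_def less_le)
  moreover have "x < s2 \<longleftrightarrow> F x < 2/3"
    using F_less[of x s2] F_mono[of x s2] F_s2 assms by (auto simp: regular_def less_le)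
  ultimately show ?thesis by (simp add: DDI_def tau_def)
qed

lemma tau_regular: "regular x \<Longrightarrow> 0 < tau (F x) \<and> tau (F x) < 1"
  by (auto simp: regular_def tau_def)

lemma F_T: "regular x \<Longrightarrow> F (T x) = tau (F x)"
  using T_eq_G_tau tau_regular F_G by simp

lemma regular_T: "regular x \<Longrightarrow> regular (T x)"
  using F_T[of x] tau_regular[of x] by (auto simp: regular_def tau_def split: if_splits)

lemma T_le_iff: "regular x \<Longrightarrow> T x \<le> c \<longleftrightarrow> tau (F x) \<le> F c"
  using T_eq_G_tau tau_regular G_le_iff by simp

lemma AE_regular: "AE x in \<rho>. regular x"
  using AE_F_neq[of 0] AE_F_neq[of 1] AE_F_neq[of "1/3"] AE_F_neq[of "2/3"]
proof eventually_elim
  case (elim x)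
  thus ?case using F_bounds[of x] by (auto simp: regular_def)
qed

text \<open>This is the invariance of the uniform distribution under \<open>tau\<close>. Each
  sublevel set is, up to one negligible level of \<open>F\<close>, one or two half-open bands of
  total length \<open>v\<close>.\<close>

lemma measure_tau_le:
  assumes v: "0 \<le> v" "v \<le> 1"
  shows "measure \<rho> {x. tau (F x) \<le> v} = v"
proof -
  have [measurable]: "tau \<in> borel_measurable borel" unfolding tau_def[abs_def] by measurable
  have S: "{x. tau (F x) \<le> v} \<in> sets borel" by measurable
  have U: "measure \<rho> ({x. a \<le> F x \<and> F x < b} \<union> {x. c \<le> F x \<and> F x < d}) = (b - a) + (d - c)"
    if "0 \<le> a" "a \<le> b" "b \<le> c" "c \<le> d" "d \<le> 1" for a b c d
    using that measure_F_between[of a b] measure_F_between[of c d]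
    by (subst finite_measure_Union) auto
  have eq: "measure \<rho> {x. tau (F x) \<le> v} = measure \<rho> A"
    if "A \<in> sets borel" "AE x in \<rho>. tau (F x) \<le> v \<longleftrightarrow> x \<in> A" for A
    using that S by (intro finite_measure_eq_AE) auto
  consider "v < 1/3" | "1/3 \<le> v" "v < 2/3" | "2/3 \<le> v" by linarith
  thus ?thesis
  proof cases
    case 1
    have "AE x in \<rho>. tau (F x) \<le> v \<longleftrightarrow> x \<in> {x. 2/3 \<le> F x \<and> F x < 2/3 + v}"
      using AE_F_neq[of "2/3 + v"]
    proof eventually_elim
      case (elim x) thus ?case using 1 by (auto simp: tau_def)
    qed
    hence "measure \<rho> {x. tau (F x) \<le> v} = measure \<rho> {x. 2/3 \<le> F x \<and> F x < 2/3 + v}" by (intro eq) simp_all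
    also have "\<dots> = v" using 1 v by (subst measure_F_between) auto
    finally show ?thesis .
  next
    case 2
    have "AE x in \<rho>. tau (F x) \<le> v \<longleftrightarrow> x \<in> {x. 2/3 - v \<le> F x \<and> F x < 1/3} \<union> {x. 2/3 \<le> F x \<and> F x < 1}"
      using AE_F_neq[of 1]
    proof eventually_elim
      case (elim x) thus ?case using 2 F_bounds[of x] by (auto simp: tau_def)
    qed
    hence "measure \<rho> {x. tau (F x) \<le> v} = measure \<rho> ({x. 2/3 - v \<le> F x \<and> F x < 1/3} \<union> {x. 2/3 \<le> F x \<and> F x < 1})"
      by (intro eq sets.Un) simp_all
    also have "\<dots> = v" using 2 v by (subst U) auto
    finally show ?thesis .
  next
    case 3
    have "AE x in \<rho>. tau (F x) \<le> v \<longleftrightarrow> x \<in> {x. 0 \<le> F x \<and> F x < 1/3} \<union> {x. 4/3 - v \<le> F x \<and> F x < 1}"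
      using AE_F_neq[of 1]
    proof eventually_elim
      case (elim x) thus ?case using 3 v F_bounds[of x] by (auto simp: tau_def)
    qed
    hence "measure \<rho> {x. tau (F x) \<le> v} = measure \<rho> ({x. 0 \<le> F x \<and> F x < 1/3} \<union> {x. 4/3 - v \<le> F x \<and> F x < 1})"
      by (intro eq sets.Un) simp_all
    also have "\<dots> = v" using 3 v by (subst U) auto
    finally show ?thesis .
  qed
qed

lemma distr_T: "distr \<rho> borel T = \<rho>"
proof (rule cdf_unique)
  show "real_distribution (distr \<rho> borel T)" by (intro real_distribution_distr) simp
  show "real_distribution \<rho>" by unfold_locales
  show "cdf (distr \<rho> borel T) = cdf \<rho>"
  proof
    fix c
    have [measurable]: "tau \<in> borel_measurable borel" unfolding tau_def[abs_def] by measurable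
    have "cdf (distr \<rho> borel T) c = measure \<rho> {x. T x \<le> c}"
      by (simp add: cdf_def measure_distr vimage_def space_eq_univ)
    also have "\<dots> = measure \<rho> {x. tau (F x) \<le> F c}"
    proof (rule finite_measure_eq_AE)
      show "AE x in \<rho>. (x \<in> {x. T x \<le> c}) = (x \<in> {x. tau (F x) \<le> F c})"
        using AE_regular by eventually_elim (simp add: T_le_iff)
    qed simp_all
    also have "\<dots> = F c" using F_bounds by (intro measure_tau_le) auto
    finally show "cdf (distr \<rho> borel T) c = cdf \<rho> c" by (simp add: F_eq_cdf)
  qed
qed

text \<open>Avoiding the countably many values of \<open>F\<close> at rationals makes \<open>x\<close> a point of strict increase.\<close>

definition good :: "real \<Rightarrow> bool" where
  "good x \<longleftrightarrow> regular x \<and> (\<forall>q\<in>\<rat>. F x \<noteq> F q)"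

lemma AE_good: "AE x in \<rho>. good x"
proof -
  have "AE x in \<rho>. \<forall>q\<in>\<rat>. F x \<noteq> F q"
    by (subst AE_ball_countable) (use countable_rat AE_F_neq in auto)
  thus ?thesis using AE_regular by eventually_elim (simp add: good_def)
qed

lemma good_strict:
  assumes "good x" shows "y < x \<Longrightarrow> F y < F x" and "x < y \<Longrightarrow> F x < F y"
proof -
  show "F y < F x" if yx: "y < x"
  proof -
    obtain q where "q \<in> \<rat>" "y < q" "q < x" using Rats_dense_in_real[OF yx] by blast
    thus ?thesis using assms F_mono[of y q] F_mono[of q x] by (auto simp: good_def less_le)
  qed
  show "F x < F y" if xy: "x < y"
  proof -
    obtain q where "q \<in> \<rat>" "x < q" "q < y" using Rats_dense_in_real[OF xy] by blast
    thus ?thesis using assms F_mono[of x q] F_mono[of q y] by (auto simp: good_def less_le)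
  qed
qed

text \<open>\<open>tau\<close> has order three; returning from \<open>F x\<close> to
  \<open>x\<close> through \<open>G\<close> needs \<open>F\<close> to increase strictly just below
  \<open>x\<close>.\<close>

lemma good_T3: assumes "good x" shows "T (T (T x)) = x"
proof -
  have r: "regular x" using assms by (simp add: good_def)
  have "tau (tau (tau (F x))) = F x" using r by (auto simp: regular_def tau_def)
  hence "T (T (T x)) = G (F x)"
    using r by (simp add: T_eq_G_tau[OF regular_T[OF regular_T]] F_T regular_T)
  also have "\<dots> = x"
  proof (rule antisym)
    have u: "0 < F x" "F x < 1" using r by (auto simp: regular_def)
    show "G (F x) \<le> x" using G_le_iff[OF u] by simp
    show "x \<le> G (F x)" using good_strict(1)[OF assms, of "G (F x)"] F_G[OF u] by (cases "G (F x) < x") auto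
  qed
  finally show ?thesis .
qed

lemma good_open:
  assumes "good x" "open A" "x \<in> A" shows "0 < emeasure \<rho> A"
proof -
  obtain e where e: "0 < e" "ball x e \<subseteq> A" using assms open_contains_ball by blast
  have "F (x - e / 2) < F (x + e / 2)"
    using good_strict(1)[OF assms(1), of "x - e / 2"] good_strict(2)[OF assms(1), of "x + e / 2"] e by auto
  hence "0 < measure \<rho> {x - e / 2<..x + e / 2}"
    using cdf_diff_eq[of "x - e / 2" "x + e / 2"] e by (simp add: F_eq_cdf)
  also have "\<dots> \<le> measure \<rho> A"
  proof (rule finite_measure_mono)
    have "{x - e / 2<..x + e / 2} \<subseteq> ball x e" using e by (auto simp: dist_real_def)
    thus "{x - e / 2<..x + e / 2} \<subseteq> A" using e by simp
  qed (use assms in auto)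
  finally show ?thesis by (simp add: emeasure_eq_measure)
qed

text \<open>Goodness of \<open>x\<close> does not by itself give goodness of \<open>T x\<close>,
  while the potentials are evaluated along the whole orbit. Requiring it on all three points gives a
  \<open>T\<close>-invariant set, still of full measure because \<open>T\<close> preserves
  \<open>\<rho>\<close>.\<close>

definition good_orbits :: "real set" where
  "good_orbits = {x. good x \<and> good (T x) \<and> good (T (T x))}"

lemma AE_good_orbits: "AE x in \<rho>. x \<in> good_orbits"
proof -
  have "AE x in \<rho>. P (T x)" if "AE x in \<rho>. P x" for P
  proof -
    have "AE x in distr \<rho> borel T. P x" using that by (subst distr_T)
    thus ?thesis by (intro AE_distrD[of T \<rho> borel]) simp_all
  qed
  from AE_good this[OF AE_good] this[OF this[OF AE_good]] show ?thesis
    by eventually_elim (simp add: good_orbits_def)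
qed

lemma T_good_orbits: "x \<in> good_orbits \<Longrightarrow> T x \<in> good_orbits"
  using good_T3[of x] by (simp add: good_orbits_def)

lemma good_orbits_T3: "x \<in> good_orbits \<Longrightarrow> T (T (T x)) = x"
  by (simp add: good_orbits_def good_T3)

lemma good_orbits_F_T: "x \<in> good_orbits \<Longrightarrow> F (T x) = tau (F x)"
  by (simp add: good_orbits_def good_def F_T)

lemma good_orbits_regular: "x \<in> good_orbits \<Longrightarrow> regular x"
  by (simp add: good_orbits_def good_def)

text \<open>The cubic is continuous, so if it were negative at a good triple it would be negative on
  a product of open sets. Each factor has positive mass by \<open>good_open\<close>, against the
  almost everywhere hypothesis.\<close>

lemma aligned_of_AE:
  assumes ineq: "AE r in \<rho> \<Otimes>\<^sub>M (\<rho> \<Otimes>\<^sub>M \<rho>).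
       (case r of (r1, r2, r3) \<Rightarrow>
         r1 \<in> {0..s1} \<and> r2 \<in> {s1..s2} \<and> r3 \<in> {s2..} \<longrightarrow>
         r2 * (r3 - r1)^3 - r1 * (r3 + r2)^3 - r3 * (r1 + r2)^3 \<ge> 0)"
    and x: "good x" "F x < 1/3" and y: "good y" "1/3 < F y" "F y < 2/3" and z: "good z" "2/3 < F z"
  shows "aligned x y z"
proof -
  define f :: "real \<times> real \<times> real \<Rightarrow> real" where
    "f r = fst (snd r) * (snd (snd r) - fst r)^3 - fst r * (snd (snd r) + fst (snd r))^3
       - snd (snd r) * (fst r + fst (snd r))^3" for r
  have p: "0 < x" "0 < y" "0 < z" using x y z F_pos by (auto simp: good_def regular_def)
  have o: "x < s1" "s1 < y" "y < s2" "s2 < z" using x y z F_less F_s1 F_s2 by auto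
  have "0 \<le> f (x, y, z)"
  proof (rule ccontr)
    assume neg: "\<not> 0 \<le> f (x, y, z)"
    define W where "W = {r. f r < 0}"
    have "open W" unfolding W_def f_def by (intro open_Collect_less continuous_intros)
    moreover have "(x, y, z) \<in> W" using neg by (simp add: W_def)
    ultimately obtain A1 V where 1: "open A1" "open V" "x \<in> A1" "(y, z) \<in> V" "A1 \<times> V \<subseteq> W"
      by (metis open_prod_elim mem_Sigma_iff)
    obtain A2 A3 where 2: "open A2" "open A3" "y \<in> A2" "z \<in> A3" "A2 \<times> A3 \<subseteq> V"
      using open_prod_elim[OF 1(2,4)] by (metis mem_Sigma_iff)
    define B1 B2 B3 where "B1 = A1 \<inter> {0<..<s1}" and "B2 = A2 \<inter> {s1<..<s2}" and "B3 = A3 \<inter> {s2<..}"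
    have op: "open B1" "open B2" "open B3" using 1 2 by (auto simp: B1_def B2_def B3_def)
    have "0 < emeasure \<rho> B1" "0 < emeasure \<rho> B2" "0 < emeasure \<rho> B3"
      using good_open[OF x(1) op(1)] good_open[OF y(1) op(2)] good_open[OF z(1) op(3)] 1 2 p o
      by (auto simp: B1_def B2_def B3_def)
    moreover have s: "B1 \<in> sets \<rho>" "B2 \<in> sets \<rho>" "B3 \<in> sets \<rho>" using op by auto
    interpret P2: pair_prob_space \<rho> \<rho> by unfold_locales
    have "emeasure (\<rho> \<Otimes>\<^sub>M (\<rho> \<Otimes>\<^sub>M \<rho>)) (B1 \<times> (B2 \<times> B3)) = emeasure \<rho> B1 * (emeasure \<rho> B2 * emeasure \<rho> B3)"
      using s by (simp add: P2.P.emeasure_pair_measure_Times emeasure_pair_measure_Times del: events_eq_borel)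
    moreover have "emeasure (\<rho> \<Otimes>\<^sub>M (\<rho> \<Otimes>\<^sub>M \<rho>)) (B1 \<times> (B2 \<times> B3)) = 0"
    proof -
      have "AE r in \<rho> \<Otimes>\<^sub>M (\<rho> \<Otimes>\<^sub>M \<rho>). r \<notin> B1 \<times> (B2 \<times> B3)"
        using ineq
      proof eventually_elim
        case (elim r)
        obtain r1 r2 r3 where r: "r = (r1, r2, r3)" by (cases r) auto
        show ?case
        proof
          assume h: "r \<in> B1 \<times> (B2 \<times> B3)"
          hence "f r < 0" using 1 2 by (auto simp: B1_def B2_def B3_def W_def)
          thus False using elim h unfolding r f_def by (auto simp: B1_def B2_def B3_def)
        qed
      qed
      thus ?thesis using s by (subst (asm) AE_iff_measurable[OF _ refl]) (auto simp: space_pair_measure space_eq_univ)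
    qed
    ultimately show False by auto
  qed
  hence "0 \<le> (y + z) * (y * z * (z - y) - (x * (y\<^sup>2 + 5 * y * z + z\<^sup>2) + x ^ 3))"
    using condition_factor[of y z x] by (simp add: f_def)
  thus ?thesis using p by (simp add: aligned_def zero_le_mult_iff)
qed

section \<open>Optimality\<close>


lemma T_first_third: assumes "0 < F s" "F s < 1/3" shows "T s = G (2/3 - F s)" "F (T s) = 2/3 - F s" "s < s1" "s1 < T s"
    "T (T s) = G (2/3 + F s)" "s2 < T (T s)"
proof -
  have r: "regular s" using assms by (simp add: regular_def)
  show 1: "T s = G (2/3 - F s)" using T_eq_G_tau[OF r] assms by (simp add: tau_def)
  show 2: "F (T s) = 2/3 - F s" using F_T[OF r] assms by (simp add: tau_def)
  show "s < s1" "s1 < T s" using F_less F_s1 2 assms by simp_all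
  show "T (T s) = G (2/3 + F s)" using T_eq_G_tau[OF regular_T[OF r]] 2 assms by (simp add: tau_def)
  have "F (T (T s)) = 2/3 + F s" using F_T[OF regular_T[OF r]] 2 assms by (simp add: tau_def)
  thus "s2 < T (T s)" using F_less F_s2 assms by simp
qed

lemma T_second_third: assumes "1/3 < F s" "F s < 2/3" shows "T s = G (4/3 - F s)" "s1 < s" "s < s2" "s2 < T s"
proof -
  have r: "regular s" using assms by (simp add: regular_def)
  show 1: "T s = G (4/3 - F s)" using T_eq_G_tau[OF r] assms by (simp add: tau_def)
  have 2: "F (T s) = 4/3 - F s" using F_T[OF r] assms by (simp add: tau_def)
  show "s1 < s" "s < s2" "s2 < T s" using F_less F_s1 F_s2 2 assms by simp_all
qed

text \<open>The mixed derivative of \<open>1 / (x + y)\<close> is positive, which favours decreasing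
  couplings, and \<open>T\<close> is decreasing on the first third. Since \<open>T\<close> takes
  this third beyond \<open>s1\<close>, the derivative is bounded.\<close>

lemma potential_AB:
  obtains u B where "u \<in> borel_measurable borel" "\<And>x. \<bar>u x\<bar> \<le> B"
    "\<And>x t. 0 < F x \<Longrightarrow> F x < 1/3 \<Longrightarrow> 0 < F t \<Longrightarrow> F t < 1/3 \<Longrightarrow> u x + (1 / (t + T t) - u t) \<le> 1 / (x + T t)"
proof (rule pair_potential[of "{s. 0 < F s \<and> F s < 1/3}" s1 "\<lambda>x y. 1 / (x + y)" T "\<lambda>x y. - (1 / (x + y)\<^sup>2)" "1 / s1\<^sup>2"])
  show "{s. 0 < F s \<and> F s < 1/3} \<subseteq> {0..s1}"
  proof
    fix s assume "s \<in> {s. 0 < F s \<and> F s < 1/3}"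
    thus "s \<in> {0..s1}" using F_pos[of s] T_first_third(3)[of s] by auto
  qed
  show "{s. 0 < F s \<and> F s < 1/3} \<in> sets borel" by measurable
  show "(\<lambda>s. - (1 / (s + T s)\<^sup>2)) \<in> borel_measurable borel" by measurable
next
  fix a b s assume "a \<in> {s. 0 < F s \<and> F s < 1/3}" "b \<in> {s. 0 < F s \<and> F s < 1/3}" "a \<le> s" "s \<le> b"
  thus "s \<in> {s. 0 < F s \<and> F s < 1/3}" using F_mono[of a s] F_mono[of s b] by auto
next
  fix s t assume "s \<in> {s. 0 < F s \<and> F s < 1/3}" "t \<in> {s. 0 < F s \<and> F s < 1/3}"
  hence "0 < s + T t" using F_pos[of s] T_first_third(4)[of t] s1_pos by auto
  thus "((\<lambda>s. 1 / (s + T t)) has_real_derivative - (1 / (s + T t)\<^sup>2)) (at s)" by (intro recip_add_derivative) simp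
next
  fix s r t assume h: "s \<in> {s. 0 < F s \<and> F s < 1/3}" "r \<in> {s. 0 < F s \<and> F s < 1/3}" "t \<in> {s. 0 < F s \<and> F s < 1/3}" "r \<le> t"
  have "T t \<le> T r" using h T_first_third(1)[of r] T_first_third(1)[of t] F_mono[of r t] by (auto intro: G_mono)
  thus "- (1 / (s + T t)\<^sup>2) \<le> - (1 / (s + T r)\<^sup>2)"
    using recip_sq_mono[of "s + T t" "s + T r"] h F_pos[of s] T_first_third(4)[of t] s1_pos by auto
next
  fix s assume h: "s \<in> {s. 0 < F s \<and> F s < 1/3}"
  show "\<bar>- (1 / (s + T s)\<^sup>2)\<bar> \<le> 1 / s1\<^sup>2"
    using recip_sq_mono[of s1 "s + T s"] h F_pos[of s] T_first_third(4)[of s] s1_pos by auto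
next
  fix u B assume h: "u \<in> borel_measurable borel" "\<And>x. \<bar>u x\<bar> \<le> B"
    "\<And>x t. x \<in> {s. 0 < F s \<and> F s < 1/3} \<Longrightarrow> t \<in> {s. 0 < F s \<and> F s < 1/3} \<Longrightarrow> u x + (1 / (t + T t) - u t) \<le> 1 / (x + T t)"
  show thesis by (rule that[OF h(1,2) h(3)]) simp_all
qed

lemma potential_BC:
  obtains u B where "u \<in> borel_measurable borel" "\<And>x. \<bar>u x\<bar> \<le> B"
    "\<And>x t. 1/3 < F x \<Longrightarrow> F x < 2/3 \<Longrightarrow> 1/3 < F t \<Longrightarrow> F t < 2/3 \<Longrightarrow> u x + (1 / (t + T t) - u t) \<le> 1 / (x + T t)"
proof (rule pair_potential[of "{s. 1/3 < F s \<and> F s < 2/3}" s2 "\<lambda>x y. 1 / (x + y)" T "\<lambda>x y. - (1 / (x + y)\<^sup>2)" "1 / s1\<^sup>2"])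
  show "{s. 1/3 < F s \<and> F s < 2/3} \<subseteq> {0..s2}"
  proof
    fix s assume "s \<in> {s. 1/3 < F s \<and> F s < 2/3}"
    thus "s \<in> {0..s2}" using T_second_third(2,3)[of s] s1_pos by auto
  qed
  show "{s. 1/3 < F s \<and> F s < 2/3} \<in> sets borel" by measurable
  show "(\<lambda>s. - (1 / (s + T s)\<^sup>2)) \<in> borel_measurable borel" by measurable
next
  fix a b s assume "a \<in> {s. 1/3 < F s \<and> F s < 2/3}" "b \<in> {s. 1/3 < F s \<and> F s < 2/3}" "a \<le> s" "s \<le> b"
  thus "s \<in> {s. 1/3 < F s \<and> F s < 2/3}" using F_mono[of a s] F_mono[of s b] by auto
next
  fix s t assume "s \<in> {s. 1/3 < F s \<and> F s < 2/3}" "t \<in> {s. 1/3 < F s \<and> F s < 2/3}"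
  hence "0 < s + T t" using T_second_third(2)[of s] T_second_third(4)[of t] s1_pos s12 by auto
  thus "((\<lambda>s. 1 / (s + T t)) has_real_derivative - (1 / (s + T t)\<^sup>2)) (at s)" by (intro recip_add_derivative) simp
next
  fix s r t assume h: "s \<in> {s. 1/3 < F s \<and> F s < 2/3}" "r \<in> {s. 1/3 < F s \<and> F s < 2/3}"
    "t \<in> {s. 1/3 < F s \<and> F s < 2/3}" "r \<le> t"
  have "T t \<le> T r" using h T_second_third(1)[of r] T_second_third(1)[of t] F_mono[of r t] by (auto intro: G_mono)
  thus "- (1 / (s + T t)\<^sup>2) \<le> - (1 / (s + T r)\<^sup>2)"
    using recip_sq_mono[of "s + T t" "s + T r"] h T_second_third(2)[of s] T_second_third(4)[of t] s1_pos s12 by auto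
next
  fix s assume h: "s \<in> {s. 1/3 < F s \<and> F s < 2/3}"
  show "\<bar>- (1 / (s + T s)\<^sup>2)\<bar> \<le> 1 / s1\<^sup>2"
    using recip_sq_mono[of s1 "s + T s"] h T_second_third(2)[of s] T_second_third(4)[of s] s1_pos s12 by auto
next
  fix u B assume h: "u \<in> borel_measurable borel" "\<And>x. \<bar>u x\<bar> \<le> B"
    "\<And>x t. x \<in> {s. 1/3 < F s \<and> F s < 2/3} \<Longrightarrow> t \<in> {s. 1/3 < F s \<and> F s < 2/3} \<Longrightarrow> u x + (1 / (t + T t) - u t) \<le> 1 / (x + T t)"
  show thesis by (rule that[OF h(1,2) h(3)]) simp_all
qed

text \<open>For \<open>1 / (y - x)\<close> the mixed derivative is negative, which favours
  increasing couplings, and \<open>T\<close> applied twice is increasing on the first third. The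
  positive distance \<open>s2 - s1\<close> keeps the cost away from its singularity.\<close>

lemma potential_AC:
  obtains u B where "u \<in> borel_measurable borel" "\<And>x. \<bar>u x\<bar> \<le> B"
    "\<And>x t. 0 < F x \<Longrightarrow> F x < 1/3 \<Longrightarrow> 0 < F t \<Longrightarrow> F t < 1/3 \<Longrightarrow>
       u x + (1 / (T (T t) - t) - u t) \<le> 1 / (T (T t) - x)"
proof (rule pair_potential[of "{s. 0 < F s \<and> F s < 1/3}" s1 "\<lambda>x y. 1 / (y - x)" "\<lambda>x. T (T x)" "\<lambda>x y. 1 / (y - x)\<^sup>2" "1 / (s2 - s1)\<^sup>2"])
  show "{s. 0 < F s \<and> F s < 1/3} \<subseteq> {0..s1}"
  proof
    fix s assume "s \<in> {s. 0 < F s \<and> F s < 1/3}"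
    thus "s \<in> {0..s1}" using F_pos[of s] T_first_third(3)[of s] by auto
  qed
  show "{s. 0 < F s \<and> F s < 1/3} \<in> sets borel" by measurable
  show "(\<lambda>s. 1 / (T (T s) - s)\<^sup>2) \<in> borel_measurable borel" by measurable
next
  fix a b s assume "a \<in> {s. 0 < F s \<and> F s < 1/3}" "b \<in> {s. 0 < F s \<and> F s < 1/3}" "a \<le> s" "s \<le> b"
  thus "s \<in> {s. 0 < F s \<and> F s < 1/3}" using F_mono[of a s] F_mono[of s b] by auto
next
  fix s t assume "s \<in> {s. 0 < F s \<and> F s < 1/3}" "t \<in> {s. 0 < F s \<and> F s < 1/3}"
  hence "0 < T (T t) - s" using T_first_third(3)[of s] T_first_third(6)[of t] s12 by auto
  thus "((\<lambda>s. 1 / (T (T t) - s)) has_real_derivative 1 / (T (T t) - s)\<^sup>2) (at s)" by (intro recip_diff_derivative) simp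
next
  fix s r t assume h: "s \<in> {s. 0 < F s \<and> F s < 1/3}" "r \<in> {s. 0 < F s \<and> F s < 1/3}" "t \<in> {s. 0 < F s \<and> F s < 1/3}" "r \<le> t"
  have "T (T r) \<le> T (T t)" using h T_first_third(5)[of r] T_first_third(5)[of t] F_mono[of r t] by (auto intro: G_mono)
  thus "1 / (T (T t) - s)\<^sup>2 \<le> 1 / (T (T r) - s)\<^sup>2"
    using h T_first_third(3)[of s] T_first_third(6)[of r] s12 by (intro recip_sq_mono) auto
next
  fix s assume h: "s \<in> {s. 0 < F s \<and> F s < 1/3}"
  show "\<bar>1 / (T (T s) - s)\<^sup>2\<bar> \<le> 1 / (s2 - s1)\<^sup>2"
    using recip_sq_mono[of "s2 - s1" "T (T s) - s"] h T_first_third(3)[of s] T_first_third(6)[of s] s12 by auto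
next
  fix u B assume h: "u \<in> borel_measurable borel" "\<And>x. \<bar>u x\<bar> \<le> B"
    "\<And>x t. x \<in> {s. 0 < F s \<and> F s < 1/3} \<Longrightarrow> t \<in> {s. 0 < F s \<and> F s < 1/3} \<Longrightarrow> u x + (1 / (T (T t) - t) - u t) \<le> 1 / (T (T t) - x)"
  show thesis by (rule that[OF h(1,2) h(3)]) simp_all
qed

lemma kantorovich_potential:
  assumes ineq: "AE r in \<rho> \<Otimes>\<^sub>M (\<rho> \<Otimes>\<^sub>M \<rho>).
       (case r of (r1, r2, r3) \<Rightarrow>
         r1 \<in> {0..s1} \<and> r2 \<in> {s1..s2} \<and> r3 \<in> {s2..} \<longrightarrow>
         r2 * (r3 - r1)^3 - r1 * (r3 + r2)^3 - r3 * (r1 + r2)^3 \<ge> 0)"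
  obtains \<phi> K where "\<phi> \<in> borel_measurable borel" "\<And>x. x \<in> good_orbits \<Longrightarrow> \<bar>\<phi> x\<bar> \<le> K"
    "\<And>x y z. x \<in> good_orbits \<Longrightarrow> y \<in> good_orbits \<Longrightarrow> z \<in> good_orbits \<Longrightarrow> ennreal (\<phi> x + \<phi> y + \<phi> z) \<le> radial_cost (x, y, z)"
    "\<And>x. x \<in> good_orbits \<Longrightarrow> radial_cost (x, T x, T (T x)) = ennreal (\<phi> x + \<phi> (T x) + \<phi> (T (T x)))"
    "\<And>x. x \<in> good_orbits \<Longrightarrow> 0 \<le> \<phi> x + \<phi> (T x) + \<phi> (T (T x))"
proof -
  obtain u B1 where u [measurable]: "u \<in> borel_measurable borel" and uB: "\<And>x. \<bar>u x\<bar> \<le> B1" and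
    ui: "\<And>x t. 0 < F x \<Longrightarrow> F x < 1/3 \<Longrightarrow> 0 < F t \<Longrightarrow> F t < 1/3 \<Longrightarrow> u x + (1 / (t + T t) - u t) \<le> 1 / (x + T t)"
    using potential_AB by blast
  obtain v B2 where v [measurable]: "v \<in> borel_measurable borel" and vB: "\<And>x. \<bar>v x\<bar> \<le> B2" and
    vi: "\<And>x t. 1/3 < F x \<Longrightarrow> F x < 2/3 \<Longrightarrow> 1/3 < F t \<Longrightarrow> F t < 2/3 \<Longrightarrow> v x + (1 / (t + T t) - v t) \<le> 1 / (x + T t)"
    using potential_BC by blast
  obtain w B3 where w [measurable]: "w \<in> borel_measurable borel" and wB: "\<And>x. \<bar>w x\<bar> \<le> B3" and
    wi: "\<And>x t. 0 < F x \<Longrightarrow> F x < 1/3 \<Longrightarrow> 0 < F t \<Longrightarrow> F t < 1/3 \<Longrightarrow> w x + (1 / (T (T t) - t) - w t) \<le> 1 / (T (T t) - x)"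
    using potential_AC by blast
  \<comment> \<open>\<open>u\<close>, \<open>v\<close>, \<open>w\<close> belong to the pairs
    \<open>A, B\<close>, then \<open>B, C\<close>, then \<open>A, C\<close>. As \<open>T\<close> has
    order three, \<open>T (T y)\<close> is the partner in \<open>A\<close> of \<open>y\<close>,
    \<open>T z\<close> the partner in \<open>A\<close> of \<open>z\<close>, and
    \<open>T (T z)\<close> its partner in \<open>B\<close>.\<close>
  define fA where "fA x = u x + w x" for x
  define fB where "fB y = (1 / (T (T y) + y) - u (T (T y))) + v y" for y
  define fC where "fC z = (1 / (z - T z) - w (T z)) + (1 / (T (T z) + z) - v (T (T z)))" for z
  define A where "A = {x \<in> good_orbits. F x < 1/3}"
  define B where "B = {x \<in> good_orbits. 1/3 < F x \<and> F x < 2/3}"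
  define C where "C = {x \<in> good_orbits. 2/3 < F x}"
  have good_orbits: "good_orbits = A \<union> B \<union> C" using good_orbits_regular by (force simp: A_def B_def C_def regular_def)
  have AB: "T x \<in> B" if "x \<in> A" for x
    using that T_good_orbits good_orbits_F_T good_orbits_regular by (auto simp: A_def B_def tau_def regular_def)
  have BC: "T x \<in> C" if "x \<in> B" for x
    using that T_good_orbits good_orbits_F_T good_orbits_regular by (auto simp: B_def C_def tau_def regular_def)
  have CA: "T x \<in> A" if "x \<in> C" for x
    using that T_good_orbits good_orbits_F_T good_orbits_regular by (auto simp: A_def C_def tau_def regular_def)
  have T3: "T (T (T x)) = x" if "x \<in> A \<union> B \<union> C" for x using that good_orbits_T3 good_orbits by auto
  have FA: "0 < F x" "F x < 1/3" if "x \<in> A" for x using that good_orbits_regular by (auto simp: A_def regular_def)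
  have FB: "1/3 < F x" "F x < 2/3" if "x \<in> B" for x using that by (auto simp: B_def)
  have pos: "0 < x" if "x \<in> A \<union> B \<union> C" for x
    using that good_orbits good_orbits_regular F_pos by (auto simp: regular_def)
  have Q: "aligned x y z" if "x \<in> A" "y \<in> B" "z \<in> C" for x y z
    using that by (intro aligned_of_AE[OF ineq]) (auto simp: A_def B_def C_def good_orbits_def)
  have le: "fA x + fB y + fC z \<le> line_cost x y z" if "x \<in> A" "y \<in> B" "z \<in> C" for x y z
  proof -
    have "u x + (1 / (T (T y) + y) - u (T (T y))) \<le> 1 / (x + y)"
      using ui[of x "T (T y)"] FA[of x] FA[of "T (T y)"] CA[of "T y"] BC[of y] T3[of y] that by simp
    moreover have "w x + (1 / (z - T z) - w (T z)) \<le> 1 / (z - x)"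
      using wi[of x "T z"] FA[of x] FA[of "T z"] CA[of z] T3[of z] that by simp
    moreover have "v y + (1 / (T (T z) + z) - v (T (T z))) \<le> 1 / (y + z)"
      using vi[of y "T (T z)"] FB[of y] FB[of "T (T z)"] AB[of "T z"] CA[of z] T3[of z] that by simp
    ultimately show ?thesis unfolding fA_def fB_def fC_def line_cost_def by linarith
  qed
  have eq: "fA x + fB (T x) + fC (T (T x)) = line_cost x (T x) (T (T x))" if "x \<in> A" for x
    using T3[of x] that by (simp add: fA_def fB_def fC_def line_cost_def)
  obtain x0 where x0: "x0 \<in> good_orbits"
  proof -
    have "\<exists>x\<in>space \<rho>. x \<in> good_orbits"
    proof (rule ccontr)
      assume "\<not> ?thesis"
      hence "AE x in \<rho>. False" using AE_good_orbits by (auto elim: AE_mp)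
      thus False by simp
    qed
    thus ?thesis using that by blast
  qed
  have ne: "A \<noteq> {}" "B \<noteq> {}" "C \<noteq> {}" using x0 good_orbits AB BC CA by blast+
  obtain kA kB kC :: real where k0: "kA + kB + kC = 0" and
    k: "\<forall>\<phi>. (\<forall>x\<in>A. \<phi> x = fA x + kA) \<longrightarrow> (\<forall>x\<in>B. \<phi> x = fB x + kB) \<longrightarrow> (\<forall>x\<in>C. \<phi> x = fC x + kC) \<longrightarrow>
       (\<forall>x\<in>A \<union> B \<union> C. \<forall>y\<in>A \<union> B \<union> C. \<forall>z\<in>A \<union> B \<union> C. ennreal (\<phi> x + \<phi> y + \<phi> z) \<le> radial_cost (x, y, z))"
    using dual_feasible[OF ne pos Q le] by blast
  define \<phi> where "\<phi> x = (if F x < 1/3 then fA x + kA else if F x < 2/3 then fB x + kB else fC x + kC)" for x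
  have \<phi>A: "\<phi> x = fA x + kA" if "x \<in> A" for x using that by (simp add: \<phi>_def A_def)
  have \<phi>B: "\<phi> x = fB x + kB" if "x \<in> B" for x using that by (simp add: \<phi>_def B_def)
  have \<phi>C: "\<phi> x = fC x + kC" if "x \<in> C" for x using that by (simp add: \<phi>_def C_def)
  have gr: "radial_cost (x, T x, T (T x)) = ennreal (\<phi> x + \<phi> (T x) + \<phi> (T (T x)))"
     "0 \<le> \<phi> x + \<phi> (T x) + \<phi> (T (T x))" if x: "x \<in> A" for x
  proof -
    have e: "\<phi> x + \<phi> (T x) + \<phi> (T (T x)) = line_cost x (T x) (T (T x))"
      using eq[OF x] \<phi>A[OF x] \<phi>B[OF AB[OF x]] \<phi>C[OF BC[OF AB[OF x]]] k0 by linarith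
    have p: "0 < x" "0 < T x" "0 < T (T x)" using pos x AB BC by auto
    have q: "aligned x (T x) (T (T x))" using Q x AB BC by auto
    show "radial_cost (x, T x, T (T x)) = ennreal (\<phi> x + \<phi> (T x) + \<phi> (T (T x)))"
      unfolding e by (rule radial_cost_eq_line_cost[OF p q])
    show "0 \<le> \<phi> x + \<phi> (T x) + \<phi> (T (T x))" unfolding e line_cost_def using p aligned_props[OF p q] by simp
  qed
  \<comment> \<open>Starting in \<open>B\<close> or \<open>C\<close> permutes the same orbit
    cyclically, and both the cost and the sum of potentials are symmetric.\<close>
  have gr': "radial_cost (x, T x, T (T x)) = ennreal (\<phi> x + \<phi> (T x) + \<phi> (T (T x))) \<and>
     0 \<le> \<phi> x + \<phi> (T x) + \<phi> (T (T x))" if xO: "x \<in> good_orbits" for x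
  proof -
    consider "x \<in> A" | "x \<in> B" | "x \<in> C" using xO unfolding good_orbits by blast
    thus ?thesis
    proof cases
      case 1 thus ?thesis by (intro conjI gr)
    next
      case 2
      define a where "a = T (T x)"
      have a: "a \<in> A" "T a = x" using 2 BC CA T3[of x] by (auto simp: a_def)
      have "radial_cost (x, T x, a) = radial_cost (x, a, T x)" by (rule radial_cost_swap23)
      also have "\<dots> = radial_cost (a, x, T x)" by (rule radial_cost_swap12)
      finally have r: "radial_cost (x, T x, a) = radial_cost (a, x, T x)" .
      have s: "\<phi> x + \<phi> (T x) + \<phi> a = \<phi> a + \<phi> x + \<phi> (T x)" by simp
      show ?thesis unfolding a_def[symmetric] r s using gr[OF a(1)] unfolding a(2) by (rule conjI)
    next
      case 3
      define a where "a = T x"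
      have a: "a \<in> A" "T (T a) = x" using 3 CA T3[of x] by (auto simp: a_def)
      have "radial_cost (x, a, T a) = radial_cost (a, x, T a)" by (rule radial_cost_swap12)
      also have "\<dots> = radial_cost (a, T a, x)" by (rule radial_cost_swap23)
      finally have r: "radial_cost (x, a, T a) = radial_cost (a, T a, x)" .
      have s: "\<phi> x + \<phi> a + \<phi> (T a) = \<phi> a + \<phi> (T a) + \<phi> x" by simp
      show ?thesis unfolding a_def[symmetric] r s using gr[OF a(1)] unfolding a(2) by (rule conjI)
    qed
  qed
  define K where "K = B1 + B2 + B3 + 1 / s1 + 1 / (s2 - s1) + \<bar>kA\<bar> + \<bar>kB\<bar> + \<bar>kC\<bar>"
  have bound: "\<bar>\<phi> x\<bar> \<le> K" if xO: "x \<in> good_orbits" for x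
  proof -
    have B0: "0 \<le> B1" "0 \<le> B2" "0 \<le> B3" using uB[of 0] vB[of 0] wB[of 0] by linarith+
    have s0: "0 \<le> 1 / s1" "0 \<le> 1 / (s2 - s1)" using s1_pos s12 by auto
    have rs: "\<bar>1 / (a + b)\<bar> \<le> 1 / s1" if "0 < a" "s1 < b" for a b
    proof -
      have "1 / (a + b) \<le> 1 / s1" using that s1_pos by (intro divide_left_mono mult_pos_pos) auto
      thus ?thesis using that s1_pos by simp
    qed
    consider "x \<in> A" | "x \<in> B" | "x \<in> C" using xO unfolding good_orbits by blast
    thus ?thesis
    proof cases
      case 1
      show ?thesis using \<phi>A[OF 1] uB[of x] wB[of x] B0 s0 unfolding fA_def K_def by linarith
    next
      case 2
      have "\<bar>1 / (T (T x) + x)\<bar> \<le> 1 / s1"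
        using 2 BC CA pos T_second_third(2)[OF FB[OF 2]] by (intro rs) auto
      thus ?thesis using \<phi>B[OF 2] uB[of "T (T x)"] vB[of x] B0 s0 unfolding fB_def K_def by linarith
    next
      case 3
      have x2: "s2 < x" using 3 F_less F_s2 by (auto simp: C_def)
      have "\<bar>1 / (T (T x) + x)\<bar> \<le> 1 / s1" using 3 AB CA pos x2 s12 by (intro rs) auto
      moreover have "\<bar>1 / (x - T x)\<bar> \<le> 1 / (s2 - s1)"
      proof -
        have "s2 - s1 \<le> x - T x" using x2 T_first_third(3)[OF FA[OF CA[OF 3]]] by linarith
        hence "1 / (x - T x) \<le> 1 / (s2 - s1)" "0 \<le> 1 / (x - T x)"
          using s12 by (auto intro!: divide_left_mono mult_pos_pos)
        thus ?thesis by simp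
      qed
      ultimately show ?thesis using \<phi>C[OF 3] wB[of "T x"] vB[of "T (T x)"] B0 s0 unfolding fC_def K_def by linarith
    qed
  qed
  show ?thesis
  proof (rule that[of \<phi> K])
    show "\<phi> \<in> borel_measurable borel" unfolding \<phi>_def[abs_def] fA_def fB_def fC_def by measurable
    show "ennreal (\<phi> x + \<phi> y + \<phi> z) \<le> radial_cost (x, y, z)" if "x \<in> good_orbits" "y \<in> good_orbits" "z \<in> good_orbits" for x y z
      using that k[rule_format, of \<phi> x y z] \<phi>A \<phi>B \<phi>C unfolding good_orbits by simp
  qed (use bound gr' in auto)
qed

section \<open>Integrating the potential against plans\<close>

lemma DDI_plan_in_Pi3: "distr \<rho> borel (\<lambda>x. (x, T x, T (T x))) \<in> Pi3 \<rho>"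
proof -
  have m: "(\<lambda>x. (x, T x, T (T x))) \<in> \<rho> \<rightarrow>\<^sub>M borel" by (simp, measurable)
  have TT: "distr \<rho> borel (\<lambda>x. T (T x)) = \<rho>"
  proof -
    have "distr (distr \<rho> borel T) borel T = distr \<rho> borel (T \<circ> T)" by (rule distr_distr) simp_all
    thus ?thesis unfolding distr_T by (simp add: comp_def)
  qed
  have id: "distr \<rho> borel (\<lambda>x. x) = \<rho>" by (rule distr_id2[OF sets_rho[symmetric]])
  have d: "distr (distr \<rho> borel (\<lambda>x. (x, T x, T (T x)))) borel g = distr \<rho> borel (\<lambda>x. g (x, T x, T (T x)))"
    if "g \<in> borel_measurable borel" for g :: "real \<times> real \<times> real \<Rightarrow> real"
    using distr_distr[OF that m] by (simp add: comp_def)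
  note d3 = measurable_triple_proj[THEN d, simplified fst_conv snd_conv, unfolded id distr_T TT]
  show ?thesis unfolding Pi3_def using prob_space_distr[OF m] d3 by simp
qed

lemma Pi3_integral:
  fixes \<phi> :: "real \<Rightarrow> real"
  assumes \<gamma>: "\<gamma> \<in> Pi3 \<rho>" and \<phi> [measurable]: "\<phi> \<in> borel_measurable borel" and i: "integrable \<rho> \<phi>"
  shows "integrable \<gamma> (\<lambda>r. \<phi> (fst r) + \<phi> (fst (snd r)) + \<phi> (snd (snd r)))"
    "(\<integral>r. \<phi> (fst r) + \<phi> (fst (snd r)) + \<phi> (snd (snd r)) \<partial>\<gamma>) = 3 * (\<integral>x. \<phi> x \<partial>\<rho>)"
proof -
  have s: "sets \<gamma> = sets borel" and d: "distr \<gamma> borel (\<lambda>x. fst x) = \<rho>" "distr \<gamma> borel (\<lambda>x. fst (snd x)) = \<rho>"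
     "distr \<gamma> borel (\<lambda>x. snd (snd x)) = \<rho>" using \<gamma> by (auto simp: Pi3_def)
  have one: "integrable \<gamma> (\<lambda>r. \<phi> (g r)) \<and> (\<integral>r. \<phi> (g r) \<partial>\<gamma>) = (\<integral>x. \<phi> x \<partial>\<rho>)"
    if "g \<in> borel_measurable borel" "distr \<gamma> borel g = \<rho>" for g
  proof -
    have g: "g \<in> \<gamma> \<rightarrow>\<^sub>M borel" using that(1) measurable_cong_sets[OF s refl] by blast
    show ?thesis using integrable_distr_eq[OF g \<phi>] integral_distr[OF g \<phi>] that i by simp
  qed
  note f = one[OF measurable_triple_proj(1) d(1)] one[OF measurable_triple_proj(2) d(2)] one[OF measurable_triple_proj(3) d(3)]
  show "integrable \<gamma> (\<lambda>r. \<phi> (fst r) + \<phi> (fst (snd r)) + \<phi> (snd (snd r)))"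
    using f by simp
  show "(\<integral>r. \<phi> (fst r) + \<phi> (fst (snd r)) + \<phi> (snd (snd r)) \<partial>\<gamma>) = 3 * (\<integral>x. \<phi> x \<partial>\<rho>)"
    using f by simp
qed

end

text \<open>\<open>ennreal\<close> discards the negative part of \<open>f\<close>, which can only
  raise the integral.\<close>

lemma nn_integral_ennreal_ge:
  assumes "integrable M f" shows "ennreal (\<integral>x. f x \<partial>M) \<le> (\<integral>\<^sup>+x. ennreal (f x) \<partial>M)"
proof -
  have i: "integrable M (\<lambda>x. max 0 (f x))" using assms by auto
  have "ennreal (\<integral>x. f x \<partial>M) \<le> ennreal (\<integral>x. max 0 (f x) \<partial>M)"
    using assms i by (intro ennreal_leI integral_mono) auto
  also have "\<dots> = (\<integral>\<^sup>+x. ennreal (max 0 (f x)) \<partial>M)" using i by (intro nn_integral_eq_integral[symmetric]) auto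
  also have "\<dots> = (\<integral>\<^sup>+x. ennreal (f x) \<partial>M)" by (intro nn_integral_cong) (auto simp: max_def ennreal_neg)
  finally show ?thesis .
qed

theorem theorem1p2:
  fixes \<rho> :: "real measure" and s1 s2 :: real
  assumes sets_rho: "sets \<rho> = sets borel"
    and prob: "prob_space \<rho>"
    and supp: "emeasure \<rho> {..<0} = 0"
    and ac: "absolutely_continuous lborel \<rho>"
    and s12: "s1 < s2"
    and m1: "measure \<rho> {0..<s1} = 1/3"
    and m2: "measure \<rho> {s1..<s2} = 1/3"
    and m3: "measure \<rho> {s2..} = 1/3"
    and ineq: "AE r in \<rho> \<Otimes>\<^sub>M (\<rho> \<Otimes>\<^sub>M \<rho>).
       (case r of (r1, r2, r3) \<Rightarrow>
         r1 \<in> {0..s1} \<and> r2 \<in> {s1..s2} \<and> r3 \<in> {s2..} \<longrightarrow>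
         r2 * (r3 - r1)^3 - r1 * (r3 + r2)^3 - r3 * (r1 + r2)^3 \<ge> 0)"
  shows "distr \<rho> borel (\<lambda>x. (x, DDI \<rho> s1 s2 x, DDI \<rho> s1 s2 (DDI \<rho> s1 s2 x))) \<in> Pi3 \<rho>
       \<and> (\<integral>\<^sup>+ r. radial_cost r \<partial>(distr \<rho> borel (\<lambda>x. (x, DDI \<rho> s1 s2 x, DDI \<rho> s1 s2 (DDI \<rho> s1 s2 x)))))
         = (INF \<gamma>' \<in> Pi3 \<rho>. \<integral>\<^sup>+ r. radial_cost r \<partial>\<gamma>')"
proof -
  interpret ddi \<rho> s1 s2 using sets_rho prob supp ac s12 m1 m2 by (rule ddi.intro)
  obtain \<phi> K where \<phi> [measurable]: "\<phi> \<in> borel_measurable borel" and bd: "\<And>x. x \<in> good_orbits \<Longrightarrow> \<bar>\<phi> x\<bar> \<le> K"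
    and low: "\<And>x y z. x \<in> good_orbits \<Longrightarrow> y \<in> good_orbits \<Longrightarrow> z \<in> good_orbits \<Longrightarrow> ennreal (\<phi> x + \<phi> y + \<phi> z) \<le> radial_cost (x, y, z)"
    and eq: "\<And>x. x \<in> good_orbits \<Longrightarrow> radial_cost (x, T x, T (T x)) = ennreal (\<phi> x + \<phi> (T x) + \<phi> (T (T x)))"
    and nn: "\<And>x. x \<in> good_orbits \<Longrightarrow> 0 \<le> \<phi> x + \<phi> (T x) + \<phi> (T (T x))"
    using kantorovich_potential[OF ineq] by blast
  define \<Phi> where "\<Phi> r = \<phi> (fst r) + \<phi> (fst (snd r)) + \<phi> (snd (snd r))" for r
  define I where "I = 3 * (\<integral>x. \<phi> x \<partial>\<rho>)"
  define H where "H x = (x, T x, T (T x))" for x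
  have int: "integrable \<rho> \<phi>"
    by (rule integrable_const_bound[of _ K]) (use AE_good_orbits bd in \<open>auto elim: AE_mp\<close>)
  have P: "integrable \<gamma> \<Phi>" "(\<integral>r. \<Phi> r \<partial>\<gamma>) = I" if "\<gamma> \<in> Pi3 \<rho>" for \<gamma>
    using Pi3_integral[OF that \<phi> int] by (simp_all add: \<Phi>_def[abs_def] I_def)
  have ge: "ennreal I \<le> (\<integral>\<^sup>+ r. radial_cost r \<partial>\<gamma>)" if \<gamma>: "\<gamma> \<in> Pi3 \<rho>" for \<gamma>
  proof -
    have s: "sets \<gamma> = sets borel" and d: "distr \<gamma> borel (\<lambda>x. fst x) = \<rho>" "distr \<gamma> borel (\<lambda>x. fst (snd x)) = \<rho>"
     "distr \<gamma> borel (\<lambda>x. snd (snd x)) = \<rho>" using \<gamma> by (auto simp: Pi3_def)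
    have AEg: "AE r in \<gamma>. g r \<in> good_orbits" if "g \<in> borel_measurable borel" "distr \<gamma> borel g = \<rho>" for g
    proof (rule AE_distrD[of g \<gamma> borel "\<lambda>x. x \<in> good_orbits"])
      show "g \<in> \<gamma> \<rightarrow>\<^sub>M borel" using that(1) measurable_cong_sets[OF s refl] by blast
      show "AE x in distr \<gamma> borel g. x \<in> good_orbits" unfolding that(2) by (rule AE_good_orbits)
    qed
    have "AE r in \<gamma>. fst r \<in> good_orbits" "AE r in \<gamma>. fst (snd r) \<in> good_orbits" "AE r in \<gamma>. snd (snd r) \<in> good_orbits"
      by (rule AEg[OF measurable_triple_proj(1) d(1)] AEg[OF measurable_triple_proj(2) d(2)]
          AEg[OF measurable_triple_proj(3) d(3)])+
    hence "AE r in \<gamma>. ennreal (\<Phi> r) \<le> radial_cost r"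
    proof eventually_elim
      case (elim r)
      thus ?case using low[of "fst r" "fst (snd r)" "snd (snd r)"] by (simp add: \<Phi>_def)
    qed
    hence "(\<integral>\<^sup>+ r. ennreal (\<Phi> r) \<partial>\<gamma>) \<le> (\<integral>\<^sup>+ r. radial_cost r \<partial>\<gamma>)" by (rule nn_integral_mono_AE)
    moreover have "ennreal I \<le> (\<integral>\<^sup>+ r. ennreal (\<Phi> r) \<partial>\<gamma>)" using nn_integral_ennreal_ge[OF P(1)[OF \<gamma>]] P(2)[OF \<gamma>] by simp
    ultimately show ?thesis by (rule order_trans[rotated])
  qed
  have mem: "distr \<rho> borel H \<in> Pi3 \<rho>" unfolding H_def[abs_def] by (rule DDI_plan_in_Pi3)
  have [measurable]: "H \<in> borel \<rightarrow>\<^sub>M borel" unfolding H_def[abs_def] by measurable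
  have le: "(\<integral>\<^sup>+ r. radial_cost r \<partial>(distr \<rho> borel H)) \<le> ennreal I"
  proof -
    \<comment> \<open>Neither \<open>good_orbits\<close> nor \<open>radial_cost\<close> is shown to
      be measurable. A measurable null set \<open>N\<close> replaces the complement of the former,
      and \<open>E\<close>, a measurable description of the graph of \<open>H\<close> off
      \<open>N\<close>, carries the almost everywhere statements over to the image measure.\<close>
    obtain N where N: "N \<in> null_sets \<rho>" "{x \<in> space \<rho>. x \<notin> good_orbits} \<subseteq> N" using AE_good_orbits by (auto simp: eventually_ae_filter)
    have Ns [measurable]: "N \<in> sets borel" using N by auto
    define E where "E r \<longleftrightarrow> fst r \<notin> N \<and> r = H (fst r)" for r
    have "AE r in distr \<rho> borel H. E r"
    proof (subst AE_distr_iff)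
      show "AE x in \<rho>. E (H x)" using AE_not_in[OF N(1)] by eventually_elim (simp add: E_def H_def)
      show "{r \<in> space borel. E r} \<in> sets borel" unfolding E_def by measurable
    qed simp
    moreover have "radial_cost r = ennreal (\<Phi> r) \<and> 0 \<le> \<Phi> r" if "E r" for r
    proof -
      have "fst r \<in> good_orbits" using that N by (auto simp: E_def space_eq_univ)
      moreover have "r = (fst r, T (fst r), T (T (fst r)))" using that by (simp add: E_def H_def)
      ultimately show ?thesis using eq nn by (metis (no_types, lifting) \<Phi>_def fst_conv snd_conv)
    qed
    ultimately have 1: "AE r in distr \<rho> borel H. radial_cost r = ennreal (\<Phi> r)" and 2: "AE r in distr \<rho> borel H. 0 \<le> \<Phi> r"
      by (auto elim: AE_mp)
    have "(\<integral>\<^sup>+ r. radial_cost r \<partial>(distr \<rho> borel H)) = (\<integral>\<^sup>+ r. ennreal (\<Phi> r) \<partial>(distr \<rho> borel H))"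
      by (rule nn_integral_cong_AE[OF 1])
    also have "\<dots> = ennreal I" using nn_integral_eq_integral[OF P(1)[OF mem] 2] P(2)[OF mem] by simp
    finally show ?thesis by simp
  qed
  have "(\<integral>\<^sup>+ r. radial_cost r \<partial>(distr \<rho> borel H)) = (INF \<gamma>' \<in> Pi3 \<rho>. \<integral>\<^sup>+ r. radial_cost r \<partial>\<gamma>')"
  proof (rule antisym)
    show "(\<integral>\<^sup>+ r. radial_cost r \<partial>(distr \<rho> borel H)) \<le> (INF \<gamma>' \<in> Pi3 \<rho>. \<integral>\<^sup>+ r. radial_cost r \<partial>\<gamma>')"
      using le ge by (intro INF_greatest) (rule order_trans)
    show "(INF \<gamma>' \<in> Pi3 \<rho>. \<integral>\<^sup>+ r. radial_cost r \<partial>\<gamma>') \<le> (\<integral>\<^sup>+ r. radial_cost r \<partial>(distr \<rho> borel H))"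
      by (rule INF_lower[OF mem])
  qed
  thus ?thesis using mem unfolding H_def[abs_def] by simp
qed

end
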